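(* Let $M$ be a closed connected oriented smooth $2n$-manifold and $\rho$ a positive volume form on $M$. Let $v$ be a vector field on $M$. Then, for all $J\in\mathcal{J}(M)$, $$\Lambda_\rho(J,\mathcal{L}_vJ)=2\,\iota(v)\mathrm{Ric}_{\rho,J}-df_v\circ J+df_{Jv}.$$ Moreover, if $\mathbb{R}^2\to\mathcal{J}(M):(s,t)\mapsto J(s,t)$ is a smooth map, then $$\partial_s\Lambda_\rho(J,\partial_tJ)-\partial_t\Lambda_\rho(J,\partial_sJ)+\tfrac12\,d\,\mathrm{trace}\bigl((\partial_sJ)J(\partial_tJ)\bigr)=0.$$
   Context: $\mathcal{J}(M)$ is the space of almost complex structures on $M$ compatible with the orientation, and $\Omega^{0,1}_J(M,TM)=\{\hat J\in\Omega^0(M,\mathrm{End}(TM)) : \hat JJ+J\hat J=0\}$. For any vector field $u$ the function $f_u\in\Omega^0(M)$ is defined by $f_u\rho:=d\iota(u)\rho$. $\mathcal{L}_v$ is the usual Lie derivative. Let $\nabla$ be any torsion-free connection on $TM$ with $\nabla\rho=0$ (the following are independent of this choice), with usual curvature tensor $R^\nabla$. The Ricci form $\mathrm{Ric}_{\rho,J}\in\Omega^2(M)$ is $$\mathrm{Ric}_{\rho,J}(u,v):=\tfrac14\mathrm{trace}\bigl((\nabla_uJ)J(\nabla_vJ)\bigr)+\tfrac12\mathrm{trace}\bigl(JR^\nabla(u,v)\bigr)+\tfrac12 d\lambda^\nabla_J(u,v),$$ where $\lambda_J^\nabla(u):=\mathrm{trace}(w\mapsto(\nabla_wJ)u)$.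 For $\hat J\in\Omega^{0,1}_J(M,TM)$ the $1$-form $\Lambda_\rho(J,\hat J)\in\Omega^1(M)$ is $$(\Lambda_\rho(J,\hat J))(u):=\mathrm{trace}\bigl((\nabla\hat J)u+\tfrac12\hat JJ\nabla_uJ\bigr),$$ where $(\nabla\hat J)u$ denotes the endomorphism $w\mapsto(\nabla_w\hat J)u$. *)

theory Defs
  imports "HOL-Analysis.Analysis"
begin

section \<open>Smooth maps between normed spaces\<close>

primrec C_k_on :: "nat \<Rightarrow> 'e::real_normed_vector set \<Rightarrow> ('e \<Rightarrow> 'b::real_normed_vector) \<Rightarrow> bool" where
  "C_k_on 0 S f \<longleftrightarrow> continuous_on S f"
| "C_k_on (Suc k) S f \<longleftrightarrow> (\<forall>x\<in>S. f differentiable (at x)) \<and>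
     (\<forall>w. C_k_on k S (\<lambda>x. frechet_derivative f (at x) w))"

text \<open>Only used on open subsets of finite-dimensional spaces, where control of all iterated
  directional derivatives is the same as being infinitely differentiable.\<close>

definition smooth_on :: "'e::real_normed_vector set \<Rightarrow> ('e \<Rightarrow> 'b::real_normed_vector) \<Rightarrow> bool" where
  "smooth_on S f \<longleftrightarrow> (\<forall>k. C_k_on k S f)"


section \<open>Oriented smooth manifolds\<close>

text \<open>A chart is a pair of its domain and its coordinate map.\<close>

type_synonym ('a, 'n) chart = "'a set \<times> ('a \<Rightarrow> real^'n)"

abbreviation chart_dom :: "('a, 'n::finite) chart \<Rightarrow> 'a set" where
  "chart_dom c \<equiv> fst c"

abbreviation coord :: "('a, 'n::finite) chart \<Rightarrow> 'a \<Rightarrow> real^'n" where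
  "coord c \<equiv> snd c"

definition chart_inv :: "('a, 'n::finite) chart \<Rightarrow> real^'n \<Rightarrow> 'a" where
  "chart_inv c = inv_into (chart_dom c) (coord c)"

definition is_chart :: "'a topology \<Rightarrow> ('a, 'n::finite) chart \<Rightarrow> bool" where
  "is_chart M c \<longleftrightarrow> openin M (chart_dom c) \<and> open (coord c ` chart_dom c) \<and>
     homeomorphic_map (subtopology M (chart_dom c)) (top_of_set (coord c ` chart_dom c)) (coord c)"

definition transition :: "('a, 'n::finite) chart \<Rightarrow> ('a, 'n) chart \<Rightarrow> real^'n \<Rightarrow> real^'n" where
  "transition c c' = coord c' \<circ> chart_inv c"

definition oriented_smooth_atlas :: "'a topology \<Rightarrow> ('a, 'n::finite) chart set \<Rightarrow> bool" where
  "oriented_smooth_atlas M A \<longleftrightarrow>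
     (\<forall>c\<in>A. is_chart M c) \<and> (\<Union>c\<in>A. chart_dom c) = topspace M \<and>
     (\<forall>c\<in>A. \<forall>c'\<in>A.
        smooth_on (coord c ` (chart_dom c \<inter> chart_dom c')) (transition c c') \<and>
        (\<forall>y\<in>coord c ` (chart_dom c \<inter> chart_dom c').
           det (matrix (frechet_derivative (transition c c') (at y))) > 0))"

text \<open>The dimension of the manifold is the cardinality of the index type \<open>'n\<close>.\<close>

definition closed_connected_oriented_manifold ::
    "'a topology \<Rightarrow> ('a, 'n::finite) chart set \<Rightarrow> bool" where
  "closed_connected_oriented_manifold M A \<longleftrightarrow>
     Hausdorff_space M \<and> second_countable M \<and> compact_space M \<and> connected_space M \<and>
     oriented_smooth_atlas M A"


section \<open>Tangent spaces and tensor fields\<close>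

text \<open>At every point \<open>p\<close> a chart of the atlas around \<open>p\<close> is selected, and the tangent space at
  \<open>p\<close> is identified with \<open>real^'n\<close> by means of this chart.  So a vector field has type
  \<open>'a \<Rightarrow> real^'n\<close>, a field of endomorphisms of the tangent bundle has type \<open>'a \<Rightarrow> real^'n^'n\<close>,
  and a differential form of degree \<open>k\<close> takes a point and a list of \<open>k\<close> tangent vectors.  The
  selected chart changes from point to point in an uncontrolled manner; smoothness of a field is
  therefore always smoothness of its representative in each single chart of the atlas, not
  of the bare function.\<close>

definition chart_at :: "('a, 'n::finite) chart set \<Rightarrow> 'a \<Rightarrow> ('a, 'n) chart" where
  "chart_at A p = (SOME c. c \<in> A \<and> p \<in> chart_dom c)"

text \<open>The differential at \<open>q\<close> of the coordinate map of \<open>c\<close>, from the tangent space at \<open>q\<close> to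
  \<open>real^'n\<close>, and its inverse.\<close>

definition to_chart :: "('a, 'n::finite) chart set \<Rightarrow> ('a, 'n) chart \<Rightarrow> 'a \<Rightarrow> real^'n \<Rightarrow> real^'n" where
  "to_chart A c q = frechet_derivative (transition (chart_at A q) c) (at (coord (chart_at A q) q))"

definition from_chart :: "('a, 'n::finite) chart set \<Rightarrow> ('a, 'n) chart \<Rightarrow> 'a \<Rightarrow> real^'n \<Rightarrow> real^'n" where
  "from_chart A c q = frechet_derivative (transition c (chart_at A q)) (at (coord c q))"

definition vf_rep ::
    "('a, 'n::finite) chart set \<Rightarrow> ('a, 'n) chart \<Rightarrow> ('a \<Rightarrow> real^'n) \<Rightarrow> real^'n \<Rightarrow> real^'n" where
  "vf_rep A c X y = to_chart A c (chart_inv c y) (X (chart_inv c y))"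

definition endo_rep ::
    "('a, 'n::finite) chart set \<Rightarrow> ('a, 'n) chart \<Rightarrow> ('a \<Rightarrow> real^'n^'n) \<Rightarrow> real^'n \<Rightarrow> real^'n^'n" where
  "endo_rep A c J y =
     matrix (to_chart A c (chart_inv c y)) ** J (chart_inv c y) ** matrix (from_chart A c (chart_inv c y))"

definition smooth_fun :: "('a, 'n::finite) chart set \<Rightarrow> 'a set \<Rightarrow> ('a \<Rightarrow> real) \<Rightarrow> bool" where
  "smooth_fun A U f \<longleftrightarrow> (\<forall>c\<in>A. smooth_on (coord c ` (U \<inter> chart_dom c)) (f \<circ> chart_inv c))"

definition smooth_vf :: "('a, 'n::finite) chart set \<Rightarrow> 'a set \<Rightarrow> ('a \<Rightarrow> real^'n) \<Rightarrow> bool" where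
  "smooth_vf A U X \<longleftrightarrow> (\<forall>c\<in>A. smooth_on (coord c ` (U \<inter> chart_dom c)) (vf_rep A c X))"

definition smooth_endo :: "('a, 'n::finite) chart set \<Rightarrow> 'a set \<Rightarrow> ('a \<Rightarrow> real^'n^'n) \<Rightarrow> bool" where
  "smooth_endo A U J \<longleftrightarrow> (\<forall>c\<in>A. smooth_on (coord c ` (U \<inter> chart_dom c)) (endo_rep A c J))"

definition smooth_form ::
    "('a, 'n::finite) chart set \<Rightarrow> 'a set \<Rightarrow> nat \<Rightarrow> ('a \<Rightarrow> (real^'n) list \<Rightarrow> real) \<Rightarrow> bool" where
  "smooth_form A U k \<omega> \<longleftrightarrow> (\<forall>c\<in>A. \<forall>ws. length ws = k \<longrightarrow>
     smooth_on (coord c ` (U \<inter> chart_dom c))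
       (\<lambda>y. \<omega> (chart_inv c y) (map (from_chart A c (chart_inv c y)) ws)))"

definition alternating_multilinear :: "nat \<Rightarrow> ('v::real_vector list \<Rightarrow> real) \<Rightarrow> bool" where
  "alternating_multilinear k \<phi> \<longleftrightarrow>
     (\<forall>ws i. length ws = k \<longrightarrow> i < k \<longrightarrow> linear (\<lambda>w. \<phi> (ws[i := w]))) \<and>
     (\<forall>ws i j. length ws = k \<longrightarrow> i < j \<longrightarrow> j < k \<longrightarrow> ws ! i = ws ! j \<longrightarrow> \<phi> ws = 0)"

text \<open>A basis of \<open>real^'n\<close> is a list of vectors, whose orientation is the sign of the
  determinant below.  The index type carries no order, so an arbitrary enumeration of
  it is used to match list positions with coordinates; this fixes the standard orientation of the
  model space, and thereby of the manifold.\<close>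

definition frame_det :: "(real^'n::finite) list \<Rightarrow> real" where
  "frame_det ws = det (\<chi> i. ws ! to_nat_on (UNIV :: 'n set) i)"

definition positive_volume_form ::
    "'a topology \<Rightarrow> ('a, 'n::finite) chart set \<Rightarrow> ('a \<Rightarrow> (real^'n) list \<Rightarrow> real) \<Rightarrow> bool" where
  "positive_volume_form M A \<rho> \<longleftrightarrow>
     smooth_form A (topspace M) CARD('n) \<rho> \<and>
     (\<forall>p\<in>topspace M. alternating_multilinear CARD('n) (\<rho> p) \<and>
        (\<forall>ws. length ws = CARD('n) \<longrightarrow> frame_det ws > 0 \<longrightarrow> \<rho> p ws > 0))"

text \<open>Compatibility with the orientation: every complex basis \<open>w\<^sub>1, \<dots>, w\<^sub>n\<close> of a tangent space
  gives a positively oriented real basis \<open>w\<^sub>1, J w\<^sub>1, \<dots>, w\<^sub>n, J w\<^sub>n\<close>.\<close>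

definition almost_complex_structure ::
    "'a topology \<Rightarrow> ('a, 'n::finite) chart set \<Rightarrow> ('a \<Rightarrow> real^'n^'n) \<Rightarrow> bool" where
  "almost_complex_structure M A J \<longleftrightarrow>
     smooth_endo A (topspace M) J \<and>
     (\<forall>p\<in>topspace M. J p ** J p = - mat 1 \<and>
        (\<forall>ws. 2 * length ws = CARD('n) \<longrightarrow>
           frame_det (concat (map (\<lambda>w. [w, J p *v w]) ws)) \<noteq> 0 \<longrightarrow>
           frame_det (concat (map (\<lambda>w. [w, J p *v w]) ws)) > 0))"


section \<open>Differential calculus\<close>

definition dfun :: "('a, 'n::finite) chart set \<Rightarrow> ('a \<Rightarrow> real) \<Rightarrow> 'a \<Rightarrow> real^'n \<Rightarrow> real" where
  "dfun A f p w =
     frechet_derivative (f \<circ> chart_inv (chart_at A p)) (at (coord (chart_at A p) p)) w"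

text \<open>The extension of a tangent vector \<open>w\<close> at \<open>p\<close> to a vector field that has constant
  coefficients in the selected chart at \<open>p\<close>; meaningful on the domain of that chart.\<close>

definition const_ext :: "('a, 'n::finite) chart set \<Rightarrow> 'a \<Rightarrow> real^'n \<Rightarrow> 'a \<Rightarrow> real^'n" where
  "const_ext A p w q = from_chart A (chart_at A p) q w"

text \<open>Coordinate formula for the Lie bracket, with the convention \<open>[X,Y] f = X (Y f) - Y (X f)\<close>.\<close>

definition lie_bracket ::
    "('a, 'n::finite) chart set \<Rightarrow> ('a \<Rightarrow> real^'n) \<Rightarrow> ('a \<Rightarrow> real^'n) \<Rightarrow> 'a \<Rightarrow> real^'n" where
  "lie_bracket A X Y p = (let c = chart_at A p in
     frechet_derivative (vf_rep A c Y) (at (coord c p)) (X p) -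
     frechet_derivative (vf_rep A c X) (at (coord c p)) (Y p))"

text \<open>The field \<open>J X\<close>, and the Lie derivative of \<open>J\<close> given by
  \<open>(L\<^sub>v J) X = L\<^sub>v (J X) - J (L\<^sub>v X) = [v, J X] - J [v, X]\<close>.  This is tensorial in \<open>X\<close>, as are
  \<open>cov_endo_field\<close> and \<open>curvature_field\<close> below in their vector field arguments, so that the value on
  tangent vectors at \<open>p\<close> can be computed with any local extension of these vectors.\<close>

definition endo_app :: "('a \<Rightarrow> real^'n^'n) \<Rightarrow> ('a \<Rightarrow> real^'n) \<Rightarrow> 'a \<Rightarrow> real^'n::finite" where
  "endo_app J X = (\<lambda>q. J q *v X q)"

definition lie_endo ::
    "('a, 'n::finite) chart set \<Rightarrow> ('a \<Rightarrow> real^'n) \<Rightarrow> ('a \<Rightarrow> real^'n^'n) \<Rightarrow> 'a \<Rightarrow> real^'n^'n" where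
  "lie_endo A v J p = matrix (\<lambda>u.
     lie_bracket A v (endo_app J (const_ext A p u)) p - J p *v lie_bracket A v (const_ext A p u) p)"

text \<open>The exterior derivative
  \<open>d\<omega>(w\<^sub>0, \<dots>, w\<^sub>k) = \<Sum>\<^sub>i (-1)^i w\<^sub>i (\<omega>(w\<^sub>0, \<dots>, omit w\<^sub>i, \<dots>, w\<^sub>k))\<close>, where the vectors are extended with
  constant coefficients in a chart, so that the bracket terms of the invariant formula vanish.\<close>

definition ext_d ::
    "('a, 'n::finite) chart set \<Rightarrow> ('a \<Rightarrow> (real^'n) list \<Rightarrow> real) \<Rightarrow> 'a \<Rightarrow> (real^'n) list \<Rightarrow> real" where
  "ext_d A \<omega> p ws = (\<Sum>i<length ws. (-1) ^ i *
     dfun A (\<lambda>q. \<omega> q (map (\<lambda>w. const_ext A p w q) (take i ws @ drop (Suc i) ws))) p (ws ! i))"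

definition interior_product ::
    "('a \<Rightarrow> real^'n::finite) \<Rightarrow> ('a \<Rightarrow> (real^'n) list \<Rightarrow> real) \<Rightarrow> 'a \<Rightarrow> (real^'n) list \<Rightarrow> real" where
  "interior_product X \<omega> p ws = \<omega> p (X p # ws)"

text \<open>The function \<open>f\<^sub>u\<close> with \<open>f\<^sub>u \<rho> = d \<iota>(u) \<rho>\<close>.\<close>

definition divergence ::
    "('a, 'n::finite) chart set \<Rightarrow> ('a \<Rightarrow> (real^'n) list \<Rightarrow> real) \<Rightarrow> ('a \<Rightarrow> real^'n) \<Rightarrow> 'a \<Rightarrow> real" where
  "divergence A \<rho> u p =
     (THE r. \<forall>ws. length ws = CARD('n) \<longrightarrow> r * \<rho> p ws = ext_d A (interior_product u \<rho>) p ws)"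


section \<open>Connections\<close>

text \<open>\<open>D p w X\<close> is the covariant derivative at \<open>p\<close>, in the direction of the tangent vector \<open>w\<close>, of a
  vector field \<open>X\<close> which is smooth on some open neighbourhood of \<open>p\<close>.  The Leibniz rule for functions
  \<open>f\<close> that are smooth near \<open>p\<close> and arbitrary elsewhere makes it depend on \<open>X\<close> near \<open>p\<close> only, so these
  are exactly the usual affine connections, in their action on local vector fields.\<close>

type_synonym ('a, 'n) connection = "'a \<Rightarrow> real^'n \<Rightarrow> ('a \<Rightarrow> real^'n) \<Rightarrow> real^'n"

definition affine_connection ::
    "'a topology \<Rightarrow> ('a, 'n::finite) chart set \<Rightarrow> ('a, 'n) connection \<Rightarrow> bool" where
  "affine_connection M A D \<longleftrightarrow> (\<forall>U X Y. openin M U \<longrightarrow> smooth_vf A U X \<longrightarrow> smooth_vf A U Y \<longrightarrow>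
     smooth_vf A U (\<lambda>q. D q (X q) Y) \<and>
     (\<forall>p\<in>U. linear (\<lambda>w. D p w X) \<and>
        (\<forall>w. D p w (\<lambda>q. X q + Y q) = D p w X + D p w Y) \<and>
        (\<forall>f w. smooth_fun A U f \<longrightarrow>
           D p w (\<lambda>q. f q *\<^sub>R X q) = dfun A f p w *\<^sub>R X p + f p *\<^sub>R D p w X)))"

definition torsion_free ::
    "'a topology \<Rightarrow> ('a, 'n::finite) chart set \<Rightarrow> ('a, 'n) connection \<Rightarrow> bool" where
  "torsion_free M A D \<longleftrightarrow> (\<forall>U X Y. openin M U \<longrightarrow> smooth_vf A U X \<longrightarrow> smooth_vf A U Y \<longrightarrow>
     (\<forall>p\<in>U. D p (X p) Y - D p (Y p) X = lie_bracket A X Y p))"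

text \<open>\<open>\<nabla>\<rho> = 0\<close>, that is \<open>w (\<rho>(X\<^sub>1, \<dots>, X\<^sub>m)) = \<Sum>\<^sub>i \<rho>(X\<^sub>1, \<dots>, \<nabla>\<^sub>w X\<^sub>i, \<dots>, X\<^sub>m)\<close>.\<close>

definition parallel_form ::
    "'a topology \<Rightarrow> ('a, 'n::finite) chart set \<Rightarrow> ('a, 'n) connection \<Rightarrow> nat \<Rightarrow>
       ('a \<Rightarrow> (real^'n) list \<Rightarrow> real) \<Rightarrow> bool" where
  "parallel_form M A D k \<omega> \<longleftrightarrow>
     (\<forall>U Xs. openin M U \<longrightarrow> length Xs = k \<longrightarrow> (\<forall>X\<in>set Xs. smooth_vf A U X) \<longrightarrow>
        (\<forall>p\<in>U. \<forall>w. dfun A (\<lambda>q. \<omega> q (map (\<lambda>X. X q) Xs)) p w =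
           (\<Sum>i<k. \<omega> p ((map (\<lambda>X. X p) Xs)[i := D p w (Xs ! i)]))))"

text \<open>\<open>(\<nabla>\<^sub>w J) X = \<nabla>\<^sub>w (J X) - J (\<nabla>\<^sub>w X)\<close> at \<open>p\<close>.\<close>

definition cov_endo_field ::
    "('a, 'n::finite) connection \<Rightarrow> ('a \<Rightarrow> real^'n^'n) \<Rightarrow> 'a \<Rightarrow> real^'n \<Rightarrow> ('a \<Rightarrow> real^'n) \<Rightarrow> real^'n" where
  "cov_endo_field D J p w X = D p w (endo_app J X) - J p *v D p w X"

definition cov_endo ::
    "('a, 'n::finite) chart set \<Rightarrow> ('a, 'n) connection \<Rightarrow> ('a \<Rightarrow> real^'n^'n) \<Rightarrow> 'a \<Rightarrow> real^'n \<Rightarrow> real^'n^'n" where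
  "cov_endo A D J p w = matrix (\<lambda>u. cov_endo_field D J p w (const_ext A p u))"

definition curvature_field ::
    "('a, 'n::finite) chart set \<Rightarrow> ('a, 'n) connection \<Rightarrow>
       ('a \<Rightarrow> real^'n) \<Rightarrow> ('a \<Rightarrow> real^'n) \<Rightarrow> ('a \<Rightarrow> real^'n) \<Rightarrow> 'a \<Rightarrow> real^'n" where
  "curvature_field A D X Y Z p =
     D p (X p) (\<lambda>q. D q (Y q) Z) - D p (Y p) (\<lambda>q. D q (X q) Z) - D p (lie_bracket A X Y p) Z"

definition curvature ::
    "('a, 'n::finite) chart set \<Rightarrow> ('a, 'n) connection \<Rightarrow> 'a \<Rightarrow> real^'n \<Rightarrow> real^'n \<Rightarrow> real^'n^'n" where
  "curvature A D p u v =
     matrix (\<lambda>w. curvature_field A D (const_ext A p u) (const_ext A p v) (const_ext A p w) p)"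


section \<open>The Ricci form and the one-form \<open>\<Lambda>\<close>\<close>

text \<open>In all of the following, \<open>D\<close> is meant to be a torsion-free connection with \<open>D \<rho> = 0\<close>; the
  volume form enters through this condition only.\<close>

definition lambda_form ::
    "('a, 'n::finite) chart set \<Rightarrow> ('a, 'n) connection \<Rightarrow> ('a \<Rightarrow> real^'n^'n) \<Rightarrow> 'a \<Rightarrow> real^'n \<Rightarrow> real" where
  "lambda_form A D J p u = trace (matrix (\<lambda>w. cov_endo A D J p w *v u))"

definition ricci_form ::
    "('a, 'n::finite) chart set \<Rightarrow> ('a, 'n) connection \<Rightarrow> ('a \<Rightarrow> real^'n^'n) \<Rightarrow>
       'a \<Rightarrow> real^'n \<Rightarrow> real^'n \<Rightarrow> real" where
  "ricci_form A D J p u v =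
     1/4 * trace (cov_endo A D J p u ** J p ** cov_endo A D J p v) +
     1/2 * trace (J p ** curvature A D p u v) +
     1/2 * ext_d A (\<lambda>q ws. lambda_form A D J q (ws ! 0)) p [u, v]"

definition Lambda_form ::
    "('a, 'n::finite) chart set \<Rightarrow> ('a, 'n) connection \<Rightarrow> ('a \<Rightarrow> real^'n^'n) \<Rightarrow> ('a \<Rightarrow> real^'n^'n) \<Rightarrow>
       'a \<Rightarrow> real^'n \<Rightarrow> real" where
  "Lambda_form A D J H p u =
     trace (matrix (\<lambda>w. cov_endo A D H p w *v u) + (1/2) *\<^sub>R (H p ** J p ** cov_endo A D J p u))"


section \<open>Smooth two-parameter families\<close>

definition smooth_family ::
    "'a topology \<Rightarrow> ('a, 'n::finite) chart set \<Rightarrow> (real \<Rightarrow> real \<Rightarrow> 'a \<Rightarrow> real^'n^'n) \<Rightarrow> bool" where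
  "smooth_family M A J \<longleftrightarrow> (\<forall>c\<in>A.
     smooth_on (UNIV \<times> coord c ` (topspace M \<inter> chart_dom c))
       (\<lambda>((s, t), y). endo_rep A c (J s t) y))"

definition partial_s :: "(real \<Rightarrow> real \<Rightarrow> 'a \<Rightarrow> real^'n^'n::finite) \<Rightarrow> real \<Rightarrow> real \<Rightarrow> 'a \<Rightarrow> real^'n^'n" where
  "partial_s J s t p = vector_derivative (\<lambda>s'. J s' t p) (at s)"

definition partial_t :: "(real \<Rightarrow> real \<Rightarrow> 'a \<Rightarrow> real^'n^'n::finite) \<Rightarrow> real \<Rightarrow> real \<Rightarrow> 'a \<Rightarrow> real^'n^'n" where
  "partial_t J s t p = vector_derivative (\<lambda>t'. J s t' p) (at t)"

end

theory Submission
  imports Defs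
begin

text \<open>
  Everything is computed in the one chart \<open>c\<close> that the definitions select at the point \<open>p\<close>.  There
  the connection is \<open>\<nabla>\<^sub>w X = \<partial>\<^sub>w X + \<Gamma>\<^sub>w X\<close> with \<open>\<Gamma>\<^sub>w u = \<Gamma>\<^sub>u w\<close> because it is torsion-free, and
  \<open>trace \<Gamma>\<^sub>w = \<partial>\<^sub>w log h\<close> for the density \<open>h\<close> of \<open>\<rho>\<close> because \<open>\<nabla>\<rho> = 0\<close>; hence the curvature is traceless
  and \<open>f\<^sub>v = trace (\<nabla>v)\<close>.

  For the first identity, torsion-freeness gives \<open>L\<^sub>v J = \<nabla>\<^sub>v J + J (\<nabla>v) - (\<nabla>v) J\<close>.  One differentiates
  this once more, exchanges the order of differentiation by means of the Ricci identities for \<open>J\<close>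
  and \<open>v\<close>, and collects the curvature terms with the first Bianchi identity.

  For the second one, the terms with three derivatives of \<open>J\<close> cancel by symmetry of mixed partial
  derivatives, and what remains is a sum of traces of products of three endomorphisms that
  anticommute with \<open>J\<close>; such traces vanish.
\<close>

section \<open>Calculus of smooth maps\<close>

text \<open>A bare field is written at each point \<open>q\<close> in the chart selected at
  \<open>q\<close>, so even a smooth field need not be a smooth function near \<open>p\<close>.
  Whatever gets differentiated at \<open>p\<close> (L_v J, \<lambda>_J, the divergences, the family)
  must first be known in the fixed chart \<open_chart> at all nearby points. For scalars this works
  because a trace is unchanged under conjugation by the Jacobians \<open>to_chart\<close> and
  \<open>from_chart\<close>. The curvature is only evaluated, so it is needed at \<open>p\<close>
  alone.

  After that, each identity concerns finitely many matrices: values and derivatives at one point,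
  subject to symmetry relations.

  In the first identity, f_(Jv) = trace (\<nabla>(Jv)) = \<lambda>_J(v) + trace (J \<nabla>v); its
  differential removes the part of d\<lambda>_J(v,u) that differentiates along u. Bianchi leaves
  trace (R(Ju,v)), which is zero, and trace (J R(v,u)). The summand with factor 1/2 in \<Lambda>
  produces trace ((\<nabla>_u J)(\<nabla>v)), which cancels the same term left over from d trace (J
  \<nabla>v).

  In the second identity, s, t and the coordinates are treated as one variable, so a single symmetry
  lemma exchanges all derivatives.\<close>

lemmas C_k_on_Suc_iff = C_k_on.simps(2)

declare C_k_on.simps(2) [simp del]

lemma C_k_on_Suc_differentiable: "C_k_on (Suc k) S f \<Longrightarrow> x \<in> S \<Longrightarrow> f differentiable (at x)"
  by (simp add: C_k_on_Suc_iff)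

lemma C_k_on_Suc_frechet_derivative:
  "C_k_on (Suc k) S f \<Longrightarrow> C_k_on k S (\<lambda>x. frechet_derivative f (at x) w)"
  by (simp add: C_k_on_Suc_iff)

lemma C_k_on_Suc_imp: "C_k_on (Suc k) S f \<Longrightarrow> C_k_on k S f"
proof (induction k arbitrary: f)
  case 0
  then show ?case
    by (auto intro!: continuous_at_imp_continuous_on differentiable_imp_continuous_within simp: C_k_on_Suc_iff)
next
  case (Suc k)
  then have "f differentiable (at x)" if "x \<in> S" for x
    using that C_k_on_Suc_differentiable by blast
  moreover have "C_k_on k S (\<lambda>x. frechet_derivative f (at x) w)" for w
    by (rule Suc.IH[OF C_k_on_Suc_frechet_derivative[OF Suc.prems]])
  ultimately show ?case by (simp add: C_k_on_Suc_iff)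
qed

lemma C_k_on_cong:
  assumes "open S" "\<And>x. x \<in> S \<Longrightarrow> f x = g x" "C_k_on k S f"
  shows "C_k_on k S g"
  using assms(2,3)
proof (induction k arbitrary: f g)
  case 0
  then show ?case using continuous_on_cong[of S S f g] by simp
next
  case (Suc k)
  have der: "(g has_derivative frechet_derivative f (at x)) (at x)" if "x \<in> S" for x
    by (rule has_derivative_transform_within_open[OF
          frechet_derivative_works[THEN iffD1, OF C_k_on_Suc_differentiable[OF Suc.prems(2) that]] assms(1) that])
      (rule Suc.prems(1))
  then have "frechet_derivative f (at x) w = frechet_derivative g (at x) w" if "x \<in> S" for x w
    using frechet_derivative_at[OF der[OF that]] by simp
  then show ?case
    using Suc.IH[OF _ C_k_on_Suc_frechet_derivative[OF Suc.prems(2)]] der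
    by (metis C_k_on_Suc_iff differentiableI)
qed

text \<open>Any explicit derivative \<open>f'\<close> may be used: on the open set \<open>S\<close>
  it agrees with \<open>frechet_derivative\<close>, and \<open>C_k_on\<close> does not see values
  off \<open>S\<close>.\<close>

lemma C_k_on_SucI:
  assumes "open S" "\<And>x. x \<in> S \<Longrightarrow> (f has_derivative f' x) (at x)" "\<And>w. C_k_on k S (\<lambda>x. f' x w)"
  shows "C_k_on (Suc k) S f"
proof -
  have "C_k_on k S (\<lambda>x. frechet_derivative f (at x) w)" for w
    by (rule C_k_on_cong[OF assms(1) _ assms(3)]) (simp add: frechet_derivative_at[OF assms(2), symmetric])
  then show ?thesis using assms(2) by (auto simp: differentiable_def C_k_on_Suc_iff)
qed

lemma C_k_on_Suc_has_derivative:
  "C_k_on (Suc k) S f \<Longrightarrow> x \<in> S \<Longrightarrow> (f has_derivative frechet_derivative f (at x)) (at x)"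
  by (simp add: frechet_derivative_works C_k_on_Suc_iff)

lemma C_k_on_const: "C_k_on k S (\<lambda>x. c)"
  by (induction k arbitrary: c) (auto simp: C_k_on_Suc_iff)

lemma C_k_on_add:
  assumes "open S" "C_k_on k S f" "C_k_on k S g"
  shows "C_k_on k S (\<lambda>x. f x + g x)"
  using assms(2,3)
proof (induction k arbitrary: f g)
  case (Suc k)
  show ?case
    by (rule C_k_on_SucI[OF assms(1)])
      (use Suc in \<open>auto intro!: has_derivative_add C_k_on_Suc_has_derivative C_k_on_Suc_frechet_derivative\<close>)
qed (auto intro: continuous_intros)

lemma C_k_on_bounded_linear:
  assumes "bounded_linear l" "open S" "C_k_on k S f"
  shows "C_k_on k S (\<lambda>x. l (f x))"
  using assms(3)
proof (induction k arbitrary: f)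
  case 0
  then show ?case using bounded_linear.continuous_on[OF assms(1)] by simp
next
  case (Suc k)
  show ?case
    by (rule C_k_on_SucI[OF assms(2) bounded_linear.has_derivative[OF assms(1)
            C_k_on_Suc_has_derivative[OF Suc.prems]]])
      (auto intro: Suc.IH C_k_on_Suc_frechet_derivative[OF Suc.prems])
qed

text \<open>The product rule gives two terms of the same bilinear kind, hence the induction over
  \<open>f\<close> and \<open>g\<close> together; in each term one factor is differentiated and the
  other merely drops from \<open>Suc k\<close> to \<open>k\<close>.\<close>

lemma C_k_on_bounded_bilinear:
  assumes h: "bounded_bilinear h" and "open S" "C_k_on k S f" "C_k_on k S g"
  shows "C_k_on k S (\<lambda>x. h (f x) (g x))"
  using assms(3,4)
proof (induction k arbitrary: f g)
  case 0
  then show ?case using bounded_bilinear.continuous_on[OF h] by simp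
next
  case (Suc k)
  show ?case
  proof (rule C_k_on_SucI[OF assms(2)])
    show "((\<lambda>x. h (f x) (g x)) has_derivative
        (\<lambda>w. h (f x) (frechet_derivative g (at x) w) + h (frechet_derivative f (at x) w) (g x))) (at x)"
      if "x \<in> S" for x
      using Suc.prems that by (intro bounded_bilinear.FDERIV[OF h] C_k_on_Suc_has_derivative)
    show "C_k_on k S (\<lambda>x. h (f x) (frechet_derivative g (at x) w) + h (frechet_derivative f (at x) w) (g x))" for w
      by (intro C_k_on_add assms(2) Suc.IH Suc.prems[THEN C_k_on_Suc_imp]
          Suc.prems[THEN C_k_on_Suc_frechet_derivative])
  qed
qed

lemma C_k_on_sum:
  assumes "open S" "\<And>i. i \<in> I \<Longrightarrow> C_k_on k S (f i)"
  shows "C_k_on k S (\<lambda>x. \<Sum>i\<in>I. f i x)"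
  using assms(2)
  by (induction I rule: infinite_finite_induct) (auto intro: C_k_on_const C_k_on_add assms(1))

lemma frechet_derivative_Basis:
  fixes g :: "'b::euclidean_space \<Rightarrow> 'c::real_normed_vector"
  assumes "g differentiable (at y)"
  shows "frechet_derivative g (at y) w = (\<Sum>b\<in>Basis. (w \<bullet> b) *\<^sub>R frechet_derivative g (at y) b)"
proof -
  interpret linear "frechet_derivative g (at y)" by (rule linear_frechet_derivative[OF assms])
  have "frechet_derivative g (at y) (\<Sum>b\<in>Basis. (w \<bullet> b) *\<^sub>R b) = (\<Sum>b\<in>Basis. (w \<bullet> b) *\<^sub>R frechet_derivative g (at y) b)"
    by (simp add: sum scale)
  then show ?thesis by (simp add: euclidean_representation)
qed

text \<open>The chain rule evaluates the derivative of \<open>g\<close> in a direction that moves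
  with \<open>x\<close>, whereas \<open>C_k_on\<close> controls fixed directions only. Expanding the
  moving direction in the basis turns the derivative into a sum of products, to which the induction
  hypothesis applies.\<close>

lemma C_k_on_compose:
  fixes f :: "'a::real_normed_vector \<Rightarrow> 'b::euclidean_space" and g :: "'b \<Rightarrow> 'c::real_normed_vector"
  assumes "open S" "C_k_on k S f" "C_k_on k T g" "f ` S \<subseteq> T"
  shows "C_k_on k S (\<lambda>x. g (f x))"
  using assms(2,3)
proof (induction k arbitrary: g)
  case 0
  then show ?case using assms(4) by (auto intro: continuous_on_compose2)
next
  case (Suc k)
  have dg: "g differentiable (at (f x))" if "x \<in> S" for x using Suc.prems that assms(4) by (auto simp: C_k_on_Suc_iff)
  show ?case
  proof (rule C_k_on_SucI[OF assms(1)])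
    show "((\<lambda>x. g (f x)) has_derivative
        (\<lambda>w. frechet_derivative g (at (f x)) (frechet_derivative f (at x) w))) (at x)" if "x \<in> S" for x
      using has_derivative_compose[OF C_k_on_Suc_has_derivative[OF Suc.prems(1) that]] dg[OF that]
      by (simp add: frechet_derivative_works)
    fix w
    have "C_k_on k S (\<lambda>x. \<Sum>b\<in>Basis. (frechet_derivative f (at x) w \<bullet> b) *\<^sub>R frechet_derivative g (at (f x)) b)"
      by (intro C_k_on_sum C_k_on_bounded_bilinear[OF bounded_bilinear_scaleR]
          C_k_on_bounded_linear[OF bounded_linear_inner_left] Suc.IH assms(1)
          Suc.prems[THEN C_k_on_Suc_imp] Suc.prems[THEN C_k_on_Suc_frechet_derivative])
    then show "C_k_on k S (\<lambda>x. frechet_derivative g (at (f x)) (frechet_derivative f (at x) w))"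
      by (rule C_k_on_cong[OF assms(1), rotated]) (simp add: frechet_derivative_Basis[OF dg, symmetric])
  qed
qed

lemma smooth_on_cong:
  "open S \<Longrightarrow> (\<And>x. x \<in> S \<Longrightarrow> f x = g x) \<Longrightarrow> smooth_on S f \<longleftrightarrow> smooth_on S g"
  unfolding smooth_on_def using C_k_on_cong[of S f g] C_k_on_cong[of S g f] by auto

lemma smooth_on_transfer:
  "smooth_on S f \<Longrightarrow> open S \<Longrightarrow> (\<And>x. x \<in> S \<Longrightarrow> f x = g x) \<Longrightarrow> smooth_on S g"
  using smooth_on_cong by blast

lemma smooth_on_const: "smooth_on S (\<lambda>x. c)"
  by (simp add: smooth_on_def C_k_on_const)

lemma smooth_on_add:
  "open S \<Longrightarrow> smooth_on S f \<Longrightarrow> smooth_on S g \<Longrightarrow> smooth_on S (\<lambda>x. f x + g x)"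
  by (simp add: smooth_on_def C_k_on_add)

lemma smooth_on_bounded_linear:
  "bounded_linear l \<Longrightarrow> open S \<Longrightarrow> smooth_on S f \<Longrightarrow> smooth_on S (\<lambda>x. l (f x))"
  by (simp add: smooth_on_def C_k_on_bounded_linear)

lemma smooth_on_bounded_bilinear:
  "bounded_bilinear h \<Longrightarrow> open S \<Longrightarrow> smooth_on S f \<Longrightarrow> smooth_on S g \<Longrightarrow> smooth_on S (\<lambda>x. h (f x) (g x))"
  by (simp add: smooth_on_def C_k_on_bounded_bilinear)

lemma smooth_on_sum:
  "open S \<Longrightarrow> (\<And>i. i \<in> I \<Longrightarrow> smooth_on S (f i)) \<Longrightarrow> smooth_on S (\<lambda>x. \<Sum>i\<in>I. f i x)"
  by (simp add: smooth_on_def C_k_on_sum)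

lemma smooth_on_compose:
  fixes f :: "'a::real_normed_vector \<Rightarrow> 'b::euclidean_space"
  shows "open S \<Longrightarrow> smooth_on S f \<Longrightarrow> smooth_on T g \<Longrightarrow> f ` S \<subseteq> T \<Longrightarrow> smooth_on S (\<lambda>x. g (f x))"
  by (auto simp: smooth_on_def intro: C_k_on_compose)

lemma smooth_on_minus: "open S \<Longrightarrow> smooth_on S f \<Longrightarrow> smooth_on S (\<lambda>x. - f x)"
  by (rule smooth_on_bounded_linear[OF bounded_linear_minus[OF bounded_linear_ident]])

lemma smooth_on_diff:
  "open S \<Longrightarrow> smooth_on S f \<Longrightarrow> smooth_on S g \<Longrightarrow> smooth_on S (\<lambda>x. f x - g x)"
  using smooth_on_add[of S f "\<lambda>x. - g x"] by (simp add: smooth_on_minus)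

lemma smooth_on_subset: "smooth_on S f \<Longrightarrow> T \<subseteq> S \<Longrightarrow> smooth_on T f"
proof -
  have "C_k_on k S f \<Longrightarrow> T \<subseteq> S \<Longrightarrow> C_k_on k T f" for k
    by (induction k arbitrary: f) (auto intro: continuous_on_subset simp: C_k_on_Suc_iff)
  then show "smooth_on S f \<Longrightarrow> T \<subseteq> S \<Longrightarrow> smooth_on T f" by (auto simp: smooth_on_def)
qed

lemma smooth_on_has_derivative:
  "smooth_on S f \<Longrightarrow> x \<in> S \<Longrightarrow> (f has_derivative frechet_derivative f (at x)) (at x)"
  unfolding smooth_on_def by (meson C_k_on_Suc_has_derivative)

lemma smooth_on_differentiable: "smooth_on S f \<Longrightarrow> x \<in> S \<Longrightarrow> f differentiable (at x)"
  using smooth_on_has_derivative by (auto simp: differentiable_def)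

lemma smooth_on_linear: "smooth_on S f \<Longrightarrow> x \<in> S \<Longrightarrow> linear (frechet_derivative f (at x))"
  by (simp add: linear_frechet_derivative smooth_on_differentiable)

lemma smooth_on_frechet_derivative:
  "smooth_on S f \<Longrightarrow> smooth_on S (\<lambda>x. frechet_derivative f (at x) w)"
  by (simp add: smooth_on_def C_k_on_Suc_frechet_derivative)

lemma smooth_on_bounded_linear_map:
  assumes "bounded_linear l" "open S" shows "smooth_on S l"
proof -
  have "C_k_on k S l" for k
  proof (cases k)
    case 0
    then show ?thesis using assms(1) by (simp add: linear_continuous_on)
  next
    case (Suc j)
    show ?thesis unfolding Suc
      by (rule C_k_on_SucI[OF assms(2)]) (auto intro: bounded_linear_imp_has_derivative assms(1) C_k_on_const)
  qed
  then show ?thesis by (simp add: smooth_on_def)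
qed

lemma smooth_on_vec:
  fixes f :: "'a::real_normed_vector \<Rightarrow> ('b::euclidean_space)^'n"
  assumes "open S" "\<And>i. smooth_on S (\<lambda>x. f x $ i)"
  shows "smooth_on S f"
proof -
  have bl: "bounded_linear (axis i :: 'b \<Rightarrow> 'b^'n)" for i
    by (auto intro!: linear_linear[THEN iffD2] linearI simp: axis_def vec_eq_iff)
  have "smooth_on S (\<lambda>x. \<Sum>i\<in>UNIV. axis i (f x $ i) :: 'b^'n)"
    by (intro smooth_on_sum assms smooth_on_bounded_linear[OF bl])
  moreover have "(\<Sum>i\<in>UNIV. axis i (f x $ i)) = f x" for x
    by (simp add: vec_eq_iff axis_def if_distrib sum.delta cong: if_cong)
  ultimately show ?thesis by simp
qed

text \<open>Differentiability need not be checked: if neither function is differentiable, both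
  choice predicates are everywhere false and the chosen values coincide.\<close>

lemma frechet_derivative_cong_open:
  assumes "open S" "x \<in> S" "\<And>y. y \<in> S \<Longrightarrow> f y = g y"
  shows "frechet_derivative f (at x) = frechet_derivative g (at x)"
proof (cases "f differentiable (at x) \<or> g differentiable (at x)")
  case True
  then show ?thesis
    using frechet_derivative_transform_within_open[of f x S g]
      frechet_derivative_transform_within_open[of g x S f] assms by metis
next
  case False
  then have "(f has_derivative f') (at x) \<longleftrightarrow> (g has_derivative f') (at x)" for f'
    by (auto simp: differentiable_def)
  then show ?thesis by (simp add: frechet_derivative_def)
qed

section \<open>Symmetry of second derivatives\<close>

text \<open>The mean value theorem is applied twice, first along \<open>v\<close> to a difference in
  direction \<open>w\<close>, then along \<open>w\<close>. The left-hand side is symmetric in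
  \<open>v\<close> and \<open>w\<close>, which is what the next lemma exploits.\<close>

lemma second_difference_mvt:
  fixes g :: "'a::real_normed_vector \<Rightarrow> real"
  assumes g: "smooth_on S g" and h: "h > 0"
    and S: "\<And>s t. 0 \<le> s \<Longrightarrow> s \<le> h \<Longrightarrow> 0 \<le> t \<Longrightarrow> t \<le> h \<Longrightarrow> x + s *\<^sub>R v + t *\<^sub>R w \<in> S"
  shows "\<exists>s t. 0 < s \<and> s < h \<and> 0 < t \<and> t < h \<and>
    g (x + h *\<^sub>R v + h *\<^sub>R w) - g (x + h *\<^sub>R v) - g (x + h *\<^sub>R w) + g x =
    h * h * frechet_derivative (\<lambda>y. frechet_derivative g (at y) v) (at (x + s *\<^sub>R v + t *\<^sub>R w)) w"
proof -
  define g' where "g' = (\<lambda>y. frechet_derivative g (at y) v)"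
  have d: "((\<lambda>s. f (a + s *\<^sub>R u)) has_real_derivative frechet_derivative f (at (a + s *\<^sub>R u)) u) (at s)"
    if "smooth_on S f" "a + s *\<^sub>R u \<in> S" for f :: "'a \<Rightarrow> real" and a u s
  proof -
    have D: "(f has_derivative frechet_derivative f (at (a + s *\<^sub>R u))) (at (a + s *\<^sub>R u))"
      using that by (rule smooth_on_has_derivative)
    have "((\<lambda>s. a + s *\<^sub>R u) has_derivative (\<lambda>r. r *\<^sub>R u)) (at s)"
      by (auto intro!: derivative_eq_intros)
    then have "((\<lambda>s. f (a + s *\<^sub>R u)) has_derivative (\<lambda>r. frechet_derivative f (at (a + s *\<^sub>R u)) (r *\<^sub>R u))) (at s)"
      using D diff_chain_at[of "\<lambda>s. a + s *\<^sub>R u" "\<lambda>r. r *\<^sub>R u" s, OF _ D]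
      by (simp add: o_def)
    moreover have "(\<lambda>r. frechet_derivative f (at (a + s *\<^sub>R u)) (r *\<^sub>R u)) = (*) (frechet_derivative f (at (a + s *\<^sub>R u)) u)"
      by (simp add: fun_eq_iff linear_scale[OF smooth_on_linear[OF that]] mult.commute)
    ultimately show ?thesis
      by (simp add: has_field_derivative_def)
  qed
  have "\<exists>s>0. s < h \<and> (g ((x + h *\<^sub>R w) + h *\<^sub>R v) - g (x + h *\<^sub>R v)) - (g ((x + h *\<^sub>R w) + 0 *\<^sub>R v) - g (x + 0 *\<^sub>R v))
      = (h - 0) * (g' ((x + h *\<^sub>R w) + s *\<^sub>R v) - g' (x + s *\<^sub>R v))"
  proof (rule MVT2[OF h])
    fix s assume "0 \<le> s" "s \<le> h"
    then show "((\<lambda>s. g ((x + h *\<^sub>R w) + s *\<^sub>R v) - g (x + s *\<^sub>R v)) has_real_derivative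
        (g' ((x + h *\<^sub>R w) + s *\<^sub>R v) - g' (x + s *\<^sub>R v))) (at s)"
      unfolding g'_def using S[of s h] S[of s 0] h
      by (intro DERIV_diff d[OF g]) (simp_all add: algebra_simps)
  qed
  then obtain s where s: "0 < s" "s < h" and
    e1: "g (x + h *\<^sub>R v + h *\<^sub>R w) - g (x + h *\<^sub>R v) - g (x + h *\<^sub>R w) + g x
      = h * (g' (x + s *\<^sub>R v + h *\<^sub>R w) - g' (x + s *\<^sub>R v))"
    by (auto simp: algebra_simps)
  have "\<exists>t>0. t < h \<and> g' ((x + s *\<^sub>R v) + h *\<^sub>R w) - g' ((x + s *\<^sub>R v) + 0 *\<^sub>R w)
      = (h - 0) * frechet_derivative g' (at ((x + s *\<^sub>R v) + t *\<^sub>R w)) w"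
    by (rule MVT2[OF h], rule d)
      (use S s in \<open>auto simp: g'_def smooth_on_frechet_derivative[OF g]\<close>)
  then obtain t where t: "0 < t" "t < h" and
    e2: "g' (x + s *\<^sub>R v + h *\<^sub>R w) - g' (x + s *\<^sub>R v)
      = h * frechet_derivative g' (at (x + s *\<^sub>R v + t *\<^sub>R w)) w"
    by auto
  show ?thesis
    by (rule exI[of _ s], rule exI[of _ t]) (use s t e1 e2 in \<open>simp add: g'_def\<close>)
qed

text \<open>Each mixed derivative, at some point near \<open>x\<close>, equals the same second
  difference divided by \<open>h * h\<close>. Both are continuous at \<open>x\<close>, so a gap
  between them is impossible.\<close>

lemma frechet_derivative_symmetric_real:
  fixes g :: "'a::real_normed_vector \<Rightarrow> real"
  assumes "open S" "smooth_on S g" "x \<in> S"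
  shows "frechet_derivative (\<lambda>y. frechet_derivative g (at y) v) (at x) w =
         frechet_derivative (\<lambda>y. frechet_derivative g (at y) w) (at x) v" (is "?a x = ?b x")
proof (rule ccontr)
  assume ne: "?a x \<noteq> ?b x"
  \<comment> \<open>Half the gap: the \<open>e\<close>-neighbourhoods of the two values are then
    disjoint.\<close>
  define e where "e = \<bar>?a x - ?b x\<bar> / 2"
  have e: "e > 0" using ne by (simp add: e_def)
  have ca: "isCont ?a x" and cb: "isCont ?b x"
    using smooth_on_differentiable[OF smooth_on_frechet_derivative[OF smooth_on_frechet_derivative[OF assms(2)]] assms(3)]
    by (auto intro: differentiable_imp_continuous_within)
  obtain d1 where d1: "d1 > 0" "\<And>y. dist y x < d1 \<Longrightarrow> \<bar>?a y - ?a x\<bar> < e"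
    using ca e unfolding continuous_at_eps_delta dist_real_def by metis
  obtain d2 where d2: "d2 > 0" "\<And>y. dist y x < d2 \<Longrightarrow> \<bar>?b y - ?b x\<bar> < e"
    using cb e unfolding continuous_at_eps_delta dist_real_def by metis
  obtain d3 where d3: "d3 > 0" "ball x d3 \<subseteq> S" using assms(1,3) openE by blast
  define d where "d = min d1 (min d2 d3)"
  \<comment> \<open>The summand 1 keeps the denominator positive; the whole parallelogram with sides
    \<open>h *\<^sub>R v\<close> and \<open>h *\<^sub>R w\<close> stays within distance
    \<open>d\<close> of \<open>x\<close>.\<close>
  define h where "h = d / (norm v + norm w + 1) / 2"
  have d: "d > 0" using d1 d2 d3 by (simp add: d_def)
  have nz: "norm v + norm w + 1 > 0" by (simp add: add_nonneg_pos)
  have h: "h > 0" using d nz by (simp add: h_def)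
  have close: "dist (x + s *\<^sub>R a + t *\<^sub>R b) x < d" if "0 \<le> s" "s \<le> h" "0 \<le> t" "t \<le> h"
    "a = v \<and> b = w \<or> a = w \<and> b = v" for s t a b
  proof -
    have "dist (x + s *\<^sub>R a + t *\<^sub>R b) x \<le> s * norm a + t * norm b"
      using norm_triangle_ineq[of "s *\<^sub>R a" "t *\<^sub>R b"] that by (simp add: dist_norm)
    also have "\<dots> \<le> h * norm a + h * norm b"
      using that by (intro add_mono mult_right_mono) auto
    also have "\<dots> = h * (norm v + norm w)" using that(5) by (auto simp: algebra_simps)
    also have "\<dots> < h * (norm v + norm w + 1) * 2" using mult_pos_pos[OF h nz] h by (simp add: algebra_simps)
    also have "\<dots> = d" using nz unfolding h_def by (simp only: divide_inverse) (simp add: field_simps)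
    finally show ?thesis .
  qed
  have inS: "x + s *\<^sub>R a + t *\<^sub>R b \<in> S" if "0 \<le> s" "s \<le> h" "0 \<le> t" "t \<le> h"
    "a = v \<and> b = w \<or> a = w \<and> b = v" for s t a b
    using close[OF that] d3(2) by (auto simp: d_def dist_commute)
  obtain s t where st: "0 < s" "s < h" "0 < t" "t < h" and
    1: "g (x + h *\<^sub>R v + h *\<^sub>R w) - g (x + h *\<^sub>R v) - g (x + h *\<^sub>R w) + g x = h * h * ?a (x + s *\<^sub>R v + t *\<^sub>R w)"
    using second_difference_mvt[OF assms(2) h, of x v w] inS by blast
  obtain s' t' where st': "0 < s'" "s' < h" "0 < t'" "t' < h" and
    2: "g (x + h *\<^sub>R w + h *\<^sub>R v) - g (x + h *\<^sub>R w) - g (x + h *\<^sub>R v) + g x = h * h * ?b (x + s' *\<^sub>R w + t' *\<^sub>R v)"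
    using second_difference_mvt[OF assms(2) h, of x w v] inS by blast
  have "h * h * ?a (x + s *\<^sub>R v + t *\<^sub>R w) = h * h * ?b (x + s' *\<^sub>R w + t' *\<^sub>R v)"
    using 1 2 by (simp add: algebra_simps)
  then have eq: "?a (x + s *\<^sub>R v + t *\<^sub>R w) = ?b (x + s' *\<^sub>R w + t' *\<^sub>R v)" using h by simp
  have "\<bar>?a (x + s *\<^sub>R v + t *\<^sub>R w) - ?a x\<bar> < e"
    by (rule d1) (use close[of s t v w] st in \<open>auto simp: d_def\<close>)
  moreover have "\<bar>?b (x + s' *\<^sub>R w + t' *\<^sub>R v) - ?b x\<bar> < e"
    by (rule d2) (use close[of s' t' w v] st' in \<open>auto simp: d_def\<close>)
  ultimately show False using eq by (auto simp: e_def abs_if split: if_splits)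
qed

lemma frechet_derivative_symmetric:
  fixes f :: "'a::real_normed_vector \<Rightarrow> 'b::euclidean_space"
  assumes "open S" "smooth_on S f" "x \<in> S"
  shows "frechet_derivative (\<lambda>y. frechet_derivative f (at y) v) (at x) w =
         frechet_derivative (\<lambda>y. frechet_derivative f (at y) w) (at x) v"
proof (rule euclidean_eqI)
  fix b :: 'b assume "b \<in> Basis"
  have inner: "frechet_derivative (\<lambda>y. g y \<bullet> b) (at y) u = frechet_derivative g (at y) u \<bullet> b"
    if "smooth_on S g" "y \<in> S" for g :: "'a \<Rightarrow> 'b" and y u
    using frechet_derivative_at[OF bounded_linear.has_derivative[OF bounded_linear_inner_left
        smooth_on_has_derivative[OF that]]] by metis
  have twice: "frechet_derivative (\<lambda>y. frechet_derivative f (at y) u) (at x) z \<bullet> b =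
      frechet_derivative (\<lambda>y. frechet_derivative (\<lambda>y. f y \<bullet> b) (at y) u) (at x) z" for u z
  proof -
    have "frechet_derivative (\<lambda>y. frechet_derivative (\<lambda>y. f y \<bullet> b) (at y) u) (at x) =
        frechet_derivative (\<lambda>y. frechet_derivative f (at y) u \<bullet> b) (at x)"
      by (rule frechet_derivative_cong_open[OF assms(1,3)]) (rule inner[OF assms(2)])
    then show ?thesis by (simp add: inner[OF smooth_on_frechet_derivative[OF assms(2)] assms(3)])
  qed
  have "smooth_on S (\<lambda>y. f y \<bullet> b)"
    by (rule smooth_on_bounded_linear[OF bounded_linear_inner_left assms(1,2)])
  from frechet_derivative_symmetric_real[OF assms(1) this assms(3)]
  show "frechet_derivative (\<lambda>y. frechet_derivative f (at y) v) (at x) w \<bullet> b =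
      frechet_derivative (\<lambda>y. frechet_derivative f (at y) w) (at x) v \<bullet> b"
    by (simp add: twice)
qed

section \<open>Rules for derivatives, linear families and partial derivatives\<close>

lemma frechet_derivative_bilinear:
  assumes "bounded_bilinear h" "f differentiable (at x)" "g differentiable (at x)"
  shows "frechet_derivative (\<lambda>y. h (f y) (g y)) (at x) w =
    h (f x) (frechet_derivative g (at x) w) + h (frechet_derivative f (at x) w) (g x)"
  using frechet_derivative_at[OF bounded_bilinear.FDERIV[OF assms(1)
        assms(2)[unfolded frechet_derivative_works] assms(3)[unfolded frechet_derivative_works]]] by metis

lemma frechet_derivative_bounded_linear:
  assumes "bounded_linear l" "f differentiable (at x)"
  shows "frechet_derivative (\<lambda>y. l (f y)) (at x) w = l (frechet_derivative f (at x) w)"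
  using frechet_derivative_at[OF bounded_linear.has_derivative[OF assms(1)
        assms(2)[unfolded frechet_derivative_works]]] by metis

lemma frechet_derivative_plus:
  assumes "f differentiable (at x)" "g differentiable (at x)"
  shows "frechet_derivative (\<lambda>y. f y + g y) (at x) w = frechet_derivative f (at x) w + frechet_derivative g (at x) w"
  using frechet_derivative_at[OF has_derivative_add[OF assms[unfolded frechet_derivative_works]]] by metis

lemma frechet_derivative_minus:
  assumes "f differentiable (at x)" "g differentiable (at x)"
  shows "frechet_derivative (\<lambda>y. f y - g y) (at x) w = frechet_derivative f (at x) w - frechet_derivative g (at x) w"
  using frechet_derivative_at[OF has_derivative_diff[OF assms[unfolded frechet_derivative_works]]] by metis

lemma frechet_derivative_sum:
  assumes "\<And>i. i \<in> I \<Longrightarrow> f i differentiable (at x)"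
  shows "frechet_derivative (\<lambda>y. \<Sum>i\<in>I. f i y) (at x) w = (\<Sum>i\<in>I. frechet_derivative (f i) (at x) w)"
  using frechet_derivative_at[OF has_derivative_sum[of I f "\<lambda>i. frechet_derivative (f i) (at x)"]]
    assms[unfolded frechet_derivative_works] by metis

lemma linear_vec_expand:
  fixes f :: "real^'n \<Rightarrow> 'b::real_vector"
  assumes "linear f"
  shows "f w = (\<Sum>k\<in>UNIV. (w $ k) *\<^sub>R f (axis k 1))"
proof -
  have "f w = f (\<Sum>k\<in>UNIV. (w $ k) *\<^sub>R axis k 1)"
    using basis_expansion[of w] by (simp add: scalar_mult_eq_scaleR)
  then show ?thesis using assms by (simp add: linear_sum linear_scale)
qed

text \<open>A product rule for families that are smooth in \<open>y\<close> only for each fixed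
  vector, such as \<open>Gam c y\<close> and \<open>cov_rep c K y\<close>, applied to a field
  \<open>V\<close>. Expanding \<open>V y\<close> in the standard basis reduces it to scalar
  multiplication.\<close>

lemma frechet_derivative_linear_family:
  fixes L :: "real^'m \<Rightarrow> real^'n \<Rightarrow> 'b::real_normed_vector"
  assumes S: "open S" and lin: "\<And>y. y \<in> S \<Longrightarrow> linear (L y)"
    and L: "\<And>z. smooth_on S (\<lambda>y. L y z)" and V: "smooth_on S V"
  shows "smooth_on S (\<lambda>y. L y (V y))"
    and "x \<in> S \<Longrightarrow> frechet_derivative (\<lambda>y. L y (V y)) (at x) w =
      frechet_derivative (\<lambda>y. L y (V x)) (at x) w + L x (frechet_derivative V (at x) w)"
proof -
  have exp: "(\<Sum>k\<in>UNIV. (z $ k) *\<^sub>R L y (axis k 1)) = L y z" if "y \<in> S" for y z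
    by (rule linear_vec_expand[OF lin[OF that], symmetric])
  have Vk: "smooth_on S (\<lambda>y. V y $ k)" for k
    by (rule smooth_on_bounded_linear[OF bounded_linear_vec_nth S V])
  have sm: "smooth_on S (\<lambda>y. (U y $ k) *\<^sub>R L y (axis k 1))" if "smooth_on S (\<lambda>y. U y $ k)" for U :: "real^'m \<Rightarrow> real^'n" and k
    by (rule smooth_on_bounded_bilinear[OF bounded_bilinear_scaleR S that L])
  show "smooth_on S (\<lambda>y. L y (V y))"
    by (rule smooth_on_transfer[OF smooth_on_sum[OF S sm[OF Vk]] S]) (rule exp)
  assume x: "x \<in> S"
  have D: "frechet_derivative (\<lambda>y. L y (U y)) (at x) w =
      (\<Sum>k\<in>UNIV. (U x $ k) *\<^sub>R frechet_derivative (\<lambda>y. L y (axis k 1)) (at x) w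
        + (frechet_derivative (\<lambda>y. U y $ k) (at x) w) *\<^sub>R L x (axis k 1))"
    if U: "\<And>k. smooth_on S (\<lambda>y. U y $ k)" for U
  proof -
    have "frechet_derivative (\<lambda>y. L y (U y)) (at x) = frechet_derivative (\<lambda>y. \<Sum>k\<in>UNIV. (U y $ k) *\<^sub>R L y (axis k 1)) (at x)"
      by (rule frechet_derivative_cong_open[OF S x]) (rule exp[symmetric])
    moreover have "frechet_derivative (\<lambda>y. \<Sum>k\<in>UNIV. (U y $ k) *\<^sub>R L y (axis k 1)) (at x) w =
        (\<Sum>k\<in>UNIV. frechet_derivative (\<lambda>y. (U y $ k) *\<^sub>R L y (axis k 1)) (at x) w)"
      by (rule frechet_derivative_sum) (rule smooth_on_differentiable[OF sm[OF U] x])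
    ultimately show ?thesis
      by (simp add: frechet_derivative_bilinear[OF bounded_bilinear_scaleR smooth_on_differentiable[OF U x]
            smooth_on_differentiable[OF L x]])
  qed
  have "frechet_derivative (\<lambda>y. V y $ k) (at x) w = frechet_derivative V (at x) w $ k" for k
    by (rule frechet_derivative_bounded_linear[OF bounded_linear_vec_nth smooth_on_differentiable[OF V x]])
  then show "frechet_derivative (\<lambda>y. L y (V y)) (at x) w =
      frechet_derivative (\<lambda>y. L y (V x)) (at x) w + L x (frechet_derivative V (at x) w)"
    by (simp add: D[OF Vk] D[of "\<lambda>_. V x"] smooth_on_const sum.distrib exp[OF x])
qed

lemma frechet_derivative_const_on:
  assumes "open S" "x \<in> S" "\<And>y. y \<in> S \<Longrightarrow> f y = k"
  shows "frechet_derivative f (at x) w = 0"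
  using frechet_derivative_cong_open[OF assms(1,2), of f "\<lambda>_. k"] assms(3) by simp

text \<open>Derivatives in the parameter and in space become derivatives of the one map
  \<open>G\<close> in the directions \<open>(k, 0)\<close> and \<open>(0, w)\<close>, so that they
  commute by the symmetry lemma.\<close>

lemma smooth_on_slice:
  fixes G :: "'p::euclidean_space \<times> 'e::euclidean_space \<Rightarrow> 'b::real_normed_vector"
  assumes S: "open S" and G: "smooth_on (UNIV \<times> S) G"
  shows "smooth_on S (\<lambda>y. G (r, y))"
    and "y \<in> S \<Longrightarrow> frechet_derivative (\<lambda>y. G (r, y)) (at y) w = frechet_derivative G (at (r, y)) (0, w)"
    and "y \<in> S \<Longrightarrow> (\<lambda>r. G (r, y)) differentiable (at r)"
    and "y \<in> S \<Longrightarrow> frechet_derivative (\<lambda>r. G (r, y)) (at r) k = frechet_derivative G (at (r, y)) (k, 0)"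
proof -
  have bl: "bounded_linear (\<lambda>y::'e. (0::'p, y))" by (simp add: bounded_linear_Pair bounded_linear_zero bounded_linear_ident)
  have "smooth_on S (\<lambda>y. (r, 0) + (0, y))"
    by (rule smooth_on_add[OF S smooth_on_const smooth_on_bounded_linear_map[OF bl S]])
  then have "smooth_on S (\<lambda>y. (r, y))" by simp
  then show "smooth_on S (\<lambda>y. G (r, y))"
    by (rule smooth_on_compose[OF S _ G]) auto
  assume y: "y \<in> S"
  then have G': "(G has_derivative frechet_derivative G (at (r, y))) (at (r, y))"
    by (intro smooth_on_has_derivative[OF G]) simp
  have "((\<lambda>y. (r, y)) has_derivative (\<lambda>w. (0, w))) (at y)" "((\<lambda>r. (r, y)) has_derivative (\<lambda>k. (k, 0))) (at r)"
    by (auto intro!: derivative_eq_intros)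
  from diff_chain_at[OF this(1) G'] diff_chain_at[OF this(2) G']
  have 1: "((\<lambda>y. G (r, y)) has_derivative (\<lambda>w. frechet_derivative G (at (r, y)) (0, w))) (at y)"
    and 2: "((\<lambda>r. G (r, y)) has_derivative (\<lambda>k. frechet_derivative G (at (r, y)) (k, 0))) (at r)"
    by (simp_all add: o_def)
  show "frechet_derivative (\<lambda>y. G (r, y)) (at y) w = frechet_derivative G (at (r, y)) (0, w)"
    using frechet_derivative_at[OF 1] by metis
  show "(\<lambda>r. G (r, y)) differentiable (at r)" using 2 by (auto simp: differentiable_def)
  show "frechet_derivative (\<lambda>r. G (r, y)) (at r) k = frechet_derivative G (at (r, y)) (k, 0)"
    using frechet_derivative_at[OF 2] by metis
qed

lemma has_vector_derivative_two_parameters: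
  fixes G :: "(real \<times> real) \<times> 'e::euclidean_space \<Rightarrow> 'b::real_normed_vector"
  assumes S: "open S" and G: "smooth_on (UNIV \<times> S) G" and y: "y \<in> S"
  shows "((\<lambda>s. G ((s, t), y)) has_vector_derivative frechet_derivative G (at ((s, t), y)) ((1, 0), 0)) (at s)"
    and "((\<lambda>t. G ((s, t), y)) has_vector_derivative frechet_derivative G (at ((s, t), y)) ((0, 1), 0)) (at t)"
proof -
  have G': "(G has_derivative frechet_derivative G (at ((s, t), y))) (at ((s, t), y))"
    by (intro smooth_on_has_derivative[OF G]) (simp add: y)
  have "((\<lambda>s. ((s, t), y)) has_derivative (\<lambda>r. r *\<^sub>R ((1, 0), 0))) (at s)"
    "((\<lambda>t. ((s, t), y)) has_derivative (\<lambda>r. r *\<^sub>R ((0, 1), 0))) (at t)"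
    by (auto intro!: derivative_eq_intros)
  from diff_chain_at[OF this(1) G'] diff_chain_at[OF this(2) G']
  show "((\<lambda>s. G ((s, t), y)) has_vector_derivative frechet_derivative G (at ((s, t), y)) ((1, 0), 0)) (at s)"
    "((\<lambda>t. G ((s, t), y)) has_vector_derivative frechet_derivative G (at ((s, t), y)) ((0, 1), 0)) (at t)"
    unfolding has_vector_derivative_def
    by (simp_all only: o_def linear_scale[OF has_derivative_linear[OF G']])
qed

section \<open>Matrices and alternating forms\<close>

lemma matrix_mult_linear: "linear f \<Longrightarrow> matrix f *v x = f x" for f :: "real^'n \<Rightarrow> real^'m"
  by (metis matrix_vector_mul(2))

lemma matrix_add_rdistrib: "(A + B) ** C = A ** C + B ** C"
  by (vector matrix_matrix_mult_def sum.distrib[symmetric] field_simps)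

lemma matrix_diff_ldistrib: "A ** (B - C) = A ** B - A ** C" for A :: "'a::ring_1^'n^'m"
  by (vector matrix_matrix_mult_def sum_subtractf[symmetric] algebra_simps)

lemma matrix_diff_rdistrib: "(A - B) ** C = A ** C - B ** C" for A :: "'a::ring_1^'n^'m"
  by (vector matrix_matrix_mult_def sum_subtractf[symmetric] algebra_simps)

lemma matrix_scaleR_left: "(r *\<^sub>R A) ** B = r *\<^sub>R (A ** B)" for A :: "real^'n^'m"
  by (simp add: matrix_matrix_mult_def vec_eq_iff sum_distrib_left mult.assoc)

lemma matrix_scaleR_right: "A ** (r *\<^sub>R B) = r *\<^sub>R (A ** B)" for A :: "real^'n^'m"
  by (simp add: matrix_matrix_mult_def vec_eq_iff sum_distrib_left mult.left_commute)

lemma matrix_minus_left: "(- A) ** B = - (A ** B)" for A :: "real^'n^'m"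
  by (simp add: matrix_matrix_mult_def vec_eq_iff sum_negf)

lemma matrix_minus_right: "A ** (- B) = - (A ** B)" for A :: "real^'n^'m"
  by (simp add: matrix_matrix_mult_def vec_eq_iff sum_negf)

lemma bounded_bilinear_matrix_matrix_mult:
  "bounded_bilinear ((**) :: real^'n^'m \<Rightarrow> real^'k^'n \<Rightarrow> real^'k^'m)"
  unfolding bilinear_conv_bounded_bilinear[symmetric] bilinear_def
  by (auto intro!: linearI simp: matrix_add_ldistrib matrix_add_rdistrib matrix_scaleR_left matrix_scaleR_right)

lemma scaleR_matrix_vector: "(r *\<^sub>R A) *v x = r *\<^sub>R (A *v x)" for A :: "real^'n^'m"
  by (simp add: scaleR_matrix_vector_assoc)

lemma bounded_bilinear_matrix_vector_mult:
  "bounded_bilinear ((*v) :: real^'n^'m \<Rightarrow> real^'n \<Rightarrow> real^'m)"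
  unfolding bilinear_conv_bounded_bilinear[symmetric] bilinear_def
  by (auto intro!: linearI simp: matrix_vector_right_distrib matrix_vector_mult_add_rdistrib
      matrix_vector_mult_scaleR scaleR_matrix_vector)

lemma trace_scaleR: "trace (r *\<^sub>R A) = r * trace A" for A :: "real^'n^'n"
  by (simp add: trace_def sum_distrib_left)

lemma trace_minus: "trace (- A) = - trace A" for A :: "real^'n^'n"
  by (simp add: trace_def sum_negf)

lemma bounded_linear_trace: "bounded_linear (trace :: real^'n^'n \<Rightarrow> real)"
  unfolding linear_conv_bounded_linear[symmetric]
  by (auto intro!: linearI simp: trace_add trace_scaleR)

text \<open>Applied with the Jacobians of a coordinate change, this makes traces independent of the
  chart.\<close>

lemma trace_conjugate:
  fixes P Q :: "real^'n^'n"
  assumes "P ** Q = mat 1" shows "trace (Q ** B ** P) = trace B"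
  by (metis assms matrix_mul_assoc matrix_mul_lid trace_mul_sym)

lemma trace_matrix: "trace (matrix f) = (\<Sum>k\<in>UNIV. f (axis k 1) $ k)"
  by (simp add: trace_def matrix_def)

lemmas matrix_distribs = matrix_add_ldistrib matrix_add_rdistrib matrix_diff_ldistrib matrix_diff_rdistrib
  matrix_minus_left matrix_minus_right

abbreviation map_trace :: "(real^'n \<Rightarrow> real^'n) \<Rightarrow> real" where
  "map_trace f \<equiv> trace (matrix f)"

lemma map_trace_add: "map_trace (\<lambda>w. f w + g w) = map_trace f + map_trace g"
  by (simp add: trace_matrix sum.distrib)

lemma map_trace_diff: "map_trace (\<lambda>w. f w - g w) = map_trace f - map_trace g"
  by (simp add: trace_matrix sum_subtractf)

lemma map_trace_commute:
  assumes "linear f"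
  shows "map_trace (\<lambda>w. f (P *v w)) = map_trace (\<lambda>w. P *v f w)"
proof -
  have "matrix (\<lambda>w. f (P *v w)) = matrix f ** P" "matrix (\<lambda>w. P *v f w) = P ** matrix f"
    using matrix_compose[OF matrix_vector_mul_linear assms, of P] matrix_compose[OF assms matrix_vector_mul_linear, of P]
    by (simp_all add: o_def)
  then show ?thesis by (simp add: trace_mul_sym[of "matrix f" P])
qed

lemma map_trace_derivative:
  fixes P :: "real^'n \<Rightarrow> real^'n \<Rightarrow> real^'n"
  assumes S: "open S" and x: "x \<in> S" and P: "\<And>w. smooth_on S (\<lambda>y. P y w)"
  shows "smooth_on S (\<lambda>y. map_trace (P y))"
    and "frechet_derivative (\<lambda>y. map_trace (P y)) (at x) u = map_trace (\<lambda>w. frechet_derivative (\<lambda>y. P y w) (at x) u)"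
proof -
  have s: "smooth_on S (\<lambda>y. P y w $ k)" for w k
    by (rule smooth_on_bounded_linear[OF bounded_linear_vec_nth S P])
  show "smooth_on S (\<lambda>y. map_trace (P y))"
    unfolding trace_matrix by (intro smooth_on_sum S s)
  have d: "frechet_derivative (\<lambda>y. P y w $ k) (at x) u = frechet_derivative (\<lambda>y. P y w) (at x) u $ k" for w k
    by (rule frechet_derivative_bounded_linear[OF bounded_linear_vec_nth smooth_on_differentiable[OF P x]])
  show "frechet_derivative (\<lambda>y. map_trace (P y)) (at x) u = map_trace (\<lambda>w. frechet_derivative (\<lambda>y. P y w) (at x) u)"
    unfolding trace_matrix d[symmetric]
    by (rule frechet_derivative_sum) (rule smooth_on_differentiable[OF s x])
qed

section \<open>Alternating functions of the rows of a matrix\<close>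

definition row_upd :: "'a^'m^'n \<Rightarrow> 'n \<Rightarrow> 'a^'m \<Rightarrow> 'a^'m^'n::finite" where
  "row_upd A i x = (\<chi> k. if k = i then x else A $ k)"

lemma row_upd_nth [simp]: "row_upd A i x $ k = (if k = i then x else A $ k)"
  by (simp add: row_upd_def)

lemma row_upd_triv [simp]: "row_upd A i (A $ i) = A"
  by (simp add: vec_eq_iff)

lemma row_upd_twice [simp]: "row_upd (row_upd A i x) i y = row_upd A i y"
  by (simp add: vec_eq_iff)

lemma row_upd_commute: "i \<noteq> j \<Longrightarrow> row_upd (row_upd A i x) j y = row_upd (row_upd A j y) i x"
  by (simp add: vec_eq_iff)

text \<open>The counterpart of \<open>alternating_multilinear\<close> with vectors as rows of a
  matrix, so that \<open>det\<close> is an instance and induction over row operations is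
  available.\<close>

definition alternating_rows :: "(real^'n^'n \<Rightarrow> real) \<Rightarrow> bool" where
  "alternating_rows F \<longleftrightarrow> (\<forall>A i. linear (\<lambda>x. F (row_upd A i x))) \<and>
     (\<forall>A i j. i \<noteq> j \<longrightarrow> A $ i = A $ j \<longrightarrow> F A = 0)"

lemma alternating_rows_linear: "alternating_rows F \<Longrightarrow> linear (\<lambda>x. F (row_upd A i x))"
  and alternating_rows_zero: "alternating_rows F \<Longrightarrow> i \<noteq> j \<Longrightarrow> A $ i = A $ j \<Longrightarrow> F A = 0"
  by (auto simp: alternating_rows_def)

text \<open>Polarisation: expand \<open>F\<close> with \<open>x + y\<close> in both rows.\<close>

lemma alternating_rows_swap:
  assumes F: "alternating_rows F" and ij: "i \<noteq> j"
  shows "F (row_upd (row_upd A i x) j y) = - F (row_upd (row_upd A i y) j x)"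
proof -
  let ?G = "\<lambda>x y. F (row_upd (row_upd A i x) j y)"
  note lin = alternating_rows_linear[OF F]
  have z: "?G x x = 0" for x by (rule alternating_rows_zero[OF F ij]) (use ij in simp)
  have l: "?G (x + x') y = ?G x y + ?G x' y" for x x' y
    using linear_add[OF lin[of "row_upd A j y" i], of x x'] by (simp add: row_upd_commute[OF ij])
  have r: "?G x (y + y') = ?G x y + ?G x y'" for x y y'
    using linear_add[OF lin[of "row_upd A i x" j], of y y'] .
  have "0 = ?G (x + y) (x + y)" by (rule z[symmetric])
  also have "\<dots> = ?G x y + ?G y x" unfolding l r by (simp add: z)
  finally show ?thesis by simp
qed

lemma alternating_rows_det: "alternating_rows (det :: real^'n^'n \<Rightarrow> real)"
  unfolding alternating_rows_def
proof (intro conjI allI impI linearI)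
  fix A :: "real^'n^'n" and i x y r
  show "det (row_upd A i (x + y)) = det (row_upd A i x) + det (row_upd A i y)"
    unfolding row_upd_def by (rule det_row_add)
  show "det (row_upd A i (r *\<^sub>R x)) = r *\<^sub>R det (row_upd A i x)"
    unfolding row_upd_def using det_row_mul[of i r "\<lambda>_. x" "\<lambda>k. A $ k"] unfolding scalar_mult_eq_scaleR by simp
next
  fix A :: "real^'n^'n" and i j
  assume "i \<noteq> j" "A $ i = A $ j"
  then show "det A = 0" by (intro det_identical_rows[of i j]) (simp_all add: row_def vec_eq_iff)
qed

lemma alternating_rows_diagonal:
  fixes F :: "real^'n^'n \<Rightarrow> real"
  assumes F: "alternating_rows F"
  shows "F (\<chi> i. if i \<in> S then a i *\<^sub>R axis i 1 else axis i 1) = (\<Prod>i\<in>S. a i) * F (mat 1)"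
proof -
  let ?B = "\<lambda>S. (\<chi> i. if i \<in> S then a i *\<^sub>R axis i 1 else axis i 1) :: real^'n^'n"
  have "finite S" by simp
  then show ?thesis
  proof (induction S rule: finite_induct)
    case empty
    have "(\<chi> i. axis i 1) = (mat 1 :: real^'n^'n)" by (simp add: vec_eq_iff mat_def axis_def)
    then show ?case by simp
  next
    case (insert j S)
    have "?B (insert j S) = row_upd (?B S) j (a j *\<^sub>R axis j 1)"
      by (simp add: vec_eq_iff)
    moreover have "row_upd (?B S) j (axis j 1) = ?B S"
      using insert.hyps by (simp add: vec_eq_iff)
    ultimately have "F (?B (insert j S)) = a j * F (?B S)"
      using linear_scale[OF alternating_rows_linear[OF F, of "?B S" j], of "a j" "axis j 1"] by simp
    then show ?case using insert by simp
  qed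
qed

text \<open>Forms of top degree make up a line. The statement is proved for all \<open>F\<close> at
  once because the induction step for a swap needs the hypothesis for a function other than
  \<open>F\<close>.\<close>

lemma alternating_rows_eq_det:
  fixes F :: "real^'n^'n \<Rightarrow> real"
  assumes "alternating_rows F"
  shows "F A = det A * F (mat 1)"
proof -
  have "\<forall>F. alternating_rows F \<longrightarrow> F A = det A * F (mat 1)"
  proof (induction A rule: induct_matrix_row_operations)
    case (1 A i)
    show ?case
    proof (intro allI impI)
      fix F :: "real^'n^'n \<Rightarrow> real" assume F: "alternating_rows F"
      have "A $ i = 0" using 1 by (simp add: row_def vec_eq_iff)
      then have "row_upd A i 0 = A" by (metis row_upd_triv)
      then have "F A = 0" using linear_0[OF alternating_rows_linear[OF F, of A i]] by simp
      moreover have "det A = 0" by (rule det_zero_row[OF 1])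
      ultimately show "F A = det A * F (mat 1)" by simp
    qed
  next
    case (2 A)
    have "A = (\<chi> i. if i \<in> UNIV then (A $ i $ i) *\<^sub>R axis i 1 else axis i 1)"
      using 2 by (auto simp: vec_eq_iff axis_def)
    then show ?case
      using alternating_rows_diagonal[of _ UNIV "\<lambda>i. A $ i $ i"] det_diagonal[OF 2] by metis
  next
    case (3 A m n)
    let ?s = "\<lambda>B :: real^'n^'n. \<chi> i j. B $ i $ Transposition.transpose m n j"
    show ?case
    proof (intro allI impI)
      fix F :: "real^'n^'n \<Rightarrow> real" assume F: "alternating_rows F"
      \<comment> \<open>The induction swaps columns, about which alternation in rows says nothing
        directly; but \<open>G\<close> preceded by a column swap is again alternating in the
        rows.\<close>
      have s_alt: "alternating_rows (\<lambda>B. G (?s B))" if G: "alternating_rows G" for G :: "real^'n^'n \<Rightarrow> real"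
        unfolding alternating_rows_def
      proof (intro conjI allI impI)
        fix B :: "real^'n^'n" and i
        have "?s (row_upd B i x) = row_upd (?s B) i (\<chi> j. x $ Transposition.transpose m n j)" for x
          by (simp add: vec_eq_iff)
        moreover have "linear (\<lambda>x :: real^'n. \<chi> j. x $ Transposition.transpose m n j)"
          by (rule linearI) (simp_all add: vec_eq_iff)
        ultimately show "linear (\<lambda>x. G (?s (row_upd B i x)))"
          using linear_compose[OF _ alternating_rows_linear[OF G, of "?s B" i]] by (auto simp: o_def)
      next
        fix B :: "real^'n^'n" and i j
        assume "i \<noteq> j" "B $ i = B $ j"
        then show "G (?s B) = 0" by (intro alternating_rows_zero[OF G, of i j]) simp_all
      qed
      \<comment> \<open>For the identity matrix a column swap is also a row swap, which supplies the
        sign.\<close>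
      have s1: "G (?s (mat 1)) = - G (mat 1)" if G: "alternating_rows G" for G :: "real^'n^'n \<Rightarrow> real"
      proof -
        let ?I = "mat 1 :: real^'n^'n"
        have "?s ?I = row_upd (row_upd ?I m (?I $ n)) n (?I $ m)"
          using 3 by (auto simp: vec_eq_iff mat_def Transposition.transpose_def)
        then show ?thesis using alternating_rows_swap[OF G 3(2), of ?I "?I $ n" "?I $ m"] by simp
      qed
      have "F (?s A) = - (det A * F (mat 1))"
        using 3(1)[rule_format, OF s_alt[OF F]] s1[OF F] by simp
      moreover have "det (?s A) = - det A"
        using 3(1)[rule_format, OF s_alt[OF alternating_rows_det]] s1[OF alternating_rows_det] by simp
      ultimately show "F (?s A) = det (?s A) * F (mat 1)" by simp
    qed
  next
    case (4 A m n r)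
    let ?A' = "\<chi> i. if i = m then row m A + r *\<^sub>R row n A else row i A"
    have A': "?A' = row_upd A m (A $ m + r *\<^sub>R A $ n)"
      by (simp add: vec_eq_iff row_def)
    have inv: "G ?A' = G A" if G: "alternating_rows G" for G :: "real^'n^'n \<Rightarrow> real"
    proof -
      have "G (row_upd A m (A $ n)) = 0"
        by (rule alternating_rows_zero[OF G 4(2)]) (use 4(2) in simp)
      then show ?thesis
        unfolding A' by (simp add: linear_add[OF alternating_rows_linear[OF G]] linear_scale[OF alternating_rows_linear[OF G]])
    qed
    show ?case
    proof (intro allI impI)
      fix F :: "real^'n^'n \<Rightarrow> real" assume "alternating_rows F"
      then show "F ?A' = det ?A' * F (mat 1)"
        unfolding inv[OF \<open>alternating_rows F\<close>] inv[OF alternating_rows_det] using 4(1) by blast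
    qed
  qed
  then show ?thesis using assms by blast
qed

text \<open>As a function of \<open>A\<close>, the sum is itself alternating in the rows, hence a
  multiple of \<open>det\<close>, and its value at the identity is the trace. All traces in the
  density and divergence formulas come from here.\<close>

lemma sum_det_row_upd:
  fixes L :: "real^'n \<Rightarrow> real^'n"
  assumes L: "linear L"
  shows "(\<Sum>i\<in>UNIV. det (row_upd A i (L (A $ i)))) = trace (matrix L) * det A"
proof -
  let ?S = "\<lambda>A :: real^'n^'n. \<Sum>i\<in>UNIV. det (row_upd A i (L (A $ i)))"
  note d = alternating_rows_det
  have "alternating_rows ?S"
    unfolding alternating_rows_def
  proof (intro conjI allI impI)
    fix A :: "real^'n^'n" and j
    have "linear (\<lambda>x. det (row_upd (row_upd A j x) i (L (row_upd A j x $ i))))" for i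
    proof (cases "i = j")
      case True
      then show ?thesis
        using linear_compose[OF L alternating_rows_linear[OF d, of A j]] by (simp add: o_def)
    next
      case False
      then show ?thesis
        using alternating_rows_linear[OF d, of "row_upd A i (L (A $ i))" j] by (simp add: row_upd_commute)
    qed
    then show "linear (\<lambda>x. ?S (row_upd A j x))"
      by (intro linear_compose_sum) auto
  next
    fix A :: "real^'n^'n" and a b
    assume ab: "a \<noteq> b" "A $ a = A $ b"
    \<comment> \<open>If rows \<open>a\<close> and \<open>b\<close> agree, only the terms with index
      \<open>a\<close> and \<open>b\<close> survive, and they cancel by antisymmetry.\<close>
    let ?t = "\<lambda>i. det (row_upd A i (L (A $ i)))"
    have "?t i = 0" if "i \<noteq> a" "i \<noteq> b" for i
      by (rule alternating_rows_zero[OF d ab(1)]) (use that ab in simp)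
    then have "?S A = sum ?t {a, b}"
      by (intro sum.mono_neutral_right) auto
    moreover have "row_upd A a (L (A $ a)) = row_upd (row_upd A a (L (A $ a))) b (A $ a)"
      "row_upd A b (L (A $ b)) = row_upd (row_upd A a (A $ a)) b (L (A $ a))"
      using ab(1) by (auto simp: vec_eq_iff ab(2)[symmetric])
    then have "?t a + ?t b = 0"
      using alternating_rows_swap[OF d ab(1), of A "L (A $ a)" "A $ a"] by simp
    ultimately show "?S A = 0" using ab(1) by simp
  qed
  then have "?S A = det A * ?S (mat 1)" by (rule alternating_rows_eq_det)
  \<comment> \<open>Cramer's rule for the identity matrix; with \<open>x = L (axis i 1)\<close>
    these are the diagonal entries of \<open>matrix L\<close>.\<close>
  moreover have "det (row_upd (mat 1) i x) = x $ i" for i and x :: "real^'n"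
  proof -
    have "row j (mat 1 :: real^'n^'n) = axis j 1" for j by (simp add: row_def mat_def axis_def vec_eq_iff)
    moreover have "mat 1 $ j = (axis j 1 :: real^'n)" for j by (simp add: mat_def axis_def vec_eq_iff)
    ultimately show ?thesis
      using cramer_lemma_transpose[of i x "mat 1 :: real^'n^'n"] basis_expansion[of x]
      by (simp add: row_upd_def cong: if_cong)
  qed
  moreover have "mat 1 $ j = (axis j 1 :: real^'n)" for j by (simp add: mat_def axis_def vec_eq_iff)
  ultimately show ?thesis by (simp add: trace_def matrix_def)
qed

section \<open>Lists of vectors as matrices, and forms of top degree\<close>

abbreviation row_index :: "'n::finite \<Rightarrow> nat" where
  "row_index \<equiv> to_nat_on UNIV"

lemma bij_row_index: "bij_betw (row_index :: 'n::finite \<Rightarrow> nat) UNIV {..<CARD('n)}"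
  by (rule to_nat_on_finite) simp

text \<open>Inverse to the passage from lists to matrices inside \<open>frame_det\<close>, with the
  same enumeration of the index type.\<close>

definition row_list :: "real^'n^'n::finite \<Rightarrow> (real^'n) list" where
  "row_list A = map (\<lambda>j. A $ the_inv row_index j) [0..<CARD('n)]"

lemma length_row_list [simp]: "length (row_list (A :: real^'n^'n)) = CARD('n)"
  by (simp add: row_list_def)

lemma row_index_less [simp]: "row_index (i :: 'n::finite) < CARD('n)"
  using bij_row_index by (auto simp: bij_betw_def)

lemma inj_row_index: "inj (row_index :: 'n::finite \<Rightarrow> nat)"
  using bij_row_index by (auto simp: bij_betw_def)

lemma row_index_cases: "j < CARD('n) \<Longrightarrow> \<exists>i::'n::finite. j = row_index i"
  using bij_row_index unfolding bij_betw_def by (metis imageE lessThan_iff)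

lemma row_list_nth [simp]: "row_list A ! row_index i = A $ i"
  by (simp add: row_list_def the_inv_f_f[OF inj_row_index])

lemma row_list_upd:
  fixes A :: "real^'n^'n"
  shows "(row_list A)[row_index i := x] = row_list (row_upd A i x)"
proof (rule nth_equalityI)
  fix j assume "j < length ((row_list A)[row_index i := x])"
  then obtain k :: 'n where "j = row_index k" using row_index_cases[where 'n = 'n] by auto
  then show "(row_list A)[row_index i := x] ! j = row_list (row_upd A i x) ! j"
    by (simp add: nth_list_update inj_eq[OF inj_row_index])
qed simp

lemma row_list_frame:
  fixes ws :: "(real^'n) list"
  assumes "length ws = CARD('n)"
  shows "row_list (\<chi> i. ws ! row_index i) = ws"
proof (rule nth_equalityI)
  fix j assume "j < length (row_list (\<chi> i. ws ! row_index i))"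
  then obtain k :: 'n where "j = row_index k" using row_index_cases[where 'n = 'n] by auto
  then show "row_list (\<chi> i. ws ! row_index i) ! j = ws ! j" by simp
qed (simp add: assms)

lemma frame_det_row_list [simp]: "frame_det (row_list A) = det A"
  by (simp add: frame_det_def vec_nth_inverse)

lemma alternating_multilinear_rows:
  assumes "alternating_multilinear CARD('n) \<phi>"
  shows "alternating_rows (\<lambda>A :: real^'n^'n. \<phi> (row_list A))"
  unfolding alternating_rows_def
proof (intro conjI allI impI)
  fix A :: "real^'n^'n" and i
  show "linear (\<lambda>x. \<phi> (row_list (row_upd A i x)))"
    using assms by (simp add: alternating_multilinear_def row_list_upd[symmetric])
next
  fix A :: "real^'n^'n" and i j
  assume ij: "i \<noteq> j" "A $ i = A $ j"
  then have "row_index i \<noteq> row_index j" by (simp add: inj_eq[OF inj_row_index])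
  then consider "row_index i < row_index j" | "row_index j < row_index i" by linarith
  then show "\<phi> (row_list A) = 0"
    using assms ij unfolding alternating_multilinear_def
    by cases (metis length_row_list row_index_less row_list_nth)+
qed

text \<open>This is what allows a volume form to be described in a chart by a single scalar
  density.\<close>

lemma alternating_multilinear_eq_frame_det:
  fixes ws :: "(real^'n) list"
  assumes "alternating_multilinear CARD('n) \<phi>" "length ws = CARD('n)"
  shows "\<phi> ws = frame_det ws * \<phi> (row_list (mat 1))"
  using alternating_rows_eq_det[OF alternating_multilinear_rows[OF assms(1)], of "\<chi> i. ws ! row_index i"]
  by (simp add: row_list_frame assms(2) frame_det_def)

lemma alternating_multilinear_frame_det: "alternating_multilinear CARD('n) (frame_det :: (real^'n) list \<Rightarrow> real)"
  unfolding alternating_multilinear_def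
proof (intro conjI allI impI)
  fix ws :: "(real^'n) list" and i
  assume ws: "length ws = CARD('n)" and i: "i < CARD('n)"
  obtain A :: "real^'n^'n" where A: "ws = row_list A" using row_list_frame[OF ws] by metis
  obtain k :: 'n where "i = row_index k" using row_index_cases[OF i] by blast
  then show "linear (\<lambda>w. frame_det (ws[i := w]))"
    using alternating_rows_linear[OF alternating_rows_det] by (simp add: A row_list_upd)
next
  fix ws :: "(real^'n) list" and i j
  assume ws: "length ws = CARD('n)" and i: "i < j" and j: "j < CARD('n)" and eq: "ws ! i = ws ! j"
  obtain A :: "real^'n^'n" where A: "ws = row_list A" using row_list_frame[OF ws] by metis
  obtain k l :: 'n where kl: "i = row_index k" "j = row_index l" using row_index_cases[where 'n = 'n] i j by (metis less_trans)
  then have "k \<noteq> l" "A $ k = A $ l" using i eq A by auto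
  then show "frame_det ws = 0" unfolding A frame_det_row_list by (rule alternating_rows_zero[OF alternating_rows_det])
qed

lemma sum_frame_det_update:
  fixes ws :: "(real^'n) list"
  assumes "linear L" and ws: "length ws = CARD('n)"
  shows "(\<Sum>i<CARD('n). frame_det (ws[i := L (ws ! i)])) = trace (matrix L) * frame_det ws"
proof -
  obtain A :: "real^'n^'n" where A: "ws = row_list A" using row_list_frame[OF ws] by metis
  have "(\<Sum>i<CARD('n). frame_det (ws[i := L (ws ! i)])) =
      (\<Sum>k\<in>(UNIV :: 'n set). frame_det (ws[row_index k := L (ws ! row_index k)]))"
    by (rule sum.reindex_bij_betw[OF bij_row_index, symmetric])
  then show ?thesis by (simp add: A row_list_upd sum_det_row_upd[OF assms(1)])
qed

lemma alternating_multilinear_map: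
  assumes "alternating_multilinear k \<phi>" "linear f"
  shows "alternating_multilinear k (\<lambda>ws. \<phi> (map f ws))"
  unfolding alternating_multilinear_def
proof (intro conjI allI impI)
  fix ws :: "'b list" and i
  assume "length ws = k" "i < k"
  then have "linear (\<lambda>w. \<phi> ((map f ws)[i := w]))"
    using assms(1) by (simp add: alternating_multilinear_def)
  from linear_compose[OF assms(2) this] show "linear (\<lambda>w. \<phi> (map f (ws[i := w])))"
    by (simp add: o_def map_update)
next
  fix ws :: "'b list" and i j
  assume ij: "length ws = k" "i < j" "j < k" "ws ! i = ws ! j"
  have "length (map f ws) = k \<longrightarrow> i < j \<longrightarrow> j < k \<longrightarrow> map f ws ! i = map f ws ! j \<longrightarrow> \<phi> (map f ws) = 0"
    using assms(1) unfolding alternating_multilinear_def by blast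
  then show "\<phi> (map f ws) = 0" using ij by simp
qed

lemma alternating_multilinear_swap:
  assumes alt: "alternating_multilinear k \<phi>" and ws: "length ws = k" and ij: "i < j" "j < k"
  shows "\<phi> (ws[i := x, j := y]) = - \<phi> (ws[i := y, j := x])"
proof -
  let ?G = "\<lambda>x y. \<phi> (ws[i := x, j := y])"
  have lin: "linear (\<lambda>w. \<phi> (us[m := w]))" if "length us = k" "m < k" for us m
    using alt that by (simp add: alternating_multilinear_def)
  have zero: "\<phi> us = 0" if "length us = k" "us ! i = us ! j" for us
    using alt that ij unfolding alternating_multilinear_def by blast
  have z: "?G x x = 0" for x
    by (rule zero) (use ws ij in auto)
  have l: "?G (x + x') y = ?G x y + ?G x' y" for x x' y
    using linear_add[OF lin[of "ws[j := y]" i], of x x'] ws ij by (simp add: list_update_swap)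
  have r: "?G x (y + y') = ?G x y + ?G x y'" for x y y'
    using linear_add[OF lin[of "ws[i := x]" j], of y y'] ws ij by simp
  have "0 = ?G (x + y) (x + y)" by (rule z[symmetric])
  also have "\<dots> = ?G x y + ?G y x" unfolding l r by (simp add: z)
  finally show ?thesis by simp
qed

text \<open>\<open>x\<close> passes \<open>i\<close> entries by adjacent transpositions, each
  contributing one sign.\<close>

lemma alternating_multilinear_move:
  assumes alt: "alternating_multilinear k \<phi>" and us: "Suc (length us) = k" and "i \<le> length us"
  shows "\<phi> (x # us) = (-1) ^ i * \<phi> (take i us @ x # drop i us)"
  using assms(3)
proof (induction i)
  case (Suc i)
  let ?b = "us ! i"
  let ?ws = "take i us @ x # ?b # drop (Suc i) us"
  have d: "drop i us = ?b # drop (Suc i) us" using Suc.prems by (simp add: Cons_nth_drop_Suc)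
  have l: "length (take i us) = i" using Suc.prems by simp
  have t: "take (Suc i) us = take i us @ [?b]" using Suc.prems by (simp add: take_Suc_conv_app_nth)
  have "\<phi> (?ws[i := x, Suc i := ?b]) = - \<phi> (?ws[i := ?b, Suc i := x])"
    by (rule alternating_multilinear_swap[OF alt]) (use us Suc.prems in auto)
  moreover have "?ws[i := x, Suc i := ?b] = ?ws" using l by (simp add: list_update_append)
  moreover have "?ws[i := ?b, Suc i := x] = take (Suc i) us @ x # drop (Suc i) us"
    using l by (simp add: list_update_append t)
  ultimately show ?case using Suc d by simp
qed simp

text \<open>The sign of the \<open>i\<close>-th summand of \<open>ext_d\<close> is exactly the cost
  of moving \<open>x\<close> from the front, where \<open>interior_product\<close> puts it, into
  slot \<open>i\<close>.\<close>

lemma alternating_multilinear_insert: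
  assumes alt: "alternating_multilinear k \<phi>" and ws: "length ws = k" and i: "i < k"
  shows "(-1) ^ i * \<phi> (x # take i ws @ drop (Suc i) ws) = \<phi> (ws[i := x])"
proof -
  let ?us = "take i ws @ drop (Suc i) ws"
  have "\<phi> (x # ?us) = (-1) ^ i * \<phi> (take i ?us @ x # drop i ?us)"
    by (rule alternating_multilinear_move[OF alt]) (use ws i in auto)
  also have "take i ?us @ x # drop i ?us = ws[i := x]"
    using ws i by (simp add: upd_conv_take_nth_drop min_def)
  finally show ?thesis by simp
qed

section \<open>Coordinate changes\<close>

text \<open>Indexed by the point \<open>q\<close> instead of its coordinates, so that the cocycle
  rule \<open>jac_comp\<close> has the same base point throughout; \<open>to_chart\<close> and
  \<open>from_chart\<close> are both instances.\<close>

definition jac :: "('a, 'n::finite) chart \<Rightarrow> ('a, 'n) chart \<Rightarrow> 'a \<Rightarrow> real^'n \<Rightarrow> real^'n" where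
  "jac a b q = frechet_derivative (transition a b) (at (coord a q))"

lemma to_chart_jac: "to_chart A c q = jac (chart_at A q) c q"
  and from_chart_jac: "from_chart A c q = jac c (chart_at A q) q"
  by (simp_all add: to_chart_def from_chart_def jac_def)

text \<open>Constant coefficients in an arbitrary fixed chart \<open>c\<close>, where
  \<open>const_ext\<close> always takes the chart selected at its point.\<close>

definition coord_field :: "('a, 'n::finite) chart set \<Rightarrow> ('a, 'n) chart \<Rightarrow> real^'n \<Rightarrow> 'a \<Rightarrow> real^'n" where
  "coord_field A c w q = from_chart A c q w"

lemma const_ext_coord_field: "const_ext A p w = coord_field A (chart_at A p) w"
  by (simp add: const_ext_def coord_field_def fun_eq_iff)

lemma endo_app_apply: "endo_app J X q = J q *v X q"
  by (simp add: endo_app_def)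

locale smooth_atlas =
  fixes M :: "'a topology" and A :: "('a, 'n::finite) chart set"
  assumes atlas: "oriented_smooth_atlas M A"
begin

lemma chart_at: "p \<in> topspace M \<Longrightarrow> chart_at A p \<in> A"
  and chart_at_dom: "p \<in> topspace M \<Longrightarrow> p \<in> chart_dom (chart_at A p)"
proof -
  assume "p \<in> topspace M"
  then have "\<exists>c. c \<in> A \<and> p \<in> chart_dom c" using atlas unfolding oriented_smooth_atlas_def by blast
  then have "chart_at A p \<in> A \<and> p \<in> chart_dom (chart_at A p)"
    unfolding chart_at_def by (rule someI_ex)
  then show "chart_at A p \<in> A" "p \<in> chart_dom (chart_at A p)" by auto
qed

lemma is_chart: "c \<in> A \<Longrightarrow> is_chart M c"
  using atlas by (simp add: oriented_smooth_atlas_def)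

lemma openin_chart_dom: "c \<in> A \<Longrightarrow> openin M (chart_dom c)"
  using is_chart by (simp add: is_chart_def)

lemma chart_dom_topspace: "c \<in> A \<Longrightarrow> q \<in> chart_dom c \<Longrightarrow> q \<in> topspace M"
  using openin_chart_dom openin_subset by blast

lemma chart_at': "c \<in> A \<Longrightarrow> q \<in> chart_dom c \<Longrightarrow> chart_at A q \<in> A"
  and chart_at_dom': "c \<in> A \<Longrightarrow> q \<in> chart_dom c \<Longrightarrow> q \<in> chart_dom (chart_at A q)"
  using chart_dom_topspace chart_at chart_at_dom by auto

lemma chart_inv_coord [simp]: "c \<in> A \<Longrightarrow> q \<in> chart_dom c \<Longrightarrow> chart_inv c (coord c q) = q"
proof -
  assume "c \<in> A" "q \<in> chart_dom c"
  then have "homeomorphic_map (subtopology M (chart_dom c)) (top_of_set (coord c ` chart_dom c)) (coord c)"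
    using is_chart by (simp add: is_chart_def)
  then have "inj_on (coord c) (topspace (subtopology M (chart_dom c)))"
    by (rule homeomorphic_imp_injective_map)
  moreover have "topspace (subtopology M (chart_dom c)) = chart_dom c"
    using chart_dom_topspace[OF \<open>c \<in> A\<close>] by auto
  ultimately show ?thesis using \<open>q \<in> chart_dom c\<close> by (simp add: chart_inv_def)
qed

lemma open_coord_image: "c \<in> A \<Longrightarrow> openin M U \<Longrightarrow> open (coord c ` (U \<inter> chart_dom c))"
proof -
  assume c: "c \<in> A" and "openin M U"
  then have hom: "homeomorphic_map (subtopology M (chart_dom c)) (top_of_set (coord c ` chart_dom c)) (coord c)"
    and op: "open (coord c ` chart_dom c)"
    using is_chart by (simp_all add: is_chart_def)
  have "openin (subtopology M (chart_dom c)) (U \<inter> chart_dom c)"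
    using \<open>openin M U\<close> by (auto simp: openin_subtopology)
  then have "openin (top_of_set (coord c ` chart_dom c)) (coord c ` (U \<inter> chart_dom c))"
    using homeomorphic_imp_open_map[OF hom] by (simp add: open_map_def)
  then show ?thesis using op openin_open_eq by blast
qed

lemma open_coord_image_subset: "c \<in> A \<Longrightarrow> openin M U \<Longrightarrow> U \<subseteq> chart_dom c \<Longrightarrow> open (coord c ` U)"
  using open_coord_image[of c U] by (simp add: Int_absorb2)

lemma open_coord_dom: "c \<in> A \<Longrightarrow> open (coord c ` chart_dom c)"
  using open_coord_image_subset[OF _ openin_chart_dom] by simp

lemma openin_chart_Int: "a \<in> A \<Longrightarrow> b \<in> A \<Longrightarrow> openin M (chart_dom a \<inter> chart_dom b)"
  by (simp add: openin_chart_dom openin_Int)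

lemma transition_coord: "a \<in> A \<Longrightarrow> q \<in> chart_dom a \<Longrightarrow> transition a b (coord a q) = coord b q"
  by (simp add: transition_def)

lemma transition_smooth:
  "a \<in> A \<Longrightarrow> b \<in> A \<Longrightarrow> smooth_on (coord a ` (chart_dom a \<inter> chart_dom b)) (transition a b)"
  using atlas by (simp add: oriented_smooth_atlas_def)

lemma jac_has_derivative:
  assumes "a \<in> A" "b \<in> A" "q \<in> chart_dom a" "q \<in> chart_dom b"
  shows "(transition a b has_derivative jac a b q) (at (coord a q))"
  unfolding jac_def using assms by (intro smooth_on_has_derivative[OF transition_smooth]) auto

lemma linear_jac:
  "a \<in> A \<Longrightarrow> b \<in> A \<Longrightarrow> q \<in> chart_dom a \<Longrightarrow> q \<in> chart_dom b \<Longrightarrow> linear (jac a b q)"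
  using jac_has_derivative has_derivative_linear by blast

text \<open>The chain rule, since the composite of the two transitions agrees with the direct one
  near \<open>coord a q\<close>.\<close>

lemma jac_comp:
  assumes "a \<in> A" "b \<in> A" "d \<in> A" "q \<in> chart_dom a" "q \<in> chart_dom b" "q \<in> chart_dom d"
  shows "jac b d q (jac a b q w) = jac a d q w"
proof -
  let ?S = "coord a ` (chart_dom a \<inter> chart_dom b)"
  have "open ?S" using open_coord_image_subset[OF assms(1) openin_chart_Int] assms by auto
  moreover have "((transition b d \<circ> transition a b) has_derivative (jac b d q \<circ> jac a b q)) (at (coord a q))"
    using jac_has_derivative[of b d q] assms
    by (intro diff_chain_at jac_has_derivative) (simp_all add: transition_coord)
  ultimately have "(transition a d has_derivative (jac b d q \<circ> jac a b q)) (at (coord a q))"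
    using assms by (elim has_derivative_transform_within_open) (auto simp: transition_coord)
  from has_derivative_unique[OF this jac_has_derivative] show ?thesis
    using assms by (auto simp: fun_eq_iff)
qed

lemma jac_self:
  assumes "a \<in> A" "q \<in> chart_dom a"
  shows "jac a a q w = w"
proof -
  have "(transition a a has_derivative (\<lambda>w. w)) (at (coord a q))"
    by (rule has_derivative_transform_within_open[OF has_derivative_ident open_coord_dom[OF assms(1)]])
      (use assms in \<open>auto simp: transition_coord\<close>)
  from has_derivative_unique[OF this jac_has_derivative] show ?thesis
    using assms by (auto simp: fun_eq_iff)
qed

context
  fixes c and q
  assumes c: "c \<in> A" and q: "q \<in> chart_dom c"
begin

lemma linear_to_chart: "linear (to_chart A c q)" and linear_from_chart: "linear (from_chart A c q)"
  unfolding to_chart_jac from_chart_jac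
  by (simp_all add: linear_jac c q chart_at'[OF c q] chart_at_dom'[OF c q])

lemma to_from_chart [simp]: "to_chart A c q (from_chart A c q w) = w"
  and from_to_chart [simp]: "from_chart A c q (to_chart A c q w) = w"
  unfolding to_chart_jac from_chart_jac
  by (simp_all add: jac_comp jac_self c q chart_at'[OF c q] chart_at_dom'[OF c q])

lemma matrix_to_from_chart:
  "matrix (to_chart A c q) ** matrix (from_chart A c q) = mat 1"
  "matrix (from_chart A c q) ** matrix (to_chart A c q) = mat 1"
  by (simp_all add: matrix_eq matrix_vector_mul_assoc[symmetric] matrix_mult_linear
      linear_to_chart linear_from_chart)

lemma vf_rep_coord: "vf_rep A c X (coord c q) = to_chart A c q (X q)"
  by (simp add: vf_rep_def c q)

lemma endo_rep_coord:
  "endo_rep A c J (coord c q) = matrix (to_chart A c q) ** J q ** matrix (from_chart A c q)"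
  by (simp add: endo_rep_def c q)

lemma from_vf_rep: "from_chart A c q (vf_rep A c X (coord c q)) = X q"
  by (simp add: vf_rep_coord)

lemma vf_rep_endo_app:
  "vf_rep A c (endo_app J X) (coord c q) = endo_rep A c J (coord c q) *v vf_rep A c X (coord c q)"
  by (simp add: vf_rep_coord endo_rep_coord endo_app_def matrix_vector_mul_assoc[symmetric]
      matrix_mult_linear linear_to_chart linear_from_chart)

end

lemma to_chart_at: "p \<in> topspace M \<Longrightarrow> to_chart A (chart_at A p) p w = w"
  and from_chart_at: "p \<in> topspace M \<Longrightarrow> from_chart A (chart_at A p) p w = w"
  unfolding to_chart_jac from_chart_jac by (simp_all add: jac_self chart_at chart_at_dom)

lemma vf_rep_coord_field:
  "c \<in> A \<Longrightarrow> y \<in> coord c ` chart_dom c \<Longrightarrow> vf_rep A c (coord_field A c w) y = w"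
  by (auto simp: vf_rep_coord coord_field_def)

lemma change_chart:
  assumes "c \<in> A" "c' \<in> A" "openin M U" "U \<subseteq> chart_dom c"
  shows "open (coord c' ` (U \<inter> chart_dom c'))"
    "smooth_on (coord c' ` (U \<inter> chart_dom c')) (transition c' c)"
    "transition c' c ` (coord c' ` (U \<inter> chart_dom c')) \<subseteq> coord c ` U"
proof -
  show "open (coord c' ` (U \<inter> chart_dom c'))"
    using open_coord_image[OF assms(2,3)] .
  show "smooth_on (coord c' ` (U \<inter> chart_dom c')) (transition c' c)"
    by (rule smooth_on_subset[OF transition_smooth[OF assms(2,1)]]) (use assms(4) in blast)
  show "transition c' c ` (coord c' ` (U \<inter> chart_dom c')) \<subseteq> coord c ` U"
    using assms(2) by (auto simp: transition_coord)
qed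

section \<open>Smoothness and differentiation in one chart\<close>

lemma smooth_funI:
  assumes "c \<in> A" "openin M U" "U \<subseteq> chart_dom c" "smooth_on (coord c ` U) (f \<circ> chart_inv c)"
  shows "smooth_fun A U f"
  unfolding smooth_fun_def
proof
  fix c' assume c': "c' \<in> A"
  note ch = change_chart[OF assms(1) c' assms(2,3)]
  have eq: "(f \<circ> chart_inv c) (transition c' c y) = (f \<circ> chart_inv c') y"
    if "y \<in> coord c' ` (U \<inter> chart_dom c')" for y
    using that assms(1,3) c' by (auto simp: transition_coord subset_iff)
  show "smooth_on (coord c' ` (U \<inter> chart_dom c')) (f \<circ> chart_inv c')"
    by (rule smooth_on_transfer[OF smooth_on_compose[OF ch(1,2) assms(4) ch(3)] ch(1)]) (rule eq)
qed

text \<open>Smoothness is demanded in every chart of the atlas, but the representative in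
  \<open>c'\<close> is the Jacobian applied to the one in \<open>c\<close>. That Jacobian is smooth
  for fixed vectors, hence the expansion in the standard basis.\<close>

lemma smooth_vfI:
  assumes "c \<in> A" "openin M U" "U \<subseteq> chart_dom c" "smooth_on (coord c ` U) (vf_rep A c X)"
  shows "smooth_vf A U X"
  unfolding smooth_vf_def
proof
  fix c' assume c': "c' \<in> A"
  let ?S = "coord c' ` (U \<inter> chart_dom c')" and ?t = "transition c' c"
  note ch = change_chart[OF assms(1) c' assms(2,3)]
  have "smooth_on ?S (\<lambda>y. (vf_rep A c X (?t y) $ i) *\<^sub>R
      (frechet_derivative (transition c c') (at (?t y)) (axis i 1)))" for i
  proof (intro smooth_on_bounded_bilinear[OF bounded_bilinear_scaleR ch(1)])
    show "smooth_on ?S (\<lambda>y. vf_rep A c X (?t y) $ i)"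
      by (intro smooth_on_bounded_linear[OF bounded_linear_vec_nth ch(1)] smooth_on_compose[OF ch(1,2) assms(4) ch(3)])
    have "?t ` ?S \<subseteq> coord c ` (chart_dom c \<inter> chart_dom c')"
      using assms c' by (auto simp: transition_coord)
    then show "smooth_on ?S (\<lambda>y. frechet_derivative (transition c c') (at (?t y)) (axis i 1))"
      by (intro smooth_on_compose[OF ch(1,2) smooth_on_frechet_derivative[OF transition_smooth[OF assms(1) c']]])
  qed
  then have sm: "smooth_on ?S (\<lambda>y. \<Sum>i\<in>UNIV. (vf_rep A c X (?t y) $ i) *\<^sub>R
      (frechet_derivative (transition c c') (at (?t y)) (axis i 1)))"
    by (intro smooth_on_sum ch(1))
  have eq: "(\<Sum>i\<in>UNIV. (vf_rep A c X (?t y) $ i) *\<^sub>R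
      (frechet_derivative (transition c c') (at (?t y)) (axis i 1))) = vf_rep A c' X y" if "y \<in> ?S" for y
  proof -
    from that obtain q where q: "q \<in> U" "q \<in> chart_dom c'" "y = coord c' q" by auto
    have qc: "q \<in> chart_dom c" using q assms by auto
    note facts = assms(1) c' q qc chart_at'[OF c' q(2)] chart_at_dom'[OF c' q(2)]
    have "(\<Sum>i\<in>UNIV. (vf_rep A c X (?t y) $ i) *\<^sub>R
      (frechet_derivative (transition c c') (at (?t y)) (axis i 1))) = jac c c' q (vf_rep A c X (coord c q))"
      using facts by (subst linear_vec_expand[OF linear_jac]) (simp_all add: transition_coord jac_def)
    also have "\<dots> = vf_rep A c' X y"
      using facts by (simp add: vf_rep_coord to_chart_jac jac_comp)
    finally show ?thesis .
  qed
  show "smooth_on ?S (vf_rep A c' X)"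
    by (rule smooth_on_transfer[OF sm ch(1)]) (rule eq)
qed

lemma smooth_vfD:
  "smooth_vf A U X \<Longrightarrow> c \<in> A \<Longrightarrow> smooth_on (coord c ` (U \<inter> chart_dom c)) (vf_rep A c X)"
  by (simp add: smooth_vf_def)

lemma smooth_vf_subset: "smooth_vf A U X \<Longrightarrow> V \<subseteq> U \<Longrightarrow> smooth_vf A V X"
  unfolding smooth_vf_def by (meson Int_mono image_mono order_refl smooth_on_subset)

lemma smooth_coord_field: "c \<in> A \<Longrightarrow> smooth_vf A (chart_dom c) (coord_field A c w)"
proof -
  assume c: "c \<in> A"
  have "smooth_on (coord c ` chart_dom c) (vf_rep A c (coord_field A c w))"
    by (rule smooth_on_transfer[OF smooth_on_const open_coord_dom[OF c]])
      (simp add: vf_rep_coord_field c)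
  then show ?thesis by (rule smooth_vfI[OF c openin_chart_dom[OF c] order_refl])
qed

lemma dfun_rep:
  assumes "c \<in> A" "q \<in> chart_dom c" "(f \<circ> chart_inv c) differentiable (at (coord c q))"
  shows "dfun A f q w = frechet_derivative (f \<circ> chart_inv c) (at (coord c q)) (to_chart A c q w)"
proof -
  let ?a = "chart_at A q"
  let ?S = "coord ?a ` (chart_dom ?a \<inter> chart_dom c)"
  note facts = assms(1,2) chart_at'[OF assms(1,2)] chart_at_dom'[OF assms(1,2)]
  have "open ?S" using open_coord_image_subset[OF _ openin_chart_Int] facts by auto
  moreover have "(((f \<circ> chart_inv c) \<circ> transition ?a c) has_derivative
      (frechet_derivative (f \<circ> chart_inv c) (at (coord c q)) \<circ> jac ?a c q)) (at (coord ?a q))"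
    using facts assms(3)
    by (intro diff_chain_at jac_has_derivative) (simp_all add: transition_coord frechet_derivative_works[symmetric])
  ultimately have "((f \<circ> chart_inv ?a) has_derivative
      (frechet_derivative (f \<circ> chart_inv c) (at (coord c q)) \<circ> jac ?a c q)) (at (coord ?a q))"
    using facts by (elim has_derivative_transform_within_open) (auto simp: transition_coord)
  from frechet_derivative_at[OF this] show ?thesis
    by (auto simp: dfun_def to_chart_jac fun_eq_iff)
qed

text \<open>The form in which \<open>dfun\<close> is computed below: it is enough to exhibit a
  smooth coordinate expression \<open>g\<close> for \<open>f\<close> near \<open>q\<close>, in any
  chart.\<close>

lemma dfun_rep_cong:
  assumes "c \<in> A" "openin M U" "U \<subseteq> chart_dom c" "q \<in> U" "smooth_on (coord c ` U) g"
    and "\<And>r. r \<in> U \<Longrightarrow> f r = g (coord c r)"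
  shows "dfun A f q w = frechet_derivative g (at (coord c q)) (to_chart A c q w)"
proof -
  have op: "open (coord c ` U)" using open_coord_image_subset assms by blast
  have eq: "(f \<circ> chart_inv c) y = g y" if "y \<in> coord c ` U" for y
    using that assms by auto
  have "smooth_on (coord c ` U) (f \<circ> chart_inv c)"
    by (rule smooth_on_transfer[OF assms(5) op]) (rule eq[symmetric])
  then have "(f \<circ> chart_inv c) differentiable (at (coord c q))"
    using assms(4) by (auto intro: smooth_on_differentiable)
  then show ?thesis
    using dfun_rep[of c q f w] frechet_derivative_cong_open[OF op _ eq, of "coord c q"] assms by auto
qed

lemma smooth_vf_cong:
  assumes "openin M U" "\<And>q. q \<in> U \<Longrightarrow> X q = Y q" "smooth_vf A U X"
  shows "smooth_vf A U Y"
  unfolding smooth_vf_def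
proof
  fix c assume c: "c \<in> A"
  show "smooth_on (coord c ` (U \<inter> chart_dom c)) (vf_rep A c Y)"
    by (rule smooth_on_transfer[OF smooth_vfD[OF assms(3) c] open_coord_image[OF c assms(1)]])
      (use c assms(2) in \<open>auto simp: vf_rep_coord\<close>)
qed

text \<open>Outside \<open>U\<close> the function is arbitrary; the case of interest is the
  indicator function of \<open>U\<close>.\<close>

lemma smooth_fun_locally_const:
  assumes "openin M U" "\<And>q. q \<in> U \<Longrightarrow> f q = r"
  shows "smooth_fun A U f" and "p \<in> U \<Longrightarrow> dfun A f p w = 0"
proof -
  have eq: "(f \<circ> chart_inv c) y = r" if "c \<in> A" "y \<in> coord c ` (U \<inter> chart_dom c)" for c y
    using that assms(2) by auto
  show "smooth_fun A U f"
    unfolding smooth_fun_def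
  proof
    fix c assume c: "c \<in> A"
    show "smooth_on (coord c ` (U \<inter> chart_dom c)) (f \<circ> chart_inv c)"
      by (rule smooth_on_transfer[OF smooth_on_const open_coord_image[OF c assms(1)]])
        (use eq[OF c] in simp)
  qed
  assume p: "p \<in> U"
  then have pM: "p \<in> topspace M" using assms(1) openin_subset by blast
  have "frechet_derivative (f \<circ> chart_inv (chart_at A p)) (at (coord (chart_at A p) p)) =
      frechet_derivative (\<lambda>y. r) (at (coord (chart_at A p) p))"
    by (rule frechet_derivative_cong_open[OF open_coord_image[OF chart_at[OF pM] assms(1)]])
      (use p chart_at_dom[OF pM] eq[OF chart_at[OF pM]] in auto)
  then show "dfun A f p w = 0" by (simp add: dfun_def)
qed

lemma smooth_vf_zero: "openin M U \<Longrightarrow> smooth_vf A U (\<lambda>q. 0)"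
proof -
  assume U: "openin M U"
  show ?thesis
    unfolding smooth_vf_def
  proof
    fix c assume c: "c \<in> A"
    show "smooth_on (coord c ` (U \<inter> chart_dom c)) (vf_rep A c (\<lambda>q. 0))"
      by (rule smooth_on_transfer[OF smooth_on_const[of _ 0] open_coord_image[OF c U]])
        (use c in \<open>auto simp: vf_rep_coord linear_0[OF linear_to_chart]\<close>)
  qed
qed

lemma smooth_vf_add:
  assumes U: "openin M U" and X: "smooth_vf A U X" "smooth_vf A U Y"
  shows "smooth_vf A U (\<lambda>q. X q + Y q)"
  unfolding smooth_vf_def
proof
  fix c assume c: "c \<in> A"
  show "smooth_on (coord c ` (U \<inter> chart_dom c)) (vf_rep A c (\<lambda>q. X q + Y q))"
    by (rule smooth_on_transfer[OF smooth_on_add[OF _ X[THEN smooth_vfD[OF _ c]]]])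
      (use c open_coord_image[OF c U] in \<open>auto simp: vf_rep_coord linear_add[OF linear_to_chart]\<close>)
qed

lemma smooth_coord_field_Int:
  "c \<in> A \<Longrightarrow> U \<subseteq> chart_dom c \<Longrightarrow> smooth_vf A U (coord_field A c w)"
  using smooth_coord_field smooth_vf_subset by blast

section \<open>Brackets and endomorphism fields in a chart\<close>

text \<open>In the chart \<open>c\<close> this would be immediate, but \<open>lie_bracket\<close>
  computes in the chart selected at \<open>q\<close>. There it becomes the symmetry of the second
  derivative of the transition from \<open>c\<close>.\<close>

lemma lie_bracket_coord_field:
  assumes c: "c \<in> A" and q: "q \<in> chart_dom c"
  shows "lie_bracket A (coord_field A c w) (coord_field A c u) q = 0"
proof -
  define a where "a = chart_at A q"
  have a: "a \<in> A" "q \<in> chart_dom a"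
    using chart_at'[OF c q] chart_at_dom'[OF c q] by (simp_all add: a_def)
  let ?S = "coord a ` (chart_dom a \<inter> chart_dom c)"
  let ?T = "coord c ` (chart_dom c \<inter> chart_dom a)"
  define f where "f u y = frechet_derivative (transition c a) (at y) u" for u y
  have S: "open ?S" and T: "open ?T"
    using open_coord_image_subset[OF _ openin_chart_Int] a c by auto
  have tr: "smooth_on ?T (transition c a)" by (rule transition_smooth[OF c a(1)])
  have f: "smooth_on ?T (f u)" for u
    unfolding f_def by (rule smooth_on_frechet_derivative[OF tr])
  have cf: "coord_field A c w q = jac c a q w" for w
    by (simp add: coord_field_def from_chart_jac a_def)
  \<comment> \<open>In the selected chart the field is the derivative of the transition in direction
    \<open>u\<close>; differentiating it along the other field, pulled back to \<open>c\<close>,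
    gives a second derivative of that transition.\<close>
  have "frechet_derivative (vf_rep A a (coord_field A c u)) (at (coord a q)) (coord_field A c w q) =
      frechet_derivative (f u) (at (coord c q)) w" for u w
  proof -
    have "frechet_derivative (vf_rep A a (coord_field A c u)) (at (coord a q)) =
        frechet_derivative (f u \<circ> transition a c) (at (coord a q))"
    proof (rule frechet_derivative_cong_open[OF S])
      fix y assume "y \<in> ?S"
      then obtain r where r: "y = coord a r" "r \<in> chart_dom a" "r \<in> chart_dom c" by auto
      have "vf_rep A a (coord_field A c u) y = jac (chart_at A r) a r (jac c (chart_at A r) r u)"
        using r a by (simp add: vf_rep_coord coord_field_def to_chart_jac from_chart_jac)
      also have "\<dots> = jac c a r u"
        using r a c chart_at'[OF c r(3)] chart_at_dom'[OF c r(3)] by (intro jac_comp) auto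
      finally show "vf_rep A a (coord_field A c u) y = (f u \<circ> transition a c) y"
        using r a by (simp add: f_def jac_def transition_coord)
    qed (use a q in auto)
    also have "\<dots> = frechet_derivative (f u) (at (coord c q)) \<circ> jac a c q"
    proof -
      have "(f u has_derivative frechet_derivative (f u) (at (transition a c (coord a q)))) (at (transition a c (coord a q)))"
        by (rule smooth_on_has_derivative[OF f]) (use a c q in \<open>auto simp: transition_coord\<close>)
      from diff_chain_at[OF jac_has_derivative[OF a(1) c a(2) q] this] frechet_derivative_at
      show ?thesis using a by (metis transition_coord)
    qed
    finally show ?thesis
      by (simp add: cf jac_comp jac_self a c q)
  qed
  then show ?thesis
    using frechet_derivative_symmetric[OF T tr, of "coord c q"] a c q
    by (simp add: lie_bracket_def a_def[symmetric] Let_def f_def[abs_def])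
qed

lemma smooth_vf_endo_app:
  assumes c: "c \<in> A" and U: "openin M U" "U \<subseteq> chart_dom c"
    and H: "smooth_on (coord c ` U) (endo_rep A c H)" and X: "smooth_vf A U X"
  shows "smooth_vf A U (endo_app H X)"
    and "smooth_on (coord c ` U) (vf_rep A c X)"
proof -
  note op = open_coord_image_subset[OF c U]
  show X: "smooth_on (coord c ` U) (vf_rep A c X)"
    using smooth_vfD[OF X c] U(2) by (simp add: Int_absorb2)
  show "smooth_vf A U (endo_app H X)"
    by (rule smooth_vfI[OF c U], rule smooth_on_transfer[OF smooth_on_bounded_bilinear[OF
            bounded_bilinear_matrix_vector_mult op H X] op])
      (use U(2) in \<open>auto simp: vf_rep_endo_app[OF c]\<close>)
qed

lemma to_chart_endo:
  assumes c: "c \<in> A" and q: "q \<in> chart_dom c"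
  shows "to_chart A c q (H q *v x) = endo_rep A c H (coord c q) *v to_chart A c q x"
  using vf_rep_endo_app[OF c q, of H "\<lambda>_. x"] by (simp add: vf_rep_coord[OF c q] endo_app_def)

lemma const_ext_at: "q \<in> topspace M \<Longrightarrow> const_ext A q u q = u"
  by (simp add: const_ext_def from_chart_at)

lemma smooth_const_ext:
  "q \<in> topspace M \<Longrightarrow> U \<subseteq> chart_dom (chart_at A q) \<Longrightarrow> smooth_vf A U (const_ext A q u)"
  unfolding const_ext_coord_field by (rule smooth_coord_field_Int[OF chart_at])

text \<open>The extension \<open>const_ext A q u\<close> is controlled only on the chart selected at
  \<open>q\<close>, so local computations in \<open>c\<close> must shrink to both domains.\<close>

lemma common_domain:
  assumes c: "c \<in> A" and U: "openin M U" "U \<subseteq> chart_dom c" and qU: "q \<in> U"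
  obtains W where "openin M W" "W \<subseteq> U" "W \<subseteq> chart_dom c" "W \<subseteq> chart_dom (chart_at A q)" "q \<in> W"
    "q \<in> topspace M"
proof
  have q: "q \<in> chart_dom c" using U qU by auto
  note a = chart_at'[OF c q] chart_at_dom'[OF c q]
  show "openin M (U \<inter> chart_dom (chart_at A q))"
    by (rule openin_Int[OF U(1) openin_chart_dom[OF a(1)]])
  show "q \<in> U \<inter> chart_dom (chart_at A q)" using a qU by auto
  show "q \<in> topspace M" by (rule chart_dom_topspace[OF c q])
qed (use U in auto)

lemma smooth_rep_endo:
  "smooth_endo A (topspace M) J \<Longrightarrow> c \<in> A \<Longrightarrow> smooth_on (coord c ` chart_dom c) (endo_rep A c J)"
  using chart_dom_topspace[of c] by (auto simp: smooth_endo_def Int_absorb1 subset_iff)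

lemma smooth_rep_vf:
  "smooth_vf A (topspace M) v \<Longrightarrow> c \<in> A \<Longrightarrow> smooth_on (coord c ` chart_dom c) (vf_rep A c v)"
  using chart_dom_topspace[of c] by (auto simp: smooth_vf_def Int_absorb1 subset_iff)

lemma smooth_endo_app:
  assumes J: "smooth_endo A (topspace M) J" and v: "smooth_vf A (topspace M) v"
  shows "smooth_vf A (topspace M) (endo_app J v)"
  unfolding smooth_vf_def
proof
  fix c assume c: "c \<in> A"
  have "topspace M \<inter> chart_dom c = chart_dom c" using chart_dom_topspace[OF c] by blast
  moreover have "smooth_on (coord c ` chart_dom c) (vf_rep A c (endo_app J v))"
    by (rule smooth_on_transfer[OF smooth_on_bounded_bilinear[OF bounded_bilinear_matrix_vector_mult
            open_coord_dom[OF c] smooth_rep_endo[OF J c] smooth_rep_vf[OF v c]] open_coord_dom[OF c]])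
      (auto simp: vf_rep_endo_app[OF c])
  ultimately show "smooth_on (coord c ` (topspace M \<inter> chart_dom c)) (vf_rep A c (endo_app J v))" by simp
qed

text \<open>In the chart selected at \<open>p\<close>, coordinate values at \<open>p\<close> itself
  are the bare values, so pointwise formulas need no conversion.\<close>

lemma endo_rep_at:
  "p \<in> topspace M \<Longrightarrow> endo_rep A (chart_at A p) H (coord (chart_at A p) p) = H p"
proof -
  assume p: "p \<in> topspace M"
  have "matrix (to_chart A (chart_at A p) p) = mat 1" "matrix (from_chart A (chart_at A p) p) = mat 1"
    using p by (simp_all add: to_chart_at from_chart_at matrix_def mat_def vec_eq_iff axis_def)
  then show ?thesis by (simp add: endo_rep_coord[OF chart_at[OF p] chart_at_dom[OF p]])
qed

lemma endo_rep_square: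
  assumes c: "c \<in> A" and J2: "\<And>q. q \<in> topspace M \<Longrightarrow> J q ** J q = - mat 1" and y: "y \<in> coord c ` chart_dom c"
  shows "endo_rep A c J y ** endo_rep A c J y = - mat 1"
proof -
  obtain q where q: "q \<in> chart_dom c" "y = coord c q" using y by auto
  have "endo_rep A c J y ** endo_rep A c J y = matrix (to_chart A c q) ** J q **
      (matrix (from_chart A c q) ** matrix (to_chart A c q)) ** J q ** matrix (from_chart A c q)"
    by (simp add: q endo_rep_coord[OF c] matrix_mul_assoc)
  also have "\<dots> = matrix (to_chart A c q) ** (J q ** J q) ** matrix (from_chart A c q)"
    by (simp add: matrix_to_from_chart[OF c q(1)] matrix_mul_assoc)
  finally show ?thesis
    by (simp add: J2[OF chart_dom_topspace[OF c q(1)]] matrix_minus_left matrix_minus_right matrix_to_from_chart[OF c q(1)])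
qed

end

section \<open>The connection in a chart\<close>

locale connection_atlas = smooth_atlas M A
  for M :: "'a topology" and A :: "('a, 'n::finite) chart set" +
  fixes D :: "('a, 'n) connection"
  assumes affine: "affine_connection M A D" and torsion: "torsion_free M A D"
begin

lemma conn_smooth:
  "openin M U \<Longrightarrow> smooth_vf A U X \<Longrightarrow> smooth_vf A U Y \<Longrightarrow> smooth_vf A U (\<lambda>q. D q (X q) Y)"
  using affine unfolding affine_connection_def by blast

lemma conn_linear: "openin M U \<Longrightarrow> smooth_vf A U X \<Longrightarrow> p \<in> U \<Longrightarrow> linear (\<lambda>w. D p w X)"
  using affine unfolding affine_connection_def by blast

lemma conn_add:
  "openin M U \<Longrightarrow> smooth_vf A U X \<Longrightarrow> smooth_vf A U Y \<Longrightarrow> p \<in> U \<Longrightarrow>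
    D p w (\<lambda>q. X q + Y q) = D p w X + D p w Y"
  using affine unfolding affine_connection_def by blast

lemma conn_leibniz:
  "openin M U \<Longrightarrow> smooth_vf A U X \<Longrightarrow> smooth_fun A U f \<Longrightarrow> p \<in> U \<Longrightarrow>
    D p w (\<lambda>q. f q *\<^sub>R X q) = dfun A f p w *\<^sub>R X p + f p *\<^sub>R D p w X"
  using affine unfolding affine_connection_def by blast

lemma conn_torsion:
  "openin M U \<Longrightarrow> smooth_vf A U X \<Longrightarrow> smooth_vf A U Y \<Longrightarrow> p \<in> U \<Longrightarrow>
    lie_bracket A X Y p = D p (X p) Y - D p (Y p) X"
  using torsion unfolding torsion_free_def by metis

text \<open>The function that is 1 on \<open>U\<close> and 0 elsewhere counts as smooth on \<open>U\<close>; multiplying by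
  it makes two fields that agree on \<open>U\<close> equal.\<close>

lemma conn_local:
  assumes U: "openin M U" "p \<in> U" and X: "smooth_vf A U X" and eq: "\<And>q. q \<in> U \<Longrightarrow> X q = Y q"
  shows "D p w X = D p w Y"
proof -
  define f :: "'a \<Rightarrow> real" where "f = (\<lambda>q. if q \<in> U then 1 else 0)"
  have f: "smooth_fun A U f" "dfun A f p w = 0"
    using smooth_fun_locally_const[OF U(1), of f 1] U(2) by (auto simp: f_def)
  have Y: "smooth_vf A U Y" by (rule smooth_vf_cong[OF U(1) eq X])
  have "D p w X = D p w (\<lambda>q. f q *\<^sub>R X q)"
    using conn_leibniz[OF U(1) X f(1) U(2)] f(2) U(2) by (simp add: f_def)
  also have "(\<lambda>q. f q *\<^sub>R X q) = (\<lambda>q. f q *\<^sub>R Y q)" by (auto simp: f_def eq)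
  also have "D p w (\<lambda>q. f q *\<^sub>R Y q) = D p w Y"
    using conn_leibniz[OF U(1) Y f(1) U(2)] f(2) U(2) by (simp add: f_def)
  finally show ?thesis .
qed

text \<open>Smoothness of the partial sums is carried along in the induction because
  \<open>conn_add\<close> requires it.\<close>

lemma conn_sum:
  assumes U: "openin M U" "p \<in> U" and "finite I" and X: "\<And>i. i \<in> I \<Longrightarrow> smooth_vf A U (X i)"
  shows "smooth_vf A U (\<lambda>q. \<Sum>i\<in>I. X i q) \<and> D p w (\<lambda>q. \<Sum>i\<in>I. X i q) = (\<Sum>i\<in>I. D p w (X i))"
  using assms(3) X
proof (induction I rule: finite_induct)
  case empty
  \<comment> \<open>The zero field is its own double, so additivity forces its covariant derivative
    to vanish.\<close>
  have "D p w (\<lambda>q. (0::real^'n) + 0) = D p w (\<lambda>q. 0) + D p w (\<lambda>q. 0)"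
    by (intro conn_add[OF U(1)] smooth_vf_zero U)
  then show ?case by (simp add: smooth_vf_zero U)
next
  case (insert i I)
  then show ?case
    using conn_add[OF U(1) _ _ U(2), of "X i" "\<lambda>q. \<Sum>i\<in>I. X i q"]
      smooth_vf_add[OF U(1), of "X i" "\<lambda>q. \<Sum>i\<in>I. X i q"] by simp
qed

text \<open>The Christoffel symbols, as an endomorphism for each direction \<open>w\<close>, so that
  products, commutators and traces of them make sense.\<close>

definition Gam :: "('a, 'n) chart \<Rightarrow> real^'n \<Rightarrow> real^'n \<Rightarrow> real^'n^'n" where
  "Gam c y w = matrix (\<lambda>u. vf_rep A c (\<lambda>q. D q (coord_field A c w q) (coord_field A c u)) y)"

lemma linear_Gam:
  assumes c: "c \<in> A" and y: "y \<in> coord c ` chart_dom c"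
  shows "linear (Gam c y)"
proof -
  obtain q where q: "q \<in> chart_dom c" "y = coord c q" using y by auto
  have "linear (\<lambda>w. to_chart A c q (D q (from_chart A c q w) X))" if "smooth_vf A (chart_dom c) X" for X
    using linear_compose[OF linear_compose[OF linear_from_chart[OF c q(1)]
          conn_linear[OF openin_chart_dom[OF c] that q(1)]] linear_to_chart[OF c q(1)]]
    by (simp add: o_def)
  note lin = this[OF smooth_coord_field[OF c]]
  show ?thesis
    unfolding q(2)
    by (rule linearI) (simp_all add: Gam_def matrix_def vec_eq_iff vf_rep_coord[OF c q(1)] coord_field_def[of A c w for w]
        linear_add[OF lin] linear_scale[OF lin])
qed

text \<open>Near \<open>q\<close> the field is a combination of coordinate fields with smooth
  coefficients. Locality permits replacing it by this combination, and the Leibniz rule separates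
  the derivative of the coefficients from the \<open>Gam\<close> term.\<close>

lemma vf_rep_conn:
  assumes c: "c \<in> A" and U: "openin M U" "U \<subseteq> chart_dom c" "q \<in> U" and X: "smooth_vf A U X"
  shows "to_chart A c q (D q w X) =
    frechet_derivative (vf_rep A c X) (at (coord c q)) (to_chart A c q w) +
    Gam c (coord c q) (to_chart A c q w) *v vf_rep A c X (coord c q)"
proof -
  have q: "q \<in> chart_dom c" using U by auto
  let ?V = "vf_rep A c X" and ?w = "to_chart A c q w"
  define g where "g i r = ?V (coord c r) $ i" for i r
  define E where "E i = coord_field A c (axis i 1)" for i
  have V: "smooth_on (coord c ` U) ?V"
    using smooth_vfD[OF X c] U(2) by (simp add: Int_absorb2)
  have Vi: "smooth_on (coord c ` U) (\<lambda>y. ?V y $ i)" for i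
    by (rule smooth_on_bounded_linear[OF bounded_linear_vec_nth open_coord_image_subset[OF c U(1,2)] V])
  have Vd: "?V differentiable (at (coord c q))" using V U(3) smooth_on_differentiable by blast
  have g: "smooth_fun A U (g i)" for i
    by (rule smooth_funI[OF c U(1,2)], rule smooth_on_transfer[OF Vi open_coord_image_subset[OF c U(1,2)]])
      (use c U in \<open>auto simp: g_def subset_iff\<close>)
  have dg: "dfun A (g i) q w = frechet_derivative ?V (at (coord c q)) ?w $ i" for i
    using dfun_rep_cong[OF c U Vi, of "g i"] frechet_derivative_bounded_linear[OF bounded_linear_vec_nth Vd]
    by (simp add: g_def)
  have E: "smooth_vf A U (E i)" for i
    unfolding E_def by (rule smooth_coord_field_Int[OF c U(2)])
  have gE: "smooth_vf A U (\<lambda>r. g i r *\<^sub>R E i r)" for i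
  proof (rule smooth_vfI[OF c U(1,2)])
    show "smooth_on (coord c ` U) (vf_rep A c (\<lambda>r. g i r *\<^sub>R E i r))"
      by (rule smooth_on_transfer[OF smooth_on_bounded_linear[OF bounded_linear_scaleR_left[of "axis i 1"]
              open_coord_image_subset[OF c U(1,2)] Vi]])
        (use c U in \<open>auto simp: vf_rep_coord subset_iff linear_scale[OF linear_to_chart] g_def E_def
            coord_field_def open_coord_image_subset[OF c U(1,2)]\<close>)
  qed
  have exp: "X r = (\<Sum>i\<in>UNIV. g i r *\<^sub>R E i r)" if "r \<in> U" for r
  proof -
    have r: "r \<in> chart_dom c" using U that by auto
    have "X r = from_chart A c r (?V (coord c r))" by (simp add: from_vf_rep[OF c r])
    also have "\<dots> = (\<Sum>i\<in>UNIV. g i r *\<^sub>R E i r)"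
      by (subst linear_vec_expand[OF linear_from_chart[OF c r]]) (simp add: g_def E_def coord_field_def)
    finally show ?thesis .
  qed
  have "D q w X = D q w (\<lambda>r. \<Sum>i\<in>UNIV. g i r *\<^sub>R E i r)"
    by (rule conn_local[OF U(1,3) X exp])
  also have "\<dots> = (\<Sum>i\<in>UNIV. D q w (\<lambda>r. g i r *\<^sub>R E i r))"
    using conn_sum[OF U(1,3) finite, of UNIV "\<lambda>i r. g i r *\<^sub>R E i r"] gE by blast
  also have "\<dots> = (\<Sum>i\<in>UNIV. (frechet_derivative ?V (at (coord c q)) ?w $ i) *\<^sub>R E i q + g i q *\<^sub>R D q w (E i))"
    by (intro sum.cong refl) (simp only: conn_leibniz[OF U(1) E g U(3)] dg)
  also have "to_chart A c q \<dots> = (\<Sum>i\<in>UNIV. (frechet_derivative ?V (at (coord c q)) ?w $ i) *\<^sub>R axis i 1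
      + (?V (coord c q) $ i) *\<^sub>R to_chart A c q (D q w (E i)))"
  proof -
    note lin = linear_to_chart[OF c q]
    have "to_chart A c q (E i q) = axis i 1" for i
      by (simp add: E_def coord_field_def to_from_chart[OF c q])
    then show ?thesis
      by (simp add: linear_sum[OF lin] linear_add[OF lin] linear_scale[OF lin] g_def)
  qed
  also have "\<dots> = frechet_derivative ?V (at (coord c q)) ?w
      + (\<Sum>i\<in>UNIV. (?V (coord c q) $ i) *\<^sub>R to_chart A c q (D q w (E i)))"
    using basis_expansion[of "frechet_derivative ?V (at (coord c q)) ?w"]
    by (simp add: sum.distrib scalar_mult_eq_scaleR)
  also have "(\<Sum>i\<in>UNIV. (?V (coord c q) $ i) *\<^sub>R to_chart A c q (D q w (E i))) =
      Gam c (coord c q) ?w *v ?V (coord c q)"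
    by (simp add: Gam_def E_def vf_rep_coord[OF c q] coord_field_def[of A c ?w] c q
        matrix_def matrix_vector_mult_def vec_eq_iff mult.commute)
  finally show ?thesis .
qed

lemma Gam_apply:
  assumes c: "c \<in> A" and q: "q \<in> chart_dom c"
  shows "Gam c (coord c q) w *v u = to_chart A c q (D q (coord_field A c w q) (coord_field A c u))"
proof -
  have "frechet_derivative (vf_rep A c (coord_field A c u)) (at (coord c q)) = frechet_derivative (\<lambda>y. u) (at (coord c q))"
    by (rule frechet_derivative_cong_open[OF open_coord_dom[OF c]]) (use c q in \<open>auto simp: vf_rep_coord_field\<close>)
  then show ?thesis
    using vf_rep_conn[OF c openin_chart_dom[OF c] order_refl q smooth_coord_field[OF c], of "coord_field A c w q" u]
    by (simp add: vf_rep_coord_field c q coord_field_def[of A c w])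
qed

lemma smooth_Gam:
  assumes c: "c \<in> A"
  shows "smooth_on (coord c ` chart_dom c) (\<lambda>y. Gam c y w)"
proof (intro smooth_on_vec open_coord_dom[OF c])
  fix i j
  have "smooth_on (coord c ` chart_dom c) (vf_rep A c (\<lambda>q. D q (coord_field A c w q) (coord_field A c (axis j 1))))"
    using smooth_vfD[OF conn_smooth[OF openin_chart_dom[OF c] smooth_coord_field[OF c] smooth_coord_field[OF c]] c]
    by simp
  from smooth_on_bounded_linear[OF bounded_linear_vec_nth open_coord_dom[OF c] this]
  show "smooth_on (coord c ` chart_dom c) (\<lambda>y. Gam c y w $ i $ j)"
    by (simp add: Gam_def matrix_def)
qed

text \<open>Coordinate fields commute, so vanishing torsion is the symmetry of the Christoffel
  symbols.\<close>

lemma Gam_sym: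
  assumes c: "c \<in> A" and y: "y \<in> coord c ` chart_dom c"
  shows "Gam c y w *v u = Gam c y u *v w"
proof -
  obtain q where q: "q \<in> chart_dom c" "y = coord c q" using y by auto
  have "D q (coord_field A c w q) (coord_field A c u) = D q (coord_field A c u q) (coord_field A c w)"
    using conn_torsion[OF openin_chart_dom[OF c] smooth_coord_field[OF c] smooth_coord_field[OF c] q(1), of w u]
      lie_bracket_coord_field[OF c q(1), of w u] by simp
  then show ?thesis by (simp add: q Gam_apply[OF c])
qed

end

section \<open>Covariant derivatives, Lie derivative and curvature in coordinates\<close>

context connection_atlas
begin

text \<open>The covariant derivative of an endomorphism field: partial derivative plus commutator
  with \<Gamma>.\<close>

definition cov_rep :: "('a, 'n) chart \<Rightarrow> (real^'n \<Rightarrow> real^'n^'n) \<Rightarrow> real^'n \<Rightarrow> real^'n \<Rightarrow> real^'n^'n" where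
  "cov_rep c K y w = frechet_derivative K (at y) w + Gam c y w ** K y - K y ** Gam c y w"

text \<open>The endomorphism \<nabla>V sending w to \<nabla>_w V. By symmetry of \<Gamma>, the part
  sending w to \<Gamma>_w V is simply the matrix \<Gamma>_V.\<close>

definition grad_rep :: "('a, 'n) chart \<Rightarrow> (real^'n \<Rightarrow> real^'n) \<Rightarrow> real^'n \<Rightarrow> real^'n^'n" where
  "grad_rep c V y = matrix (frechet_derivative V (at y)) + Gam c y (V y)"

text \<open>The derivative of \<open>X\<close> occurs in both halves of
  \<open>cov_endo_field\<close> and cancels, which is why only the value of \<open>X\<close> at
  \<open>q\<close> remains.\<close>

lemma cov_endo_field_rep:
  assumes c: "c \<in> A" and U: "openin M U" "U \<subseteq> chart_dom c" and qU: "q \<in> U"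
    and H: "smooth_on (coord c ` U) (endo_rep A c H)" and X: "smooth_vf A U X"
  shows "to_chart A c q (cov_endo_field D H q w X) =
    cov_rep c (endo_rep A c H) (coord c q) (to_chart A c q w) *v to_chart A c q (X q)"
proof -
  let ?y = "coord c q" and ?w = "to_chart A c q w" and ?V = "vf_rep A c X" and ?K = "endo_rep A c H"
  have q: "q \<in> chart_dom c" and y: "?y \<in> coord c ` U" using qU U by auto
  note HX = smooth_vf_endo_app[OF c U H X]
  have dK: "?K differentiable (at ?y)" by (rule smooth_on_differentiable[OF H y])
  have dV: "?V differentiable (at ?y)" by (rule smooth_on_differentiable[OF HX(2) y])
  have "frechet_derivative (vf_rep A c (endo_app H X)) (at ?y) = frechet_derivative (\<lambda>y. ?K y *v ?V y) (at ?y)"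
    by (rule frechet_derivative_cong_open[OF open_coord_image_subset[OF c U] y])
      (use U(2) in \<open>auto simp: vf_rep_endo_app[OF c]\<close>)
  then have 1: "to_chart A c q (D q w (endo_app H X)) =
      ?K ?y *v frechet_derivative ?V (at ?y) ?w + frechet_derivative ?K (at ?y) ?w *v ?V ?y + Gam c ?y ?w *v (?K ?y *v ?V ?y)"
    using vf_rep_conn[OF c U qU HX(1), of w]
      frechet_derivative_bilinear[OF bounded_bilinear_matrix_vector_mult dK dV, of ?w]
    by (simp add: vf_rep_endo_app[OF c q])
  have 2: "to_chart A c q (H q *v D q w X) =
      ?K ?y *v (frechet_derivative ?V (at ?y) ?w + Gam c ?y ?w *v ?V ?y)"
    using vf_rep_conn[OF c U qU X, of w] by (simp add: to_chart_endo[OF c q])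
  show ?thesis
    unfolding cov_endo_field_def linear_diff[OF linear_to_chart[OF c q]] 1 2 cov_rep_def
    by (simp add: algebra_simps matrix_vector_mul_assoc vf_rep_coord[OF c q])
qed

lemma cov_endo_rep:
  assumes c: "c \<in> A" and U: "openin M U" "U \<subseteq> chart_dom c" and qU: "q \<in> U"
    and H: "smooth_on (coord c ` U) (endo_rep A c H)"
  shows "cov_endo A D H q w = matrix (from_chart A c q) **
    cov_rep c (endo_rep A c H) (coord c q) (to_chart A c q w) ** matrix (to_chart A c q)"
proof -
  let ?C = "cov_rep c (endo_rep A c H) (coord c q) (to_chart A c q w)"
  have q: "q \<in> chart_dom c" using U qU by auto
  obtain W where W: "openin M W" "W \<subseteq> U" "W \<subseteq> chart_dom c" "W \<subseteq> chart_dom (chart_at A q)" "q \<in> W"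
    and qM: "q \<in> topspace M"
    using common_domain[OF c U qU] .
  have HW: "smooth_on (coord c ` W) (endo_rep A c H)"
    by (rule smooth_on_subset[OF H]) (use W in blast)
  have "cov_endo_field D H q w (const_ext A q u) =
      (matrix (from_chart A c q) ** ?C ** matrix (to_chart A c q)) *v u" for u
  proof -
    have "to_chart A c q (cov_endo_field D H q w (const_ext A q u)) = ?C *v to_chart A c q u"
      using cov_endo_field_rep[OF c W(1,3,5) HW smooth_const_ext[OF qM W(4)], of w u] by (simp add: const_ext_at qM)
    then have "cov_endo_field D H q w (const_ext A q u) = from_chart A c q (?C *v to_chart A c q u)"
      by (metis from_to_chart[OF c q])
    then show ?thesis
      by (simp add: matrix_vector_mul_assoc[symmetric] matrix_mult_linear linear_to_chart[OF c q] linear_from_chart[OF c q])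
  qed
  then show ?thesis by (simp add: cov_endo_def)
qed

lemma cov_endo_field_cov_endo:
  assumes c: "c \<in> A" and U: "openin M U" "U \<subseteq> chart_dom c" and qU: "q \<in> U"
    and H: "smooth_on (coord c ` U) (endo_rep A c H)" and X: "smooth_vf A U X"
  shows "cov_endo_field D H q w X = cov_endo A D H q w *v X q"
proof -
  have q: "q \<in> chart_dom c" using U qU by auto
  show ?thesis
    using cov_endo_field_rep[OF assms, of w] from_to_chart[OF c q, of "cov_endo_field D H q w X"]
    by (simp add: cov_endo_rep[OF c U qU H] matrix_vector_mul_assoc[symmetric] matrix_mult_linear
        linear_to_chart[OF c q] linear_from_chart[OF c q])
qed

lemma grad_rep_conn:
  assumes c: "c \<in> A" and U: "openin M U" "U \<subseteq> chart_dom c" "q \<in> U" and v: "smooth_vf A U v"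
  shows "D q w v = (matrix (from_chart A c q) ** grad_rep c (vf_rep A c v) (coord c q) ** matrix (to_chart A c q)) *v w"
proof -
  let ?y = "coord c q" and ?w = "to_chart A c q w" and ?V = "vf_rep A c v"
  have q: "q \<in> chart_dom c" and y: "?y \<in> coord c ` chart_dom c" using U by auto
  have V: "smooth_on (coord c ` U) ?V"
    using smooth_vfD[OF v c] U(2) by (simp add: Int_absorb2)
  have "linear (frechet_derivative ?V (at ?y))"
    by (rule smooth_on_linear[OF V]) (use U in blast)
  then have "to_chart A c q (D q w v) = grad_rep c ?V ?y *v ?w"
    unfolding vf_rep_conn[OF c U v] grad_rep_def
    by (simp add: matrix_mult_linear matrix_vector_mult_add_rdistrib Gam_sym[OF c y, of ?w])
  then have "D q w v = from_chart A c q (grad_rep c ?V ?y *v ?w)"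
    by (metis from_to_chart[OF c q])
  then show ?thesis
    by (simp add: matrix_vector_mul_assoc[symmetric] matrix_mult_linear linear_to_chart[OF c q] linear_from_chart[OF c q])
qed

text \<open>Brackets with \<open>v\<close> are differences of covariant derivatives; the derivatives
  of the extended vector combine to \<nabla>_v J and the others to the commutator of J with
  \<nabla>v. The formula is stated at every \<open>q\<close> of the chart because it is
  differentiated later.\<close>

lemma lie_endo_rep:
  assumes c: "c \<in> A" and q: "q \<in> chart_dom c" and v: "smooth_vf A (topspace M) v"
    and J: "smooth_on (coord c ` chart_dom c) (endo_rep A c J)"
  shows "endo_rep A c (lie_endo A v J) (coord c q) =
    cov_rep c (endo_rep A c J) (coord c q) (vf_rep A c v (coord c q))
    + endo_rep A c J (coord c q) ** grad_rep c (vf_rep A c v) (coord c q)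
    - grad_rep c (vf_rep A c v) (coord c q) ** endo_rep A c J (coord c q)"
    (is "_ = ?N + ?K ** ?B - ?B ** ?K")
proof -
  let ?P = "matrix (to_chart A c q)" and ?Q = "matrix (from_chart A c q)"
  obtain W where W: "openin M W" "W \<subseteq> chart_dom c" "W \<subseteq> chart_dom (chart_at A q)" "q \<in> W"
    and qM: "q \<in> topspace M"
    using common_domain[OF c openin_chart_dom[OF c] order_refl q] by metis
  have vW: "smooth_vf A W v"
    by (rule smooth_vf_subset[OF v]) (use W openin_subset in blast)
  have JW: "smooth_on (coord c ` W) (endo_rep A c J)"
    by (rule smooth_on_subset[OF J]) (use W in blast)
  have Dv: "D q w v = (?Q ** ?B ** ?P) *v w" for w
    by (rule grad_rep_conn[OF c W(1,2,4) vW])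
  have PQ: "?P ** ?Q = mat 1" "?Q ** ?P = mat 1" by (rule matrix_to_from_chart[OF c q])+
  have K: "?K = ?P ** J q ** ?Q" by (rule endo_rep_coord[OF c q])
  have PV: "to_chart A c q (v q) = vf_rep A c v (coord c q)" by (simp add: vf_rep_coord[OF c q])
  have C: "cov_endo A D J q (v q) = ?Q ** ?N ** ?P"
    using cov_endo_rep[OF c W(1,2,4) JW, of "v q"] by (simp add: PV)
  have "lie_bracket A v (endo_app J (const_ext A q u)) q - J q *v lie_bracket A v (const_ext A q u) q =
      (?Q ** ?N ** ?P + J q ** (?Q ** ?B ** ?P) - (?Q ** ?B ** ?P) ** J q) *v u" for u
  proof -
    note X = smooth_const_ext[OF qM W(3), of u]
    note JX = smooth_vf_endo_app(1)[OF c W(1,2) JW X]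
    have "lie_bracket A v (endo_app J (const_ext A q u)) q - J q *v lie_bracket A v (const_ext A q u) q =
        cov_endo_field D J q (v q) (const_ext A q u) - D q (J q *v u) v + J q *v D q u v"
      by (simp add: conn_torsion[OF W(1) vW JX W(4)] conn_torsion[OF W(1) vW X W(4)] cov_endo_field_def
          endo_app_apply const_ext_at qM algebra_simps)
    then show ?thesis
      by (simp add: cov_endo_field_cov_endo[OF c W(1,2,4) JW X] const_ext_at qM C Dv
          matrix_vector_mult_add_rdistrib matrix_vector_mult_diff_rdistrib matrix_vector_mul_assoc)
  qed
  then have "lie_endo A v J q = ?Q ** ?N ** ?P + J q ** (?Q ** ?B ** ?P) - (?Q ** ?B ** ?P) ** J q"
    by (simp add: lie_endo_def)
  then have "endo_rep A c (lie_endo A v J) (coord c q) =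
      (?P ** ?Q) ** ?N ** (?P ** ?Q) + ?P ** J q ** ?Q ** ?B ** (?P ** ?Q) - (?P ** ?Q) ** ?B ** ?P ** J q ** ?Q"
    by (simp add: endo_rep_coord[OF c q] matrix_add_ldistrib matrix_add_rdistrib matrix_diff_ldistrib
        matrix_diff_rdistrib matrix_mul_assoc)
  then show ?thesis unfolding PQ K by (simp add: matrix_mul_assoc)
qed

lemma linear_cov_rep:
  assumes c: "c \<in> A" and y: "y \<in> coord c ` chart_dom c" and K: "smooth_on (coord c ` chart_dom c) K"
  shows "linear (cov_rep c K y)"
  by (rule linearI) (simp_all add: cov_rep_def linear_add[OF smooth_on_linear[OF K y]]
      linear_scale[OF smooth_on_linear[OF K y]] linear_add[OF linear_Gam[OF c y]] linear_scale[OF linear_Gam[OF c y]]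
      matrix_add_ldistrib matrix_add_rdistrib matrix_scaleR_left matrix_scaleR_right algebra_simps)

text \<open>Conjugation invariance of the trace gives this at all points of \<open>c\<close>, as
  required for the exterior derivative of \<lambda>_J at \<open>p\<close>.\<close>

lemma lambda_form_rep:
  assumes c: "c \<in> A" and q: "q \<in> chart_dom c"
    and J: "smooth_on (coord c ` chart_dom c) (endo_rep A c J)"
  shows "lambda_form A D J q u =
    trace (matrix (\<lambda>w. cov_rep c (endo_rep A c J) (coord c q) w *v to_chart A c q u))"
proof -
  let ?K = "endo_rep A c J" and ?y = "coord c q"
  let ?L = "\<lambda>w. cov_rep c ?K ?y w *v to_chart A c q u"
  have y: "?y \<in> coord c ` chart_dom c" using q by blast
  have "linear (cov_rep c ?K ?y)" by (rule linear_cov_rep[OF c y J])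
  then have L: "linear ?L"
    by (auto intro!: linearI simp: linear_add linear_scale matrix_vector_mult_add_rdistrib scaleR_matrix_vector)
  have "(\<lambda>w. cov_endo A D J q w *v u) = (\<lambda>w. (matrix (from_chart A c q) ** matrix ?L ** matrix (to_chart A c q)) *v w)"
    by (simp add: cov_endo_rep[OF c openin_chart_dom[OF c] order_refl q J] matrix_vector_mul_assoc[symmetric]
        matrix_mult_linear linear_to_chart[OF c q] linear_from_chart[OF c q] L fun_eq_iff)
  then show ?thesis
    by (simp add: lambda_form_def trace_conjugate[OF matrix_to_from_chart(1)[OF c q]])
qed

text \<open>The classical formula \<partial>\<Gamma> - \<partial>\<Gamma> + [\<Gamma>,\<Gamma>]; the
  bracket term drops out since coordinate fields commute.\<close>

lemma curvature_rep:
  fixes p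
  defines "c \<equiv> chart_at A p"
  assumes p: "p \<in> topspace M"
  shows "curvature A D p u v =
    frechet_derivative (\<lambda>y. Gam c y v) (at (coord c p)) u - frechet_derivative (\<lambda>y. Gam c y u) (at (coord c p)) v
    + Gam c (coord c p) u ** Gam c (coord c p) v - Gam c (coord c p) v ** Gam c (coord c p) u"
proof -
  have c: "c \<in> A" and pc: "p \<in> chart_dom c" using chart_at[OF p] chart_at_dom[OF p] by (auto simp: c_def)
  let ?y = "coord c p"
  have y: "?y \<in> coord c ` chart_dom c" using pc by blast
  note op = openin_chart_dom[OF c]
  have toc: "to_chart A c p w = w" for w unfolding c_def by (rule to_chart_at[OF p])
  have ce: "const_ext A p w = coord_field A c w" for w by (simp add: const_ext_coord_field c_def)
  have "D p (coord_field A c u p) (\<lambda>q. D q (coord_field A c v q) (coord_field A c w)) =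
      (frechet_derivative (\<lambda>y. Gam c y v) (at ?y) u + Gam c ?y u ** Gam c ?y v) *v w" for u v w
  proof -
    let ?X = "\<lambda>q. D q (coord_field A c v q) (coord_field A c w)"
    have X: "smooth_vf A (chart_dom c) ?X"
      by (rule conn_smooth[OF op smooth_coord_field[OF c] smooth_coord_field[OF c]])
    have rep: "vf_rep A c ?X y = Gam c y v *v w" if "y \<in> coord c ` chart_dom c" for y
      using that by (auto simp: vf_rep_coord[OF c] Gam_apply[OF c])
    have "frechet_derivative (vf_rep A c ?X) (at ?y) = frechet_derivative (\<lambda>y. Gam c y v *v w) (at ?y)"
      by (rule frechet_derivative_cong_open[OF open_coord_dom[OF c] y rep])
    moreover have "frechet_derivative (\<lambda>y. Gam c y v *v w) (at ?y) u = frechet_derivative (\<lambda>y. Gam c y v) (at ?y) u *v w"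
      by (rule frechet_derivative_bounded_linear[OF bounded_bilinear.bounded_linear_left[OF
            bounded_bilinear_matrix_vector_mult] smooth_on_differentiable[OF smooth_Gam[OF c] y]])
    moreover have "coord_field A c u p = u" by (simp add: coord_field_def c_def from_chart_at p)
    ultimately show ?thesis
      using vf_rep_conn[OF c op order_refl pc X, of u]
      by (simp add: toc rep[OF y] matrix_vector_mul_assoc matrix_vector_mult_add_rdistrib)
  qed
  moreover have "D p 0 (coord_field A c w) = 0" for w
    using linear_0[OF conn_linear[OF op smooth_coord_field[OF c] pc]] .
  ultimately have "curvature_field A D (const_ext A p u) (const_ext A p v) (const_ext A p w) p =
      (frechet_derivative (\<lambda>y. Gam c y v) (at ?y) u - frechet_derivative (\<lambda>y. Gam c y u) (at ?y) v
      + Gam c ?y u ** Gam c ?y v - Gam c ?y v ** Gam c ?y u) *v w" for w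
    by (simp add: curvature_field_def ce lie_bracket_coord_field[OF c pc]
        matrix_vector_mult_add_rdistrib matrix_vector_mult_diff_rdistrib)
  then show ?thesis by (simp add: curvature_def)
qed

lemma smooth_cov_rep:
  assumes c: "c \<in> A" and K: "smooth_on (coord c ` chart_dom c) K"
  shows "smooth_on (coord c ` chart_dom c) (\<lambda>y. cov_rep c K y w)"
  unfolding cov_rep_def
  by (rule smooth_on_diff[OF open_coord_dom[OF c] smooth_on_add[OF open_coord_dom[OF c]
          smooth_on_frechet_derivative[OF K]
          smooth_on_bounded_bilinear[OF bounded_bilinear_matrix_matrix_mult open_coord_dom[OF c] smooth_Gam[OF c] K]]
        smooth_on_bounded_bilinear[OF bounded_bilinear_matrix_matrix_mult open_coord_dom[OF c] K smooth_Gam[OF c]]])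

lemma smooth_grad_rep:
  assumes c: "c \<in> A" and V: "smooth_on (coord c ` chart_dom c) V"
  shows "smooth_on (coord c ` chart_dom c) (grad_rep c V)"
proof -
  note op = open_coord_dom[OF c]
  have "smooth_on (coord c ` chart_dom c) (\<lambda>y. matrix (frechet_derivative V (at y)))"
  proof (intro smooth_on_vec op)
    fix i j
    show "smooth_on (coord c ` chart_dom c) (\<lambda>y. matrix (frechet_derivative V (at y)) $ i $ j)"
      using smooth_on_bounded_linear[OF bounded_linear_vec_nth op smooth_on_frechet_derivative[OF V]]
      by (simp add: matrix_def)
  qed
  then show ?thesis
    unfolding grad_rep_def[abs_def]
    by (rule smooth_on_add[OF op _ frechet_derivative_linear_family(1)[OF op linear_Gam[OF c] smooth_Gam[OF c] V]])
qed

lemma grad_rep_apply: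
  assumes c: "c \<in> A" and y: "y \<in> coord c ` chart_dom c" and V: "smooth_on (coord c ` chart_dom c) V"
  shows "grad_rep c V y *v z = frechet_derivative V (at y) z + Gam c y z *v V y"
  by (simp add: grad_rep_def matrix_vector_mult_add_rdistrib matrix_mult_linear[OF smooth_on_linear[OF V y]]
      Gam_sym[OF c y, of "V y"])

lemma cov_endo_at:
  fixes p
  defines "c \<equiv> chart_at A p"
  assumes p: "p \<in> topspace M" and H: "smooth_on (coord c ` chart_dom c) (endo_rep A c H)"
  shows "cov_endo A D H p w = cov_rep c (endo_rep A c H) (coord c p) w"
proof -
  have "matrix (to_chart A c p) = mat 1" "matrix (from_chart A c p) = mat 1"
    using p by (simp_all add: c_def to_chart_at from_chart_at matrix_def mat_def vec_eq_iff axis_def)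
  then show ?thesis
    using cov_endo_rep[OF chart_at[OF p] openin_chart_dom[OF chart_at[OF p]] order_refl chart_at_dom[OF p]
        H[unfolded c_def], of w] p
    by (simp add: to_chart_at c_def)
qed

text \<open>Differentiate \<open>K y ** K y = - mat 1\<close>; the commutator with \<Gamma>
  anticommutes with \<open>K y\<close> for the same reason.\<close>

lemma cov_rep_anticommute:
  assumes c: "c \<in> A" and y: "y \<in> coord c ` chart_dom c" and K: "smooth_on (coord c ` chart_dom c) K"
    and K2: "\<And>y. y \<in> coord c ` chart_dom c \<Longrightarrow> K y ** K y = - mat 1"
  shows "cov_rep c K y w ** K y = - (K y ** cov_rep c K y w)"
proof -
  note d = smooth_on_differentiable[OF K y]
  have "0 = frechet_derivative (\<lambda>y. K y ** K y) (at y) w"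
    by (rule frechet_derivative_const_on[OF open_coord_dom[OF c] y K2, symmetric])
  also have "\<dots> = K y ** frechet_derivative K (at y) w + frechet_derivative K (at y) w ** K y"
    by (rule frechet_derivative_bilinear[OF bounded_bilinear_matrix_matrix_mult d d])
  finally have 1: "frechet_derivative K (at y) w ** K y = - (K y ** frechet_derivative K (at y) w)"
    by (simp add: eq_neg_iff_add_eq_0 add.commute)
  have 2: "Gam c y w ** K y ** K y = - Gam c y w" "K y ** K y ** Gam c y w = - Gam c y w"
    using K2[OF y] by (simp_all add: matrix_mul_assoc[symmetric] matrix_minus_right)
      (simp add: K2[OF y] matrix_mul_assoc matrix_minus_left)
  show ?thesis
    by (simp add: cov_rep_def matrix_distribs matrix_mul_assoc 1 2)
qed

end

section \<open>Volume form and divergence\<close>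

locale volume_connection = connection_atlas M A D
  for M :: "'a topology" and A :: "('a, 'n::finite) chart set" and D :: "('a, 'n) connection" +
  fixes \<rho> :: "'a \<Rightarrow> (real^'n) list \<Rightarrow> real"
  assumes volume: "positive_volume_form M A \<rho>" and parallel: "parallel_form M A D CARD('n) \<rho>"
begin

abbreviation std_frame :: "(real^'n) list" where
  "std_frame \<equiv> row_list (mat 1)"

text \<open>The density h for which \<rho> = h det in the chart \<open>c\<close>.\<close>

definition dens :: "('a, 'n) chart \<Rightarrow> real^'n \<Rightarrow> real" where
  "dens c y = \<rho> (chart_inv c y) (map (from_chart A c (chart_inv c y)) std_frame)"

lemma volume_coord:
  assumes c: "c \<in> A" and q: "q \<in> chart_dom c" and ws: "length ws = CARD('n)"
  shows "\<rho> q (map (from_chart A c q) ws) = dens c (coord c q) * frame_det ws"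
proof -
  have "alternating_multilinear CARD('n) (\<rho> q)"
    using volume chart_dom_topspace[OF c q] by (simp add: positive_volume_form_def)
  from alternating_multilinear_eq_frame_det[OF alternating_multilinear_map[OF this linear_from_chart[OF c q]] ws]
  show ?thesis by (simp add: dens_def c q)
qed

lemma smooth_dens:
  assumes c: "c \<in> A" shows "smooth_on (coord c ` chart_dom c) (dens c)"
proof -
  have "topspace M \<inter> chart_dom c = chart_dom c" using chart_dom_topspace[OF c] by blast
  moreover have "smooth_form A (topspace M) CARD('n) \<rho>" using volume by (simp add: positive_volume_form_def)
  ultimately have "smooth_on (coord c ` chart_dom c)
      (\<lambda>y. \<rho> (chart_inv c y) (map (from_chart A c (chart_inv c y)) ws))" if "length ws = CARD('n)" for ws
    using c that unfolding smooth_form_def by auto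
  from this[OF length_row_list, of "mat 1"] show ?thesis by (simp only: dens_def[abs_def])
qed

text \<open>The standard frame has determinant 1, so \<rho> is positive on it, while a zero density
  would annihilate every frame at \<open>q\<close>.\<close>

lemma dens_nonzero:
  assumes c: "c \<in> A" and q: "q \<in> chart_dom c"
  shows "dens c (coord c q) \<noteq> 0"
proof
  assume "dens c (coord c q) = 0"
  then have "\<rho> q (map (from_chart A c q) (map (to_chart A c q) std_frame)) = 0"
    by (subst volume_coord[OF c q]) simp_all
  moreover have "map (from_chart A c q) (map (to_chart A c q) std_frame) = std_frame"
    by (simp add: o_def c q)
  moreover have "\<rho> q std_frame > 0"
    using volume chart_dom_topspace[OF c q] by (simp add: positive_volume_form_def)
  ultimately show False by simp
qed

text \<open>Parallelism is evaluated on the coordinate fields. Applying \<Gamma>_w in one slot after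
  the other and adding up gives the trace, by \<open>sum_frame_det_update\<close>. Multiplying out
  by h avoids the logarithm.\<close>

lemma dens_derivative:
  assumes c: "c \<in> A" and q: "q \<in> chart_dom c"
  shows "frechet_derivative (dens c) (at (coord c q)) w = dens c (coord c q) * trace (Gam c (coord c q) w)"
proof -
  define Xs where "Xs = map (coord_field A c) std_frame"
  have Xs: "map (\<lambda>X. X r) Xs = map (from_chart A c r) std_frame" for r
    by (simp add: Xs_def coord_field_def)
  have L: "length Xs = CARD('n)" by (simp add: Xs_def)
  let ?w = "from_chart A c q w"
  have "dfun A (\<lambda>r. \<rho> r (map (\<lambda>X. X r) Xs)) q ?w =
      (\<Sum>i<CARD('n). \<rho> q ((map (\<lambda>X. X q) Xs)[i := D q ?w (Xs ! i)]))"
  proof -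
    have "\<forall>X\<in>set Xs. smooth_vf A (chart_dom c) X"
      by (auto simp: Xs_def smooth_coord_field[OF c])
    then show ?thesis
      using parallel openin_chart_dom[OF c] q L unfolding parallel_form_def by blast
  qed
  also have "dfun A (\<lambda>r. \<rho> r (map (\<lambda>X. X r) Xs)) q ?w = frechet_derivative (dens c) (at (coord c q)) w"
    using dfun_rep_cong[OF c openin_chart_dom[OF c] order_refl q smooth_dens[OF c],
        of "\<lambda>r. \<rho> r (map (\<lambda>X. X r) Xs)" ?w] c q
    by (simp add: Xs dens_def)
  also have "(\<Sum>i<CARD('n). \<rho> q ((map (\<lambda>X. X q) Xs)[i := D q ?w (Xs ! i)])) =
      (\<Sum>i<CARD('n). dens c (coord c q) * frame_det (std_frame[i := Gam c (coord c q) w *v (std_frame ! i)]))"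
  proof (intro sum.cong refl)
    fix i assume "i \<in> {..<CARD('n)}"
    then have i: "i < length std_frame" by simp
    have "D q ?w (Xs ! i) = from_chart A c q (to_chart A c q (D q ?w (Xs ! i)))" by (simp add: c q)
    also have "to_chart A c q (D q ?w (Xs ! i)) = Gam c (coord c q) w *v (std_frame ! i)"
      using i by (simp add: Xs_def Gam_apply[OF c q] coord_field_def[of A c w])
    finally have "(map (\<lambda>X. X q) Xs)[i := D q ?w (Xs ! i)] =
        map (from_chart A c q) (std_frame[i := Gam c (coord c q) w *v (std_frame ! i)])"
      by (simp add: Xs map_update)
    then show "\<rho> q ((map (\<lambda>X. X q) Xs)[i := D q ?w (Xs ! i)]) =
        dens c (coord c q) * frame_det (std_frame[i := Gam c (coord c q) w *v (std_frame ! i)])"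
      by (simp add: volume_coord[OF c q])
  qed
  also have "\<dots> = dens c (coord c q) * trace (Gam c (coord c q) w)"
    using sum_frame_det_update[of "(*v) (Gam c (coord c q) w)" std_frame]
    by (simp add: sum_distrib_left[symmetric])
  finally show ?thesis .
qed

text \<open>The second derivative of h is h \<partial>(trace \<Gamma>) plus a product symmetric in
  \<open>u\<close> and \<open>w\<close>; symmetry of the whole leaves the claim after division by
  h.\<close>

lemma trace_Gam_closed:
  assumes c: "c \<in> A" and y: "y \<in> coord c ` chart_dom c"
  shows "trace (frechet_derivative (\<lambda>y. Gam c y u) (at y) w) = trace (frechet_derivative (\<lambda>y. Gam c y w) (at y) u)"
proof -
  let ?S = "coord c ` chart_dom c"
  note op = open_coord_dom[OF c]
  have h: "smooth_on ?S (dens c)" by (rule smooth_dens[OF c])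
  have tr: "smooth_on ?S (\<lambda>y. trace (Gam c y w))" for w
    by (rule smooth_on_bounded_linear[OF bounded_linear_trace op smooth_Gam[OF c]])
  have "frechet_derivative (\<lambda>y. frechet_derivative (dens c) (at y) u) (at y) w =
      dens c y * trace (frechet_derivative (\<lambda>y. Gam c y u) (at y) w) + dens c y * trace (Gam c y w) * trace (Gam c y u)"
    for u w
  proof -
    have "frechet_derivative (\<lambda>y. frechet_derivative (dens c) (at y) u) (at y) =
        frechet_derivative (\<lambda>y. dens c y * trace (Gam c y u)) (at y)"
      by (rule frechet_derivative_cong_open[OF op y]) (use dens_derivative[OF c] in auto)
    moreover have "frechet_derivative (\<lambda>y. trace (Gam c y u)) (at y) w = trace (frechet_derivative (\<lambda>y. Gam c y u) (at y) w)"
      by (rule frechet_derivative_bounded_linear[OF bounded_linear_trace smooth_on_differentiable[OF smooth_Gam[OF c] y]])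
    moreover have "frechet_derivative (dens c) (at y) w = dens c y * trace (Gam c y w)"
      using y dens_derivative[OF c] by auto
    ultimately show ?thesis
      using frechet_derivative_bilinear[OF bounded_bilinear_mult smooth_on_differentiable[OF h y]
          smooth_on_differentiable[OF tr y], of u w] by simp
  qed
  moreover have "dens c y \<noteq> 0" using y dens_nonzero[OF c] by auto
  ultimately show ?thesis
    using frechet_derivative_symmetric[OF op h y, of u w] by simp
qed

text \<open>\<open>ext_d\<close> extends vectors with constant coefficients in the chart selected at
  the point, so the divergence is first computed in that chart only.\<close>

lemma divergence_own_chart:
  fixes q
  defines "c \<equiv> chart_at A q"
  assumes q: "q \<in> topspace M" and v: "smooth_vf A (topspace M) v"
  shows "divergence A \<rho> v q = trace (grad_rep c (vf_rep A c v) (coord c q))"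
proof -
  have c: "c \<in> A" and qc: "q \<in> chart_dom c" using chart_at[OF q] chart_at_dom[OF q] by (auto simp: c_def)
  note op = openin_chart_dom[OF c]
  let ?V = "vf_rep A c v" and ?y = "coord c q" and ?S = "coord c ` chart_dom c"
  have y: "?y \<in> ?S" using qc by blast
  have V: "smooth_on ?S ?V"
    using smooth_vfD[OF v c] chart_dom_topspace[OF c] by (simp add: Int_absorb1 subset_iff)
  have h: "smooth_on ?S (dens c)" by (rule smooth_dens[OF c])
  have hV: "smooth_on ?S (\<lambda>y. dens c y *\<^sub>R ?V y)"
    by (rule smooth_on_bounded_bilinear[OF bounded_bilinear_scaleR open_coord_dom[OF c] h V])
  \<comment> \<open>The contraction of \<rho> with v is the determinant with hV in front. Its
    exterior derivative therefore depends on D(hV) only, whose trace is h trace (\<nabla>V) since dh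
    = h trace \<Gamma>.\<close>
  define L where "L = frechet_derivative (\<lambda>y. dens c y *\<^sub>R ?V y) (at ?y)"
  have L: "linear L" unfolding L_def by (rule smooth_on_linear[OF hV y])
  have Leq: "L w = dens c ?y *\<^sub>R frechet_derivative ?V (at ?y) w + (dens c ?y * trace (Gam c ?y w)) *\<^sub>R ?V ?y" for w
    unfolding L_def dens_derivative[OF c qc, symmetric]
    by (rule frechet_derivative_bilinear[OF bounded_bilinear_scaleR smooth_on_differentiable[OF h y]
          smooth_on_differentiable[OF V y]])
  have trGam: "linear (\<lambda>w. trace (Gam c ?y w))"
    using linear_compose[OF linear_Gam[OF c y] bounded_linear.linear[OF bounded_linear_trace]] by (simp add: o_def)
  have trL: "trace (matrix L) = dens c ?y * trace (grad_rep c ?V ?y)"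
  proof -
    have "trace (matrix L) = dens c ?y * trace (matrix (frechet_derivative ?V (at ?y)))
        + dens c ?y * (\<Sum>k\<in>UNIV. (?V ?y $ k) *\<^sub>R trace (Gam c ?y (axis k 1)))"
      by (simp add: trace_matrix Leq sum.distrib sum_distrib_left mult.assoc mult.commute[of "?V ?y $ _"])
    also have "(\<Sum>k\<in>UNIV. (?V ?y $ k) *\<^sub>R trace (Gam c ?y (axis k 1))) = trace (Gam c ?y (?V ?y))"
      by (rule linear_vec_expand[OF trGam, symmetric])
    finally show ?thesis by (simp add: grad_rep_def trace_add distrib_left)
  qed
  have toc: "to_chart A c q w = w" for w unfolding c_def by (rule to_chart_at[OF q])
  have fd_lin: "bounded_linear (\<lambda>x. frame_det (x # us))" if "Suc (length us) = CARD('n)" for us :: "(real^'n) list"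
  proof -
    have "linear (\<lambda>x. frame_det ((0 # us)[0 := x]))"
      using alternating_multilinear_frame_det[where 'n = 'n] that unfolding alternating_multilinear_def
      by (metis length_Cons zero_less_card_finite)
    then show ?thesis by (simp add: linear_conv_bounded_linear)
  qed
  have ext: "ext_d A (interior_product v \<rho>) q ws = trace (grad_rep c ?V ?y) * \<rho> q ws" if ws: "length ws = CARD('n)" for ws
  proof -
    have summand: "dfun A (\<lambda>r. interior_product v \<rho> r (map (\<lambda>w. const_ext A q w r) us)) q w = frame_det (L w # us)"
      if us: "Suc (length us) = CARD('n)" for us w
    proof -
      note bl = fd_lin[OF us]
      have sm: "smooth_on ?S (\<lambda>y. frame_det (dens c y *\<^sub>R ?V y # us))"
        by (rule smooth_on_bounded_linear[OF bl open_coord_dom[OF c] hV])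
      have "interior_product v \<rho> r (map (\<lambda>w. const_ext A q w r) us) = frame_det (dens c (coord c r) *\<^sub>R ?V (coord c r) # us)"
        if r: "r \<in> chart_dom c" for r
      proof -
        have "interior_product v \<rho> r (map (\<lambda>w. const_ext A q w r) us) = \<rho> r (map (from_chart A c r) (?V (coord c r) # us))"
          by (simp add: interior_product_def const_ext_def c_def[symmetric] from_vf_rep[OF c r])
        also have "\<dots> = dens c (coord c r) * frame_det (?V (coord c r) # us)"
          by (rule volume_coord[OF c r]) (simp add: us)
        also have "\<dots> = frame_det (dens c (coord c r) *\<^sub>R ?V (coord c r) # us)"
          using linear_scale[OF bounded_linear.linear[OF bl]] by simp
        finally show ?thesis .
      qed
      from dfun_rep_cong[OF c op order_refl qc sm this]
      have "dfun A (\<lambda>r. interior_product v \<rho> r (map (\<lambda>w. const_ext A q w r) us)) q w =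
          frechet_derivative (\<lambda>y. frame_det (dens c y *\<^sub>R ?V y # us)) (at ?y) w"
        by (simp add: toc)
      also have "\<dots> = frame_det (L w # us)"
        unfolding L_def by (rule frechet_derivative_bounded_linear[OF bl smooth_on_differentiable[OF hV y]])
      finally show ?thesis .
    qed
    \<comment> \<open>The alternating signs disappear on moving each vector into its slot, and the
      remaining sum over slots is a trace.\<close>
    have "ext_d A (interior_product v \<rho>) q ws =
        (\<Sum>i<CARD('n). (-1) ^ i * frame_det (L (ws ! i) # take i ws @ drop (Suc i) ws))"
      unfolding ext_d_def ws by (intro sum.cong refl) (subst summand, use ws in auto)
    also have "\<dots> = (\<Sum>i<CARD('n). frame_det (ws[i := L (ws ! i)]))"
      by (intro sum.cong refl alternating_multilinear_insert[OF alternating_multilinear_frame_det ws]) simp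
    also have "\<dots> = trace (grad_rep c ?V ?y) * (dens c ?y * frame_det ws)"
      by (simp add: sum_frame_det_update[OF L ws] trL)
    also have "dens c ?y * frame_det ws = \<rho> q ws"
    proof -
      have "map (from_chart A c q) ws = ws"
        by (rule map_idI) (simp add: c_def from_chart_at q)
      then show ?thesis using volume_coord[OF c qc ws] by simp
    qed
    finally show ?thesis .
  qed
  have pos: "\<rho> q std_frame > 0"
    using volume q by (simp add: positive_volume_form_def)
  show ?thesis
    unfolding divergence_def
  proof (rule the_equality)
    show "\<forall>ws. length ws = CARD('n) \<longrightarrow> trace (grad_rep c ?V ?y) * \<rho> q ws = ext_d A (interior_product v \<rho>) q ws"
      using ext by simp
    fix r assume "\<forall>ws. length ws = CARD('n) \<longrightarrow> r * \<rho> q ws = ext_d A (interior_product v \<rho>) q ws"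
    then have "r * \<rho> q std_frame = trace (grad_rep c ?V ?y) * \<rho> q std_frame" using ext by simp
    then show "r = trace (grad_rep c ?V ?y)" using pos by simp
  qed
qed

text \<open>To differentiate the divergence at \<open>p\<close> its values at nearby points, with
  other selected charts, are needed in \<open>c\<close>. The trace of the map sending
  \<open>w\<close> to \<open>D q w v\<close> is the same in both charts.\<close>

lemma divergence_rep:
  assumes c: "c \<in> A" and q: "q \<in> chart_dom c" and v: "smooth_vf A (topspace M) v"
  shows "divergence A \<rho> v q = trace (grad_rep c (vf_rep A c v) (coord c q))"
proof -
  have qM: "q \<in> topspace M" by (rule chart_dom_topspace[OF c q])
  have rep: "(\<lambda>w. D q w v) = (\<lambda>w. (matrix (from_chart A c q) ** grad_rep c (vf_rep A c v) (coord c q)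
      ** matrix (to_chart A c q)) *v w)" if c: "c \<in> A" and q: "q \<in> chart_dom c" for c
    by (rule ext, rule grad_rep_conn[OF c openin_chart_dom[OF c] order_refl q smooth_vf_subset[OF v]])
      (use chart_dom_topspace[OF c] in blast)
  have tr: "trace (matrix (\<lambda>w. D q w v)) = trace (grad_rep c (vf_rep A c v) (coord c q))"
    if "c \<in> A" "q \<in> chart_dom c" for c
    unfolding rep[OF that] by (simp add: trace_conjugate[OF matrix_to_from_chart(1)[OF that]])
  show ?thesis
    using divergence_own_chart[OF qM v] tr[OF chart_at[OF qM] chart_at_dom[OF qM]] tr[OF c q] by simp
qed

end

section \<open>The Lie derivative of \<open>J\<close>\<close>

text \<open>The linear algebra behind the first identity, with the data at one point as free
  letters: \<open>N\<close> is \<nabla>J, \<open>B\<close> is \<nabla>v, \<open>H\<close> is L_v J,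
  \<open>R\<close> the curvature; \<open>dN w z\<close> is the derivative of N_z in direction
  \<open>w\<close>, and likewise for \<open>dG\<close>, \<open>d2J\<close> and
  \<open>d2V\<close>.\<close>

lemma Lambda_lie_pointwise:
  fixes J B dV :: "real^'n^'n" and V u :: "real^'n" and N G dJ dB :: "real^'n \<Rightarrow> real^'n^'n"
    and dN dG d2J :: "real^'n \<Rightarrow> real^'n \<Rightarrow> real^'n^'n" and d2V :: "real^'n \<Rightarrow> real^'n \<Rightarrow> real^'n"
  assumes J2: "J ** J = - mat 1"
    and NJ: "\<And>w. N w ** J = - (J ** N w)"
    and N: "\<And>w. N w = dJ w + G w ** J - J ** G w" and linN: "linear N"
    and dN: "\<And>w z. dN w z = d2J w z + (dG w z ** J + G z ** dJ w) - (dJ w ** G z + J ** dG w z)"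
    and d2J: "\<And>w z. d2J w z = d2J z w" and d2V: "\<And>w z. d2V w z = d2V z w"
    and G: "\<And>w z. G w *v z = G z *v w" and dG: "\<And>w z z'. dG w z *v z' = dG w z' *v z"
    and B: "B = dV + G V"
    and dB: "\<And>w z. dB w *v z = d2V w z + dG w z *v V + G z *v (dV *v w)"
    and closed: "\<And>w z. trace (dG w z) = trace (dG z w)"
  defines "H \<equiv> N V + J ** B - B ** J"
    and "R \<equiv> \<lambda>w z. dG w z - dG z w + G w ** G z - G z ** G w"
  shows "map_trace (\<lambda>w. (N (dV *v w) + dN w V + dJ w ** B + J ** dB w - dB w ** J - B ** dJ w
        + G w ** H - H ** G w) *v u) + 1/2 * trace (H ** J ** N u) =
      2 * (1/4 * trace (N V ** J ** N u) + 1/2 * trace (J ** R V u)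
        + 1/2 * (map_trace (\<lambda>w. dN V w *v u) - map_trace (\<lambda>w. dN u w *v V)))
      - trace (dB (J *v u))
      + (map_trace (\<lambda>w. dN u w *v V) + map_trace (\<lambda>w. N w *v (dV *v u)) + trace (dJ u ** B) + trace (J ** dB u))"
proof -
  \<comment> \<open>\<open>C w\<close> is the covariant derivative of \<nabla>v in direction
    \<open>w\<close>.\<close>
  define C where "C w = dB w + G w ** B - B ** G w" for w
  \<comment> \<open>The Ricci identity for J. The correction of the differentiated index by
    \<Gamma>_w z is omitted on both sides; it is symmetric in \<open>w\<close> and
    \<open>z\<close>.\<close>
  have ricci: "dN w z + G w ** N z - N z ** G w = dN z w + G z ** N w - N w ** G z + (R w z ** J - J ** R w z)" for w z
    using d2J[of w z] by (simp add: dN N R_def matrix_distribs matrix_mul_assoc algebra_simps)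
  \<comment> \<open>The Ricci identity for the field v.\<close>
  have C_comm: "C w *v z = C z *v w + R w z *v V" for w z
  proof -
    have "C w *v z = d2V w z + dG w z *v V + G z *v (dV *v w) + G w *v (dV *v z) + G w *v (G z *v V) - B *v (G w *v z)" for w z
      by (simp add: C_def dB B G[of V z] matrix_vector_mult_add_rdistrib matrix_vector_mult_diff_rdistrib
          matrix_vector_right_distrib matrix_vector_mul_assoc[symmetric] algebra_simps)
    then show ?thesis
      using d2V[of w z] G[of w z]
      by (simp add: R_def matrix_vector_mult_add_rdistrib matrix_vector_mult_diff_rdistrib matrix_vector_mul_assoc[symmetric])
  qed
  have trC: "trace (C w) = trace (dB w)" for w
    by (simp add: C_def trace_add trace_sub trace_mul_sym[of B "G w"])
  \<comment> \<open>First Bianchi identity, arranged so that \<open>w\<close> ends up in the last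
    slot.\<close>
  have bianchi: "R w a *v b - R w b *v a = R b a *v w" for w a b
  proof -
    have "dG w a *v b = dG w b *v a" "dG a w *v b = dG a b *v w" "dG b w *v a = dG b a *v w" by (rule dG)+
    moreover have "G a *v b = G b *v a" "G w *v b = G b *v w" "G w *v a = G a *v w" by (rule G)+
    ultimately show ?thesis
      by (simp add: R_def matrix_vector_mult_add_rdistrib matrix_vector_mult_diff_rdistrib matrix_vector_mul_assoc[symmetric])
  qed
  have trR: "trace (R a b) = 0" for a b
    by (simp add: R_def trace_add trace_sub closed[of a b] trace_mul_sym[of "G a" "G b"])
  have linNz: "linear (\<lambda>w. N w *v z)" for z
    by (rule linearI) (simp_all add: linear_add[OF linN] linear_scale[OF linN] matrix_vector_mult_add_rdistrib scaleR_matrix_vector)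
  \<comment> \<open>Product rule for the covariant derivative of \<open>H\<close>, followed by
    exchanging the directions \<open>w\<close> and \<open>V\<close> with the Ricci identity.\<close>
  have covH: "N (dV *v w) + dN w V + dJ w ** B + J ** dB w - dB w ** J - B ** dJ w + G w ** H - H ** G w
      = N (dV *v w) + dN V w + G V ** N w - N w ** G V + (R w V ** J - J ** R w V)
        + N w ** B + J ** C w - C w ** J - B ** N w" (is "?L w = ?R w") for w
  proof -
    have "?L w = N (dV *v w) + (dN w V + G w ** N V - N V ** G w) + N w ** B + J ** C w - C w ** J - B ** N w"
      by (simp add: H_def C_def N[of w] matrix_distribs matrix_mul_assoc algebra_simps)
    also have "\<dots> = ?R w" by (simp add: ricci[of w V] algebra_simps)
    finally show ?thesis .
  qed
  \<comment> \<open>The trace runs over \<open>w\<close>, so \<open>C_comm\<close> moves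
    \<open>w\<close> from the direction into the argument of \<open>C\<close>. The \<Gamma>_V terms
    cancel against those inside \<open>B\<close>.\<close>
  have pt: "?L w *v u =
      (N (dV *v w) *v u - dV *v (N w *v u)) + dN V w *v u + N w *v (dV *v u)
      + R w V *v (J *v u) - J *v (R w V *v u) + J *v (R w u *v V) - R w (J *v u) *v V
      + (J ** C u) *v w - C (J *v u) *v w" for w
    unfolding covH
    using C_comm[of w u] C_comm[of w "J *v u"]
    by (simp add: B matrix_vector_mult_add_rdistrib matrix_vector_mult_diff_rdistrib
        matrix_vector_right_distrib matrix_vector_mul_assoc[symmetric] algebra_simps)
  \<comment> \<open>Two uses of Bianchi pair up the four curvature terms;
    \<open>R (J *v u) V\<close> is traceless, and the other one is the curvature term of the Ricci
    form.\<close>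
  have curv: "R w V *v (J *v u) - J *v (R w V *v u) + J *v (R w u *v V) - R w (J *v u) *v V
      = (R (J *v u) V + J ** R V u) *v w" for w
    using bianchi[of w V "J *v u"] bianchi[of w u V, THEN diff_eq_eq[THEN iffD1]]
    by (simp add: matrix_vector_right_distrib matrix_vector_mult_add_rdistrib matrix_vector_mult_diff_distrib
        matrix_vector_mul_assoc[symmetric] algebra_simps)
  \<comment> \<open>Under the trace the bracketed difference vanishes by cyclicity.\<close>
  have "map_trace (\<lambda>w. ?L w *v u) =
      map_trace (\<lambda>w. (N (dV *v w) *v u - dV *v (N w *v u)) + dN V w *v u + N w *v (dV *v u)
      + ((R (J *v u) V + J ** R V u) *v w) + (J ** C u) *v w - C (J *v u) *v w)"
    unfolding pt curv[symmetric] by (simp add: algebra_simps)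
  also have "\<dots> = map_trace (\<lambda>w. dN V w *v u) + map_trace (\<lambda>w. N w *v (dV *v u))
      + trace (J ** R V u) + trace (J ** C u) - trace (dB (J *v u))"
    by (simp add: map_trace_add map_trace_diff map_trace_commute[OF linNz] trace_add trR trC)
  finally have first: "map_trace (\<lambda>w. ?L w *v u) = \<dots>" .
  \<comment> \<open>Passing from the covariant to the partial derivative of \<open>B\<close> creates
    the commutator of J with \<Gamma>_u, which is \<open>dJ u - N u\<close>.\<close>
  have trJC: "trace (J ** C u) = trace (J ** dB u) + trace (dJ u ** B) - trace (N u ** B)"
  proof -
    have "trace (J ** (B ** G u)) = trace (G u ** J ** B)"
      by (metis matrix_mul_assoc trace_mul_sym)
    then show ?thesis
      by (simp add: C_def N matrix_distribs trace_add trace_sub matrix_mul_assoc)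
  qed
  \<comment> \<open>Both halves of the commutator of J with \<open>B\<close> contribute
    \<open>trace (N u ** B)\<close>; half of this total cancels the last term of
    \<open>trJC\<close>.\<close>
  have "trace (H ** J ** N u) = trace (N V ** J ** N u) + 2 * trace (N u ** B)"
  proof -
    have "J ** N u ** J = N u"
    proof -
      have "J ** N u ** J = - (J ** J ** N u)"
        using NJ[of u] by (metis matrix_minus_right matrix_mul_assoc)
      then show ?thesis by (simp add: J2 matrix_minus_left)
    qed
    then have "trace (J ** B ** J ** N u) = trace (N u ** B)"
      by (metis matrix_mul_assoc trace_mul_sym)
    moreover have "B ** J ** J ** N u = - (B ** N u)"
      by (metis J2 matrix_mul_assoc matrix_minus_left matrix_minus_right matrix_mul_lid)
    ultimately show ?thesis
      by (simp add: H_def matrix_distribs trace_add trace_sub trace_minus trace_mul_sym[of B "N u"])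
  qed
  then show ?thesis unfolding first trJC by (simp add: algebra_simps)
qed

context volume_connection
begin

text \<open>All ingredients are rewritten at \<open>x\<close> in the chart selected at
  \<open>p\<close>, after which only the pointwise identity remains.\<close>

lemma Lambda_lie:
  assumes J: "smooth_endo A (topspace M) J" and J2: "\<And>q. q \<in> topspace M \<Longrightarrow> J q ** J q = - mat 1"
    and v: "smooth_vf A (topspace M) v" and p: "p \<in> topspace M"
  shows "Lambda_form A D J (lie_endo A v J) p u =
    2 * ricci_form A D J p (v p) u - dfun A (divergence A \<rho> v) p (J p *v u)
    + dfun A (divergence A \<rho> (endo_app J v)) p u"
proof -
  define c where "c = chart_at A p"
  define x where "x = coord c p"
  define S where "S = coord c ` chart_dom c"
  define K where "K = endo_rep A c J"
  define V where "V = vf_rep A c v"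
  define H where "H y = cov_rep c K y (V y) + K y ** grad_rep c V y - grad_rep c V y ** K y" for y
  define dN where "dN w z = frechet_derivative (\<lambda>y. cov_rep c K y z) (at x) w" for w z
  define dG where "dG w z = frechet_derivative (\<lambda>y. Gam c y z) (at x) w" for w z
  define dK where "dK w = frechet_derivative K (at x) w" for w
  define dB where "dB w = frechet_derivative (grad_rep c V) (at x) w" for w
  define dV where "dV = matrix (frechet_derivative V (at x))"
  have c: "c \<in> A" and pc: "p \<in> chart_dom c" using chart_at[OF p] chart_at_dom[OF p] by (auto simp: c_def)
  have op: "open S" and x: "x \<in> S" using open_coord_dom[OF c] pc by (auto simp: S_def x_def)
  note dom = openin_chart_dom[OF c]
  have toc: "to_chart A c p w = w" for w by (simp add: c_def to_chart_at p)
  have K: "smooth_on S K" unfolding S_def K_def by (rule smooth_rep_endo[OF J c])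
  have V: "smooth_on S V" unfolding S_def V_def by (rule smooth_rep_vf[OF v c])
  have K2: "K y ** K y = - mat 1" if "y \<in> S" for y
    using endo_rep_square[OF c J2] that by (simp add: S_def K_def)
  have N: "smooth_on S (\<lambda>y. cov_rep c K y w)" for w
    using smooth_cov_rep[OF c K[unfolded S_def]] by (simp add: S_def)
  have linN: "linear (cov_rep c K y)" if "y \<in> S" for y
    using linear_cov_rep[OF c _ K[unfolded S_def]] that by (simp add: S_def)
  have B: "smooth_on S (grad_rep c V)"
    using smooth_grad_rep[OF c V[unfolded S_def]] by (simp add: S_def)
  have G: "smooth_on S (\<lambda>y. Gam c y w)" for w
    using smooth_Gam[OF c] by (simp add: S_def)
  note mm = bounded_bilinear_matrix_matrix_mult and mv = bounded_bilinear_matrix_vector_mult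
  note dif = smooth_on_differentiable[OF _ x]
  have smm: "smooth_on S (\<lambda>y. P y ** Q y)" if "smooth_on S P" "smooth_on S Q" for P Q :: "real^'n \<Rightarrow> real^'n^'n"
    by (rule smooth_on_bounded_bilinear[OF mm op that])
  have smv: "smooth_on S (\<lambda>y. P y *v X y)" if "smooth_on S P" "smooth_on S X" for P :: "real^'n \<Rightarrow> real^'n^'n" and X
    by (rule smooth_on_bounded_bilinear[OF mv op that])
  have dmm: "frechet_derivative (\<lambda>y. P y ** Q y) (at x) w = P x ** frechet_derivative Q (at x) w + frechet_derivative P (at x) w ** Q x"
    if "smooth_on S P" "smooth_on S Q" for P Q :: "real^'n \<Rightarrow> real^'n^'n" and w
    by (rule frechet_derivative_bilinear[OF mm dif[OF that(1)] dif[OF that(2)]])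
  have dmv: "frechet_derivative (\<lambda>y. P y *v X y) (at x) w = P x *v frechet_derivative X (at x) w + frechet_derivative P (at x) w *v X x"
    if "smooth_on S P" "smooth_on S X" for P :: "real^'n \<Rightarrow> real^'n^'n" and X w
    by (rule frechet_derivative_bilinear[OF mv dif[OF that(1)] dif[OF that(2)]])
  have dV: "frechet_derivative V (at x) w = dV *v w" for w
    by (simp add: dV_def matrix_mult_linear[OF smooth_on_linear[OF V x]])
  have NV: "smooth_on S (\<lambda>y. cov_rep c K y (V y))"
    "frechet_derivative (\<lambda>y. cov_rep c K y (V y)) (at x) w = dN w (V x) + cov_rep c K x (dV *v w)" for w
    using frechet_derivative_linear_family[OF op linN N V] x by (simp_all add: dN_def dV)
  note sd = smooth_on_diff[OF op smooth_on_add[OF op NV(1) smm[OF K B]] smm[OF B K]]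
  have H: "smooth_on S H" unfolding H_def[abs_def] by (rule sd)
  have dH: "frechet_derivative H (at x) w = cov_rep c K x (dV *v w) + dN w (V x) + dK w ** grad_rep c V x + K x ** dB w
      - dB w ** K x - grad_rep c V x ** dK w" for w
    unfolding H_def[abs_def]
    by (simp add: frechet_derivative_minus[OF dif[OF smooth_on_add[OF op NV(1) smm[OF K B]]] dif[OF smm[OF B K]]]
        frechet_derivative_plus[OF dif[OF NV(1)] dif[OF smm[OF K B]]] NV(2) dmm K B dK_def dB_def algebra_simps)
  \<comment> \<open>Valid on all of \<open>S\<close>, so that the Lie derivative may be
    differentiated through \<open>H\<close>.\<close>
  have repH: "endo_rep A c (lie_endo A v J) y = H y" if "y \<in> S" for y
    using that lie_endo_rep[OF c _ v K[unfolded K_def S_def]] by (auto simp: S_def H_def K_def V_def)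
  have smH: "smooth_on S (endo_rep A c (lie_endo A v J))"
    by (rule smooth_on_transfer[OF H op]) (rule repH[symmetric])
  have "frechet_derivative (endo_rep A c (lie_endo A v J)) (at x) = frechet_derivative H (at x)"
    by (rule frechet_derivative_cong_open[OF op x]) (rule repH)
  then have covH: "cov_endo A D (lie_endo A v J) p w = cov_rep c K x (dV *v w) + dN w (V x) + dK w ** grad_rep c V x
      + K x ** dB w - dB w ** K x - grad_rep c V x ** dK w + Gam c x w ** H x - H x ** Gam c x w" for w
    using cov_endo_at[OF p smH[unfolded S_def c_def], of w] repH[OF x]
    by (simp add: cov_rep_def[of _ "endo_rep _ _ _"] dH c_def[symmetric] x_def[symmetric])
  have covJ: "cov_endo A D J p w = cov_rep c K x w" for w
    using cov_endo_at[OF p K[unfolded S_def K_def c_def], of w] by (simp add: c_def[symmetric] x_def K_def)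
  have atp: "J p = K x" "lie_endo A v J p = H x" "v p = V x"
    using endo_rep_at[OF p, of J] endo_rep_at[OF p, of "lie_endo A v J"] repH[OF x] vf_rep_coord[OF c pc, of v]
    by (simp_all add: c_def[symmetric] x_def[symmetric] K_def V_def toc)
  \<comment> \<open>The extended vector has the constant coordinates \<open>b\<close> in
    \<open>c\<close>, so only the factor \<nabla>J is differentiated.\<close>
  have lam: "dfun A (\<lambda>q. lambda_form A D J q (const_ext A p b q)) p a = map_trace (\<lambda>w. dN a w *v b)" for a b
  proof -
    have s: "smooth_on S (\<lambda>y. cov_rep c K y w *v b)" for w by (rule smv[OF N smooth_on_const])
    have l: "lambda_form A D J q (const_ext A p b q) = map_trace (\<lambda>w. cov_rep c K (coord c q) w *v b)"
      if "q \<in> chart_dom c" for q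
      using lambda_form_rep[OF c that K[unfolded S_def K_def], of "const_ext A p b q"]
      by (simp add: const_ext_def c_def[symmetric] K_def c that)
    have "dfun A (\<lambda>q. lambda_form A D J q (const_ext A p b q)) p a =
        frechet_derivative (\<lambda>y. map_trace (\<lambda>w. cov_rep c K y w *v b)) (at x) a"
      using dfun_rep_cong[OF c dom order_refl pc map_trace_derivative(1)[OF op x s, unfolded S_def] l, of a]
      by (simp add: toc x_def)
    then show ?thesis
      by (simp add: map_trace_derivative(2)[OF op x s] dmv[OF N smooth_on_const] dN_def)
  qed
  have ext: "ext_d A (\<lambda>q ws. lambda_form A D J q (ws ! 0)) p [V x, u] =
      map_trace (\<lambda>w. dN (V x) w *v u) - map_trace (\<lambda>w. dN u w *v V x)"
    by (simp add: ext_d_def lam lessThan_Suc numeral_2_eq_2)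
  have div1: "dfun A (divergence A \<rho> v) p w = trace (dB w)" for w
    using dfun_rep_cong[OF c dom order_refl pc smooth_on_bounded_linear[OF bounded_linear_trace op B, unfolded S_def],
        of "divergence A \<rho> v" w] divergence_rep[OF c _ v]
    by (simp add: toc V_def[symmetric] x_def[symmetric] dB_def
        frechet_derivative_bounded_linear[OF bounded_linear_trace dif[OF B]])
  have div2: "dfun A (divergence A \<rho> (endo_app J v)) p u =
      map_trace (\<lambda>w. dN u w *v V x) + map_trace (\<lambda>w. cov_rep c K x w *v (dV *v u)) + trace (dK u ** grad_rep c V x) + trace (K x ** dB u)"
  proof -
    \<comment> \<open>Product rule for \<nabla>(Jv): the divergence of Jv is \<lambda>_J(v) plus the
      trace of J \<nabla>v.\<close>
    let ?g = "\<lambda>y. map_trace (\<lambda>w. cov_rep c K y w *v V y) + trace (K y ** grad_rep c V y)"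
    let ?W = "vf_rep A c (endo_app J v)"
    have W: "smooth_on S ?W" unfolding S_def by (rule smooth_rep_vf[OF smooth_endo_app[OF J v] c])
    have WKV: "?W y = K y *v V y" if "y \<in> S" for y
      using that by (auto simp: S_def K_def V_def vf_rep_endo_app[OF c])
    have g: "trace (grad_rep c ?W y) = ?g y" if y: "y \<in> S" for y
    proof -
      have "frechet_derivative ?W (at y) w = K y *v frechet_derivative V (at y) w + frechet_derivative K (at y) w *v V y" for w
        using frechet_derivative_cong_open[OF op y WKV]
          frechet_derivative_bilinear[OF mv smooth_on_differentiable[OF K y] smooth_on_differentiable[OF V y], of w]
        by simp
      then have "grad_rep c ?W y *v w = cov_rep c K y w *v V y + (K y ** grad_rep c V y) *v w" for w
        using y by (simp add: grad_rep_apply[OF c _ W[unfolded S_def]] grad_rep_apply[OF c _ V[unfolded S_def]] S_def[symmetric]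
            WKV cov_rep_def matrix_vector_mult_add_rdistrib matrix_vector_mult_diff_rdistrib
            matrix_vector_right_distrib matrix_vector_mul_assoc[symmetric])
      then have "map_trace (\<lambda>w. grad_rep c ?W y *v w) = map_trace (\<lambda>w. cov_rep c K y w *v V y + (K y ** grad_rep c V y) *v w)"
        by simp
      then show ?thesis by (simp add: map_trace_add)
    qed
    have s1: "smooth_on S (\<lambda>y. cov_rep c K y w *v V y)" for w by (rule smv[OF N V])
    note s1' = map_trace_derivative(1)[OF op x s1]
    note s2' = smooth_on_bounded_linear[OF bounded_linear_trace op smm[OF K B]]
    have sg: "smooth_on S ?g" by (rule smooth_on_add[OF op s1' s2'])
    have "divergence A \<rho> (endo_app J v) q = ?g (coord c q)" if "q \<in> chart_dom c" for q
      using divergence_rep[OF c that smooth_endo_app[OF J v]] g that by (simp add: S_def)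
    from dfun_rep_cong[OF c dom order_refl pc sg[unfolded S_def] this]
    have "dfun A (divergence A \<rho> (endo_app J v)) p u = frechet_derivative ?g (at x) u"
      by (simp add: toc x_def)
    also have "\<dots> = map_trace (\<lambda>w. dN u w *v V x) + map_trace (\<lambda>w. cov_rep c K x w *v (dV *v u))
        + trace (dK u ** grad_rep c V x) + trace (K x ** dB u)"
      by (simp add: frechet_derivative_plus[OF dif[OF s1'] dif[OF s2']] map_trace_derivative(2)[OF op x s1]
          dmv[OF N V] dN_def[symmetric] map_trace_add dV
          frechet_derivative_bounded_linear[OF bounded_linear_trace dif[OF smm[OF K B]]] dmm[OF K B] trace_add dK_def dB_def)
    finally show ?thesis .
  qed
  have curv: "curvature A D p (V x) u = dG (V x) u - dG u (V x) + Gam c x (V x) ** Gam c x u - Gam c x u ** Gam c x (V x)"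
    using curvature_rep[OF p, of "V x" u] by (simp add: c_def[symmetric] x_def[symmetric] dG_def)
  have key: "map_trace (\<lambda>w. (cov_rep c K x (dV *v w) + dN w (V x) + dK w ** grad_rep c V x + K x ** dB w
        - dB w ** K x - grad_rep c V x ** dK w + Gam c x w ** H x - H x ** Gam c x w) *v u)
        + 1/2 * trace (H x ** K x ** cov_rep c K x u) =
      2 * (1/4 * trace (cov_rep c K x (V x) ** K x ** cov_rep c K x u) + 1/2 * trace (K x **
          (dG (V x) u - dG u (V x) + Gam c x (V x) ** Gam c x u - Gam c x u ** Gam c x (V x)))
        + 1/2 * (map_trace (\<lambda>w. dN (V x) w *v u) - map_trace (\<lambda>w. dN u w *v V x)))
      - trace (dB (K x *v u))
      + (map_trace (\<lambda>w. dN u w *v V x) + map_trace (\<lambda>w. cov_rep c K x w *v (dV *v u)) + trace (dK u ** grad_rep c V x) + trace (K x ** dB u))"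
    unfolding H_def
  \<comment> \<open>The second derivatives of J and v occur in the premises only, so unification
    with the goal cannot find them.\<close>
  proof (rule Lambda_lie_pointwise[where d2J = "\<lambda>w z. frechet_derivative (\<lambda>y. frechet_derivative K (at y) z) (at x) w"
        and d2V = "\<lambda>w z. frechet_derivative (\<lambda>y. frechet_derivative V (at y) z) (at x) w"])
    show "K x ** K x = - mat 1" by (rule K2[OF x])
    show "cov_rep c K x w ** K x = - (K x ** cov_rep c K x w)" for w
      using cov_rep_anticommute[OF c _ K[unfolded S_def], of x w] K2 x by (simp add: S_def)
    show "cov_rep c K x w = dK w + Gam c x w ** K x - K x ** Gam c x w" for w
      by (simp add: cov_rep_def dK_def)
    show "linear (cov_rep c K x)" by (rule linN[OF x])
    show "dN w z = frechet_derivative (\<lambda>y. frechet_derivative K (at y) z) (at x) w + (dG w z ** K x + Gam c x z ** dK w)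
        - (dK w ** Gam c x z + K x ** dG w z)" for w z
    proof -
      note f = smooth_on_frechet_derivative[OF K, of z]
      show ?thesis
        unfolding dN_def cov_rep_def
        by (simp add: frechet_derivative_minus[OF dif[OF smooth_on_add[OF op f smm[OF G K]]] dif[OF smm[OF K G]]]
            frechet_derivative_plus[OF dif[OF f] dif[OF smm[OF G K]]] dmm K G dK_def dG_def algebra_simps)
    qed
    show "frechet_derivative (\<lambda>y. frechet_derivative K (at y) z) (at x) w
        = frechet_derivative (\<lambda>y. frechet_derivative K (at y) w) (at x) z" for w z
      by (rule frechet_derivative_symmetric[OF op K x])
    show "frechet_derivative (\<lambda>y. frechet_derivative V (at y) z) (at x) w
        = frechet_derivative (\<lambda>y. frechet_derivative V (at y) w) (at x) z" for w z
      by (rule frechet_derivative_symmetric[OF op V x])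
    show "Gam c x w *v z = Gam c x z *v w" for w z
      by (rule Gam_sym[OF c x[unfolded S_def]])
    show "dG w z *v z' = dG w z' *v z" for w z z'
    proof -
      have "frechet_derivative (\<lambda>y. Gam c y z *v z') (at x) = frechet_derivative (\<lambda>y. Gam c y z' *v z) (at x)"
        by (rule frechet_derivative_cong_open[OF op x]) (rule Gam_sym[OF c], simp add: S_def)
      moreover have "frechet_derivative (\<lambda>y. Gam c y a *v b) (at x) w = dG w a *v b" for a b
        by (simp add: dmv[OF G smooth_on_const] dG_def)
      ultimately show ?thesis by metis
    qed
    show "grad_rep c V x = dV + Gam c x (V x)" by (simp add: grad_rep_def dV_def)
    show "dB w *v z = frechet_derivative (\<lambda>y. frechet_derivative V (at y) z) (at x) w + dG w z *v V x + Gam c x z *v (dV *v w)" for w z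
    proof -
      note f = smooth_on_frechet_derivative[OF V, of z]
      have "dB w *v z = frechet_derivative (\<lambda>y. grad_rep c V y *v z) (at x) w"
        by (simp add: dmv[OF B smooth_on_const] dB_def)
      also have "\<dots> = frechet_derivative (\<lambda>y. frechet_derivative V (at y) z + Gam c y z *v V y) (at x) w"
      proof -
        have "frechet_derivative (\<lambda>y. grad_rep c V y *v z) (at x) = frechet_derivative (\<lambda>y. frechet_derivative V (at y) z + Gam c y z *v V y) (at x)"
          by (rule frechet_derivative_cong_open[OF op x]) (rule grad_rep_apply[OF c _ V[unfolded S_def]], simp add: S_def)
        then show ?thesis by simp
      qed
      finally show ?thesis
        by (simp add: frechet_derivative_plus[OF dif[OF f] dif[OF smv[OF G V]]] dmv[OF G V] dV dG_def)
    qed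
    show "trace (dG w z) = trace (dG z w)" for w z
      unfolding dG_def by (rule trace_Gam_closed[OF c x[unfolded S_def]])
  qed
  show ?thesis
    unfolding Lambda_form_def ricci_form_def trace_add trace_scaleR covH covJ atp ext curv div1 div2
    by (rule key)
qed

end

section \<open>Two-parameter families\<close>

text \<open>A product of an odd number of endomorphisms anticommuting with \<open>F\<close>
  anticommutes with \<open>F\<close> as well; cyclicity then makes its trace equal to its own
  negative.\<close>

lemma trace_anticommute3:
  fixes F :: "real^'n^'n"
  assumes F: "F ** F = - mat 1" and X: "X ** F = - (F ** X)" and Y: "Y ** F = - (F ** Y)" and Z: "Z ** F = - (F ** Z)"
  shows "trace (X ** Y ** Z) = 0"
proof -
  have "X ** Y ** Z ** F = - (F ** (X ** Y ** Z))"
  proof -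
    have "X ** Y ** Z ** F = - (X ** (Y ** F) ** Z)"
      by (simp add: Z matrix_mul_assoc[symmetric] matrix_minus_left matrix_minus_right)
    also have "\<dots> = X ** F ** Y ** Z"
      by (simp add: Y matrix_mul_assoc matrix_minus_left matrix_minus_right)
    also have "\<dots> = - (F ** (X ** Y ** Z))"
      by (simp add: X matrix_mul_assoc matrix_minus_left)
    finally show ?thesis .
  qed
  then have "trace (F ** (X ** Y ** Z ** F)) = - trace (F ** F ** (X ** Y ** Z))"
    by (simp add: matrix_minus_right trace_minus matrix_mul_assoc)
  moreover have "trace (F ** (X ** Y ** Z ** F)) = trace (F ** F ** (X ** Y ** Z))"
    by (metis matrix_mul_assoc trace_mul_sym)
  ultimately show ?thesis by (simp add: F matrix_minus_left trace_minus)
qed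

text \<open>Here \<open>a\<close> and \<open>b\<close> stand for \<partial>_s J and \<partial>_t J,
  the letters \<open>dF\<close>, \<open>da\<close>, \<open>db\<close> for derivatives along
  \<open>u\<close>, and \<open>G\<close> for \<Gamma>_u.\<close>

lemma Lambda_closed_pointwise:
  fixes F G a b dF da db :: "real^'n^'n"
  assumes F: "F ** F = - mat 1" and a: "a ** F = - (F ** a)" and b: "b ** F = - (F ** b)"
    and dF: "dF ** F = - (F ** dF)"
  defines "N \<equiv> dF + G ** F - F ** G"
  shows "trace (b ** a ** N + b ** F ** (da + G ** a - a ** G)) - trace (a ** b ** N + a ** F ** (db + G ** b - b ** G))
    + trace (da ** F ** b + a ** dF ** b + a ** F ** db) = 0"
proof -
  define Na where "Na = da + G ** a - a ** G"
  define Nb where "Nb = db + G ** b - b ** G"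
  have N: "N ** F = - (F ** N)"
  proof -
    have "G ** F ** F = - G" "F ** F ** G = - G"
      by (metis F matrix_minus_right matrix_mul_assoc matrix_mul_rid) (simp add: F matrix_minus_left)
    then show ?thesis by (simp add: N_def matrix_distribs matrix_mul_assoc dF)
  qed
  \<comment> \<open>A commutator with \<open>G\<close> has trace zero; adding it turns the partial
    derivatives of the product into covariant ones.\<close>
  have "trace (G ** (a ** F ** b)) = trace (a ** F ** b ** G)" by (rule trace_mul_sym)
  then have 1: "trace (da ** F ** b + a ** dF ** b + a ** F ** db) = trace (Na ** F ** b + a ** N ** b + a ** F ** Nb)"
    by (simp add: Na_def Nb_def N_def matrix_distribs matrix_mul_assoc trace_add trace_sub)
  \<comment> \<open>By cyclicity and anticommutation this cancels the \<open>Na\<close> term of the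
    first trace; the \<open>Nb\<close> terms cancel as they stand.\<close>
  have "trace (Na ** F ** b) = trace (F ** b ** Na)" by (metis matrix_mul_assoc trace_mul_sym)
  then have 2: "trace (Na ** F ** b) = - trace (b ** F ** Na)" by (simp add: b matrix_minus_left trace_minus)
  have "trace (b ** a ** N) = 0" "trace (a ** b ** N) = 0" "trace (a ** N ** b) = 0"
    by (rule trace_anticommute3[OF F]; fact)+
  then show ?thesis
    unfolding 1 Na_def[symmetric] Nb_def[symmetric] by (simp add: trace_add 2)
qed

context volume_connection
begin

text \<open>The point and its chart do not move with s and t, so these derivatives act only on the
  coordinate expression \<open>F\<close> of the family.\<close>

lemma Lambda_family_closed:
  assumes fam: "smooth_family M A J"
    and J2: "\<And>s t q. q \<in> topspace M \<Longrightarrow> J s t q ** J s t q = - mat 1" and p: "p \<in> topspace M"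
  shows "deriv (\<lambda>s'. Lambda_form A D (J s' t) (partial_t J s' t) p u) s
    - deriv (\<lambda>t'. Lambda_form A D (J s t') (partial_s J s t') p u) t
    + 1/2 * dfun A (\<lambda>q. trace (partial_s J s t q ** J s t q ** partial_t J s t q)) p u = 0"
proof -
  define c where "c = chart_at A p"
  define x where "x = coord c p"
  define S where "S = coord c ` chart_dom c"
  \<comment> \<open>Parameters and coordinates form one open set, on which all directional
    derivatives commute.\<close>
  define Z where "Z = (UNIV :: (real \<times> real) set) \<times> S"
  define F where "F z = endo_rep A c (J (fst (fst z)) (snd (fst z))) (snd z)" for z
  define dd where "dd b G z = frechet_derivative G (at z) b"
    for b :: "(real \<times> real) \<times> (real^'n)" and G :: "(real \<times> real) \<times> (real^'n) \<Rightarrow> real^'n^'n" and z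
  define es et :: "(real \<times> real) \<times> (real^'n)" where "es = ((1, 0), 0)" and "et = ((0, 1), 0)"
  define z where "z = ((s, t), x)"
  \<comment> \<open>The Christoffel symbols are frozen at \<open>x\<close>: only s and t derivatives
    of \<Lambda> at \<open>p\<close> are taken, and these leave \<open>x\<close> fixed.\<close>
  define G where "G w = Gam c x w" for w
  \<comment> \<open>The coordinate expression of \<open>Lambda_form\<close> at \<open>p\<close> when
    its second argument is the derivative of the family in direction \<open>b\<close>; it has this
    meaning at points over \<open>x\<close>.\<close>
  define \<Phi> where "\<Phi> b z = map_trace (\<lambda>w. (dd (0, w) (dd b F) z + G w ** dd b F z - dd b F z ** G w) *v u)
      + 1/2 * trace (dd b F z ** F z ** (dd (0, u) F z + G u ** F z - F z ** G u))" for b z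
  have c: "c \<in> A" and pc: "p \<in> chart_dom c" using chart_at[OF p] chart_at_dom[OF p] by (auto simp: c_def)
  have op: "open S" and x: "x \<in> S" using open_coord_dom[OF c] pc by (auto simp: S_def x_def)
  have opZ: "open Z" and z: "z \<in> Z" using op x by (auto simp: Z_def z_def open_Times)
  note dom = openin_chart_dom[OF c]
  have toc: "to_chart A c p w = w" for w by (simp add: c_def to_chart_at p)
  have F: "smooth_on Z F"
  proof -
    have "topspace M \<inter> chart_dom c = chart_dom c" using chart_dom_topspace[OF c] by blast
    then have "smooth_on Z (\<lambda>((s, t), y). endo_rep A c (J s t) y)"
      using fam c by (auto simp: smooth_family_def Z_def S_def)
    moreover have "(\<lambda>((s, t), y). endo_rep A c (J s t) y) = F" by (auto simp: F_def fun_eq_iff)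
    ultimately show ?thesis by simp
  qed
  have sdd: "smooth_on Z (dd b P)" if "smooth_on Z P" for b P
    unfolding dd_def[abs_def] by (rule smooth_on_frechet_derivative[OF that])
  have F2: "F z ** F z = - mat 1" if "z \<in> Z" for z
    using endo_rep_square[OF c J2] that by (auto simp: F_def Z_def S_def)
  note slice = smooth_on_slice[where 'p = "real \<times> real", OF op, folded Z_def]
  note two = has_vector_derivative_two_parameters[OF op, folded Z_def]
  \<comment> \<open>The conjugating matrices do not depend on s and t, so partial derivatives of the
    bare values are conjugates of those of \<open>F\<close>.\<close>
  have Jq: "J s t q = matrix (from_chart A c q) ** F ((s, t), coord c q) ** matrix (to_chart A c q)"
    if q: "q \<in> chart_dom c" for s t q
  proof -
    have "matrix (from_chart A c q) ** (matrix (to_chart A c q) ** J s t q ** matrix (from_chart A c q)) ** matrix (to_chart A c q)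
        = (matrix (from_chart A c q) ** matrix (to_chart A c q)) ** J s t q ** (matrix (from_chart A c q) ** matrix (to_chart A c q))"
      by (simp add: matrix_mul_assoc)
    then show ?thesis by (simp add: F_def endo_rep_coord[OF c q] matrix_to_from_chart[OF c q])
  qed
  have bl: "bounded_linear (\<lambda>X. P ** X ** Q)" for P Q :: "real^'n^'n"
    using bounded_linear_compose[OF bounded_bilinear.bounded_linear_left[OF bounded_bilinear_matrix_matrix_mult]
        bounded_bilinear.bounded_linear_right[OF bounded_bilinear_matrix_matrix_mult]] .
  have pd: "partial_s J s t q = matrix (from_chart A c q) ** dd es F ((s, t), coord c q) ** matrix (to_chart A c q)"
    "partial_t J s t q = matrix (from_chart A c q) ** dd et F ((s, t), coord c q) ** matrix (to_chart A c q)"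
    if q: "q \<in> chart_dom c" for s t q
    unfolding partial_s_def partial_t_def dd_def es_def et_def Jq[OF q]
    using q by (auto intro!: vector_derivative_at bounded_linear.has_vector_derivative[OF bl] two[OF F] simp: S_def)
  have conj: "matrix (to_chart A c q) ** (matrix (from_chart A c q) ** X ** matrix (to_chart A c q)) ** matrix (from_chart A c q) = X"
    if q: "q \<in> chart_dom c" for q X
  proof -
    have "matrix (to_chart A c q) ** (matrix (from_chart A c q) ** X ** matrix (to_chart A c q)) ** matrix (from_chart A c q)
        = (matrix (to_chart A c q) ** matrix (from_chart A c q)) ** X ** (matrix (to_chart A c q) ** matrix (from_chart A c q))"
      by (simp add: matrix_mul_assoc)
    then show ?thesis by (simp add: matrix_to_from_chart[OF c q])
  qed
  have rep: "endo_rep A c (partial_s J s t) y = dd es F ((s, t), y)" "endo_rep A c (partial_t J s t) y = dd et F ((s, t), y)"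
    if "y \<in> S" for s t y
    using that by (auto simp: S_def endo_rep_coord[OF c] pd conj)
  have cov: "cov_endo A D H p w = dd (0, w) P ((s, t), x) + G w ** P ((s, t), x) - P ((s, t), x) ** G w"
    and atp: "H p = P ((s, t), x)"
    if H: "\<And>y. y \<in> S \<Longrightarrow> endo_rep A c H y = P ((s, t), y)" and P: "smooth_on Z P" for H P s t w
  proof -
    have sm: "smooth_on S (endo_rep A c H)"
      by (rule smooth_on_transfer[OF slice(1)[OF P, of "(s, t)"] op]) (simp add: H)
    have "frechet_derivative (endo_rep A c H) (at x) = frechet_derivative (\<lambda>y. P ((s, t), y)) (at x)"
      by (rule frechet_derivative_cong_open[OF op x H])
    then show "cov_endo A D H p w = dd (0, w) P ((s, t), x) + G w ** P ((s, t), x) - P ((s, t), x) ** G w"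
      using cov_endo_at[OF p sm[unfolded S_def c_def], of w] slice(2)[OF P x, of "(s, t)" w] H[OF x]
      by (simp add: c_def[symmetric] x_def[symmetric] cov_rep_def dd_def G_def)
    show "H p = P ((s, t), x)"
      using endo_rep_at[OF p, of H] H[OF x] by (simp add: c_def[symmetric] x_def[symmetric])
  qed
  have repJ: "endo_rep A c (J s t) y = F ((s, t), y)" for s t y by (simp add: F_def)
  have Lam: "Lambda_form A D (J s t) H p u = \<Phi> b ((s, t), x)"
    if H: "\<And>y. y \<in> S \<Longrightarrow> endo_rep A c H y = dd b F ((s, t), y)" for H b s t
    unfolding Lambda_form_def \<Phi>_def trace_add trace_scaleR
    using cov[OF H sdd[OF F]] cov[OF repJ F] atp[OF H sdd[OF F]] atp[OF repJ F] by simp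
  note mm = bounded_bilinear_matrix_matrix_mult and mv = bounded_bilinear_matrix_vector_mult
  note dif = smooth_on_differentiable[OF _ z]
  have smm: "smooth_on Z (\<lambda>y. P y ** Q y)" if "smooth_on Z P" "smooth_on Z Q" for P Q :: "_ \<Rightarrow> real^'n^'n"
    by (rule smooth_on_bounded_bilinear[OF mm opZ that])
  have dmm: "frechet_derivative (\<lambda>y. P y ** Q y) (at z) a = P z ** dd a Q z + dd a P z ** Q z"
    if "smooth_on Z P" "smooth_on Z Q" for P Q :: "_ \<Rightarrow> real^'n^'n" and a
    unfolding dd_def by (rule frechet_derivative_bilinear[OF mm dif[OF that(1)] dif[OF that(2)]])
  have scov: "smooth_on Z (\<lambda>z. dd (0, w) P z + G w ** P z - P z ** G w)" if P: "smooth_on Z P" for w P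
    by (intro smooth_on_diff smooth_on_add smm smooth_on_const opZ sdd P)
  have dcov: "frechet_derivative (\<lambda>z. dd (0, w) P z + G w ** P z - P z ** G w) (at z) a
      = dd a (dd (0, w) P) z + G w ** dd a P z - dd a P z ** G w" if P: "smooth_on Z P" for w P a
  proof -
    note f = sdd[OF P, of "(0, w)"] and l = smm[OF smooth_on_const P, of "G w"] and r = smm[OF P smooth_on_const, of "G w"]
    show ?thesis
      by (simp add: frechet_derivative_minus[OF dif[OF smooth_on_add[OF opZ f l]] dif[OF r]]
          frechet_derivative_plus[OF dif[OF f] dif[OF l]] dmm[OF smooth_on_const P] dmm[OF P smooth_on_const])
        (simp add: dd_def)
  qed
  have sv: "smooth_on Z (\<lambda>z. (dd (0, w) (dd b F) z + G w ** dd b F z - dd b F z ** G w) *v u)" for w b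
    by (rule smooth_on_bounded_bilinear[OF mv opZ scov[OF sdd[OF F]] smooth_on_const])
  have dv: "frechet_derivative (\<lambda>z. (dd (0, w) (dd b F) z + G w ** dd b F z - dd b F z ** G w) *v u) (at z) a
      = (dd a (dd (0, w) (dd b F)) z + G w ** dd a (dd b F) z - dd a (dd b F) z ** G w) *v u" for w b a
    using frechet_derivative_bilinear[OF mv dif[OF scov[OF sdd[OF F]]] dif[OF smooth_on_const]]
    by (simp add: dcov[OF sdd[OF F]])
  have comp: "smooth_on Z (\<lambda>z. P z $ k)" "frechet_derivative (\<lambda>z. P z $ k) (at z) a = frechet_derivative P (at z) a $ k"
    if P: "smooth_on Z P" for P :: "(real \<times> real) \<times> (real^'n) \<Rightarrow> real^'n" and k a
    by (rule smooth_on_bounded_linear[OF bounded_linear_vec_nth opZ P])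
      (rule frechet_derivative_bounded_linear[OF bounded_linear_vec_nth dif[OF P]])
  have st: "smooth_on Z (\<lambda>z. trace (P z))" "frechet_derivative (\<lambda>z. trace (P z)) (at z) a = trace (frechet_derivative P (at z) a)"
    if P: "smooth_on Z P" for P :: "(real \<times> real) \<times> (real^'n) \<Rightarrow> real^'n^'n" and a
    by (rule smooth_on_bounded_linear[OF bounded_linear_trace opZ P])
      (rule frechet_derivative_bounded_linear[OF bounded_linear_trace dif[OF P]])
  have mt: "smooth_on Z (\<lambda>z. map_trace (P z))"
    "frechet_derivative (\<lambda>z. map_trace (P z)) (at z) a = map_trace (\<lambda>w. frechet_derivative (\<lambda>z. P z w) (at z) a)"
    if P: "\<And>w. smooth_on Z (\<lambda>z. P z w)" for P :: "(real \<times> real) \<times> (real^'n) \<Rightarrow> real^'n \<Rightarrow> real^'n" and a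
    unfolding trace_matrix comp(2)[OF P, symmetric]
    by (intro smooth_on_sum opZ comp P) (rule frechet_derivative_sum, rule dif[OF comp(1)[OF P]])
  have half: "smooth_on Z (\<lambda>z. 1/2 * f z)" "frechet_derivative (\<lambda>z. 1/2 * f z) (at z) a = 1/2 * frechet_derivative f (at z) a"
    if f: "smooth_on Z f" for f :: "(real \<times> real) \<times> (real^'n) \<Rightarrow> real" and a
    by (rule smooth_on_bounded_linear[OF bounded_linear_mult_right opZ f])
      (rule frechet_derivative_bounded_linear[OF bounded_linear_mult_right dif[OF f]])
  let ?Q = "\<lambda>b z. dd b F z ** F z ** (dd (0, u) F z + G u ** F z - F z ** G u)"
  have sQ: "smooth_on Z (?Q b)" for b
    by (rule smm[OF smm[OF sdd[OF F] F] scov[OF F]])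
  have \<Phi>: "smooth_on Z (\<Phi> b)" for b
    unfolding \<Phi>_def[abs_def] by (rule smooth_on_add[OF opZ mt(1)[OF sv] half(1)[OF st(1)[OF sQ]]])
  have d\<Phi>: "frechet_derivative (\<Phi> b) (at z) a =
      map_trace (\<lambda>w. (dd a (dd (0, w) (dd b F)) z + G w ** dd a (dd b F) z - dd a (dd b F) z ** G w) *v u)
      + 1/2 * (trace (dd a (dd b F) z ** F z ** (dd (0, u) F z + G u ** F z - F z ** G u))
        + trace (dd b F z ** dd a F z ** (dd (0, u) F z + G u ** F z - F z ** G u)
          + dd b F z ** F z ** (dd a (dd (0, u) F) z + G u ** dd a F z - dd a F z ** G u)))" for a b
  proof -
    have dQ: "frechet_derivative (?Q b) (at z) a = dd b F z ** F z ** (dd a (dd (0, u) F) z + G u ** dd a F z - dd a F z ** G u)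
        + (dd b F z ** dd a F z + dd a (dd b F) z ** F z) ** (dd (0, u) F z + G u ** F z - F z ** G u)"
      by (simp only: dmm[OF smm[OF sdd[OF F] F] scov[OF F]]) (simp only: dd_def[of a "\<lambda>z. _ z"] dcov[OF F] dmm[OF sdd[OF F] F])
    show ?thesis
      unfolding \<Phi>_def[abs_def] frechet_derivative_plus[OF dif[OF mt(1)[OF sv]] dif[OF half(1)[OF st(1)[OF sQ]]]]
        mt(2)[OF sv] dv half(2)[OF st(1)[OF sQ]] st(2)[OF sQ] dQ matrix_add_rdistrib trace_add
      by (simp only: ac_simps)
  qed
  have sym: "dd a (dd b P) y = dd b (dd a P) y" if "smooth_on Z P" "y \<in> Z" for a b P y
    unfolding dd_def[abs_def] by (rule frechet_derivative_symmetric[OF opZ that])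
  have dd_cong: "dd a P y = dd a Q y" if "\<And>y. y \<in> Z \<Longrightarrow> P y = Q y" "y \<in> Z" for a P Q y
    unfolding dd_def using frechet_derivative_cong_open[OF opZ that(2), of P Q] that(1) by simp
  \<comment> \<open>Only two derivatives at a time can be exchanged, so \<open>es\<close> is moved
    past the spatial direction, past \<open>et\<close>, and \<open>et\<close> is then moved
    out.\<close>
  have sym3: "dd es (dd (0, w) (dd et F)) z = dd et (dd (0, w) (dd es F)) z" for w
  proof -
    have "dd es (dd (0, w) (dd et F)) z = dd (0, w) (dd es (dd et F)) z" by (rule sym[OF sdd[OF F] z])
    also have "\<dots> = dd (0, w) (dd et (dd es F)) z" by (rule dd_cong[OF sym[OF F] z])
    also have "\<dots> = dd et (dd (0, w) (dd es F)) z" by (rule sym[OF sdd[OF F] z])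
    finally show ?thesis .
  qed
  have anti: "dd b F z ** F z = - (F z ** dd b F z)" for b
  proof -
    have "0 = frechet_derivative (\<lambda>z. F z ** F z) (at z) b"
      by (rule frechet_derivative_const_on[OF opZ z F2, symmetric])
    also have "\<dots> = F z ** dd b F z + dd b F z ** F z" by (rule dmm[OF F F])
    finally show ?thesis by (simp add: eq_neg_iff_add_eq_0 add.commute)
  qed
  have d1: "deriv (\<lambda>s'. Lambda_form A D (J s' t) (partial_t J s' t) p u) s = frechet_derivative (\<Phi> et) (at z) es"
    using two(1)[OF \<Phi>[of et] x, of t s] Lam[OF rep(2)]
    by (simp add: DERIV_imp_deriv has_real_derivative_iff_has_vector_derivative z_def es_def)
  have d2: "deriv (\<lambda>t'. Lambda_form A D (J s t') (partial_s J s t') p u) t = frechet_derivative (\<Phi> es) (at z) et"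
    using two(2)[OF \<Phi>[of es] x, of s t] Lam[OF rep(1)]
    by (simp add: DERIV_imp_deriv has_real_derivative_iff_has_vector_derivative z_def et_def)
  have d3: "dfun A (\<lambda>q. trace (partial_s J s t q ** J s t q ** partial_t J s t q)) p u =
      trace (dd (0, u) (dd es F) z ** F z ** dd et F z + dd es F z ** dd (0, u) F z ** dd et F z
        + dd es F z ** F z ** dd (0, u) (dd et F) z)"
  proof -
    let ?g = "\<lambda>z. dd es F z ** F z ** dd et F z"
    have sg: "smooth_on Z ?g" by (rule smm[OF smm[OF sdd[OF F] F] sdd[OF F]])
    have "trace (partial_s J s t q ** J s t q ** partial_t J s t q) = trace (?g ((s, t), coord c q))"
      if q: "q \<in> chart_dom c" for q
    proof -
      let ?P = "matrix (to_chart A c q)" and ?R = "matrix (from_chart A c q)"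
      let ?a = "dd es F ((s, t), coord c q)" and ?f = "F ((s, t), coord c q)" and ?b = "dd et F ((s, t), coord c q)"
      have "partial_s J s t q ** J s t q ** partial_t J s t q = ?R ** ?a ** (?P ** ?R) ** ?f ** (?P ** ?R) ** ?b ** ?P"
        by (simp add: pd[OF q] Jq[OF q] matrix_mul_assoc)
      also have "\<dots> = ?R ** (?a ** ?f ** ?b) ** ?P"
        by (simp add: matrix_to_from_chart[OF c q] matrix_mul_assoc)
      finally show ?thesis by (simp add: trace_conjugate[OF matrix_to_from_chart(1)[OF c q]])
    qed
    from dfun_rep_cong[OF c dom order_refl pc slice(1)[OF st(1)[OF sg], of "(s, t)", unfolded S_def] this]
    have "dfun A (\<lambda>q. trace (partial_s J s t q ** J s t q ** partial_t J s t q)) p u =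
        frechet_derivative (\<lambda>y. trace (?g ((s, t), y))) (at x) u"
      by (simp add: toc x_def)
    also have "\<dots> = trace (frechet_derivative ?g (at z) (0, u))"
      using slice(2)[OF st(1)[OF sg] x, of "(s, t)" u] st(2)[OF sg] by (simp add: z_def)
    also have "frechet_derivative ?g (at z) (0, u) = dd es F z ** F z ** dd (0, u) (dd et F) z
        + (dd es F z ** dd (0, u) F z + dd (0, u) (dd es F) z ** F z) ** dd et F z"
      by (simp only: dmm[OF smm[OF sdd[OF F] F] sdd[OF F]]) (simp only: dd_def[of "(0, u)" "\<lambda>z. _ z"] dmm[OF sdd[OF F] F])
    finally show ?thesis by (simp add: matrix_add_rdistrib algebra_simps)
  qed
  have key: "trace (dd et F z ** dd es F z ** (dd (0, u) F z + G u ** F z - F z ** G u)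
        + dd et F z ** F z ** (dd (0, u) (dd es F) z + G u ** dd es F z - dd es F z ** G u))
      - trace (dd es F z ** dd et F z ** (dd (0, u) F z + G u ** F z - F z ** G u)
        + dd es F z ** F z ** (dd (0, u) (dd et F) z + G u ** dd et F z - dd et F z ** G u))
      + trace (dd (0, u) (dd es F) z ** F z ** dd et F z + dd es F z ** dd (0, u) F z ** dd et F z
        + dd es F z ** F z ** dd (0, u) (dd et F) z) = 0"
    by (rule Lambda_closed_pointwise[OF F2[OF z] anti anti anti])
  \<comment> \<open>\<open>m\<close> collects the traces containing \<partial>_s \<partial>_t J
    linearly, \<open>r\<close> its product with J and \<nabla>_u J; both agree in the two \<Lambda>
    derivatives and cancel.\<close>
  have arith: "m + 1/2 * (r + e) - (m + 1/2 * (r + f)) + 1/2 * g = 0" if "e - f + g = 0" for m r e f g :: real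
    using that by (simp add: field_simps)
  show ?thesis
    unfolding d1 d2 d3 d\<Phi> sym3 sym[OF F z, of es et] sym[OF F z, of es "(0, u)"] sym[OF F z, of et "(0, u)"]
    by (rule arith[OF key])
qed

end

theorem theoremB:
  fixes M :: "'a topology" and A :: "('a, 'n::finite) chart set" and n :: nat
    and \<rho> :: "'a \<Rightarrow> (real^'n) list \<Rightarrow> real"
    and D :: "('a, 'n) connection"
    and v :: "'a \<Rightarrow> real^'n"
  assumes "CARD('n) = 2 * n"
    and "closed_connected_oriented_manifold M A"
    and "positive_volume_form M A \<rho>"
    and "affine_connection M A D" and "torsion_free M A D"
    and "parallel_form M A D (2 * n) \<rho>"
    and "smooth_vf A (topspace M) v"
  shows "(\<forall>J. almost_complex_structure M A J \<longrightarrow>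
            (\<forall>p\<in>topspace M. \<forall>u.
               Lambda_form A D J (lie_endo A v J) p u =
                 2 * ricci_form A D J p (v p) u
                 - dfun A (divergence A \<rho> v) p (J p *v u)
                 + dfun A (divergence A \<rho> (endo_app J v)) p u)) \<and>
         (\<forall>J. smooth_family M A J \<longrightarrow> (\<forall>s t. almost_complex_structure M A (J s t)) \<longrightarrow>
            (\<forall>s t. \<forall>p\<in>topspace M. \<forall>u.
               deriv (\<lambda>s'. Lambda_form A D (J s' t) (partial_t J s' t) p u) s
               - deriv (\<lambda>t'. Lambda_form A D (J s t') (partial_s J s t') p u) t
               + 1/2 * dfun A (\<lambda>q. trace (partial_s J s t q ** J s t q ** partial_t J s t q)) p u
               = 0))"
proof -
  interpret volume_connection M A D \<rho>
    using assms by unfold_locales (simp_all add: closed_connected_oriented_manifold_def)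
  show ?thesis
    using Lambda_lie[OF _ _ assms(7)] Lambda_family_closed
    by (simp add: almost_complex_structure_def)
qed

end
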